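(* Let $M$ be the complex built from sixty $4$-simplices $\Delta_0,\dots,\Delta_{59}$ by the gluing table in the context, and let $O$ be the complete hyperbolic $4$-orbifold with underlying space $M\cong\mathbb{P}^2$ obtained by identifying each $\Delta_j$ with the compact hyperbolic Coxeter simplex $\mathcal{S}\subset\mathbb{H}^4$ by the vertex-label-preserving map. Then $O$ is arithmetic; that is, writing $O=\mathbb{H}^4/\Gamma$, the group $\Gamma$ is an arithmetic lattice in $\mathrm{O}^+(4,1)$.
   Context: **The complex $M$.** Take sixty $4$-simplices $\Delta_0,\dots,\Delta_{59}$, each with vertices labeled $0,1,2,3,4$. For distinct labels $a_0,\dots,a_d$, let $\Delta_j(a_0\cdots a_d)$ be the face of $\Delta_j$ spanned by the vertices with those labels. The entry $j:\ (k_1,k_2,k_3,k_4,k_5)$ below means that the $3$-faces $\Delta_j(0123)$, $\Delta_j(0124)$, $\Delta_j(0134)$, $\Delta_j(0234)$, $\Delta_j(1234)$ are glued respectively to the faces with the same labels of $\Delta_{k_1},\Delta_{k_2},\Delta_{k_3},\Delta_{k_4},\Delta_{k_5}$, by the affine map preserving vertex labels. $M$ is the quotient space. 0: (1,1,2,3,2); 1: (0,0,4,5,6); 2: (4,6,0,7,0); 3: (5,5,8,0,9); 4: (2,10,1,11,10); 5: (3,3,12,1,13); 6: (10,2,10,14,1); 7: (11,14,15,2,16); 8: (12,17,3,15,18); 9: (19,13,18,16,3); 10: (6,4,6,20,4); 11: (7,20,21,4,22); 12: (8,23,5,21,24); 13: (23,9,24,25,5); 14: (20,7,26,6,25); 15: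 (21,27,7,8,28); 16: (29,25,28,9,7); 17: (24,8,23,27,30); 18: (30,30,9,31,8); 19: (9,24,30,29,23); 20: (14,11,32,10,33); 21: (15,34,11,12,35); 22: (36,33,35,33,11); 23: (13,12,17,34,19); 24: (17,19,13,37,12); 25: (34,16,38,13,14); 26: (32,39,14,32,38); 27: (37,15,39,17,40); 28: (41,40,16,42,15); 29: (16,37,41,19,36); 30: (18,18,19,43,17); 31: (43,43,42,18,42); 32: (26,44,20,26,45); 33: (46,22,45,22,20); 34: (25,21,44,23,46); 35: (47,46,22,48,21); 36: (22,48,47,46,29); 37: (27,29,49,24,48); 38: (44,50,25,49,26); 39: (49,26,27,44,50); 40: (51,28,50,52,27); 41: (28,51,29,53,47); 42: (53,52,31,28,31); 43: (31,31,53,30,52); 44: (38,32,34,39,54); 45: (54,54,33,55,32); 46: (33,35,54,36,34); 47: (35,56,36,56,41); 48: (56,36,55,35,37); 49: (39,57,37,38,55); 50: (57,38,40,57,39); 51: (40,41,57,58,56); 52: (58,42,58,40,43); 53: (42,58,43,41,58); 54: (45,45,46,59,44); 55: (59,59,48,45,49); 56: (48,47,59,47,51); 57: (50,49,51,50,59); 58: (52,53,52,51,53); 59: (55,55,56,54,57). **The simplex $\mathcal{S}$.** $\mathcal{S}$ is the compact Coxeter simplex in $\mathbb{H}^4$ (found by Lannér) whose Coxeter diagram is a $5$-cycle in which four edges correspond to dihedral angle $\pi/3$ and one (doubled) edge corresponds to dihedral angle $\pi/4$, all other dihedral angles being $\pi/2$. Label its vertices $0,\dots,4$ so that the dihedral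 angle $\theta(a\,b\,c)$ at the $2$-dimensional face spanned by vertices $a,b,c$ satisfies $\theta(0\,1\,2)=\pi/4$, $\theta(0\,1\,4)=\theta(0\,3\,4)=\theta(2\,3\,4)=\theta(1\,2\,3)=\pi/3$, and $\theta=\pi/2$ at the remaining five triangles. **Known facts about the setting.** $M$ is a PL manifold homeomorphic to the complex projective plane $\mathbb{P}^2$, and identifying each $\Delta_j$ with $\mathcal{S}$ by vertex labels equips $M$ with a complete hyperbolic orbifold metric; $O$ denotes this orbifold. *)

theory Defs
  imports "HOL-Analysis.Analysis" "HOL-Algebra.Coset"
begin

section \<open>The complex\<close>

text \<open>Vertex labels are the elements $0,\dots,4$ of the type \<^typ>\<open>5\<close>. Row $j$, entry by entry, lists
  the simplices glued to the facets $0123$, $0124$, $0134$, $0234$, $1234$ of the $j$-th simplex,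
  that is, to the facets opposite to the vertices $4,3,2,1,0$.\<close>

definition gluing_table :: "(nat \<times> nat \<times> nat \<times> nat \<times> nat) list" where
  "gluing_table =
  [(1,1,2,3,2), (0,0,4,5,6), (4,6,0,7,0), (5,5,8,0,9),
   (2,10,1,11,10), (3,3,12,1,13), (10,2,10,14,1), (11,14,15,2,16),
   (12,17,3,15,18), (19,13,18,16,3), (6,4,6,20,4), (7,20,21,4,22),
   (8,23,5,21,24), (23,9,24,25,5), (20,7,26,6,25), (21,27,7,8,28),
   (29,25,28,9,7), (24,8,23,27,30), (30,30,9,31,8), (9,24,30,29,23),
   (14,11,32,10,33), (15,34,11,12,35), (36,33,35,33,11), (13,12,17,34,19),
   (17,19,13,37,12), (34,16,38,13,14), (32,39,14,32,38), (37,15,39,17,40),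
   (41,40,16,42,15), (16,37,41,19,36), (18,18,19,43,17), (43,43,42,18,42),
   (26,44,20,26,45), (46,22,45,22,20), (25,21,44,23,46), (47,46,22,48,21),
   (22,48,47,46,29), (27,29,49,24,48), (44,50,25,49,26), (49,26,27,44,50),
   (51,28,50,52,27), (28,51,29,53,47), (53,52,31,28,31), (31,31,53,30,52),
   (38,32,34,39,54), (54,54,33,55,32), (33,35,54,36,34), (35,56,36,56,41),
   (56,36,55,35,37), (39,57,37,38,55), (57,38,40,57,39), (40,41,57,58,56),
   (58,42,58,40,43), (42,58,43,41,58), (45,45,46,59,44), (59,59,48,45,49),
   (48,47,59,47,51), (50,49,51,50,59), (52,53,52,51,53), (55,55,56,54,57)]"

definition facet_neighbour :: "nat \<Rightarrow> 5 \<Rightarrow> nat" where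
  "facet_neighbour j i = (case gluing_table ! j of (k1, k2, k3, k4, k5) \<Rightarrow>
     if i = 4 then k1 else if i = 3 then k2 else if i = 2 then k3 else if i = 1 then k4 else k5)"

definition std_simplex :: "(real^5) set" where
  "std_simplex = {t. (\<forall>i. 0 \<le> t $ i) \<and> (\<Sum>i\<in>UNIV. t $ i) = 1}"

text \<open>The point with barycentric coordinates \<open>t\<close> in the \<open>j\<close>-th simplex is the pair \<open>(j, t)\<close>; the
  facet opposite to \<open>i\<close> is \<open>t $ i = 0\<close>, and a label-preserving affine gluing keeps \<open>t\<close>.\<close>

definition simplices :: "(nat \<times> (real^5)) set" where
  "simplices = {..<60} \<times> std_simplex"

definition glued :: "nat \<times> (real^5) \<Rightarrow> nat \<times> (real^5) \<Rightarrow> bool" where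
  "glued p q \<longleftrightarrow> p \<in> simplices \<and> q \<in> simplices \<and> snd q = snd p \<and>
     (\<exists>i. snd p $ i = 0 \<and> fst q = facet_neighbour (fst p) i)"

definition glue_class :: "nat \<times> (real^5) \<Rightarrow> (nat \<times> (real^5)) set" where
  "glue_class p = {q. equivclp glued p q}"

definition quotient_topology :: "'a topology \<Rightarrow> ('a \<Rightarrow> 'b) \<Rightarrow> 'b topology" where
  "quotient_topology X f =
     topology (\<lambda>U. U \<subseteq> f ` topspace X \<and> openin X {x \<in> topspace X. f x \<in> U})"

lemma openin_quotient_topology:
  "openin (quotient_topology X f) U \<longleftrightarrow>
     U \<subseteq> f ` topspace X \<and> openin X {x \<in> topspace X. f x \<in> U}"
proof -
  let ?P = "\<lambda>U. {x \<in> topspace X. f x \<in> U}"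
  have "openin X (?P (S \<inter> T))" if "openin X (?P S)" "openin X (?P T)" for S T
  proof -
    have "?P (S \<inter> T) = ?P S \<inter> ?P T"
      by blast
    with that show ?thesis
      by (simp only: openin_Int)
  qed
  moreover have "openin X (?P (\<Union>K))" if "\<forall>S\<in>K. openin X (?P S)" for K
  proof -
    have "?P (\<Union>K) = \<Union>(?P ` K)"
      by blast
    moreover have "openin X (\<Union>(?P ` K))"
      using that by (intro openin_Union) blast
    ultimately show ?thesis
      by (simp only:)
  qed
  ultimately have "istopology (\<lambda>U. U \<subseteq> f ` topspace X \<and> openin X (?P U))"
    unfolding istopology_def by (intro conjI allI impI) blast+
  from topology_inverse'[OF this] show ?thesis
    by (simp only: quotient_topology_def)
qed

lemma quotient_map_quotient_topology: "quotient_map X (quotient_topology X f) f"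
proof -
  have "topspace (quotient_topology X f) = f ` topspace X"
  proof
    show "topspace (quotient_topology X f) \<subseteq> f ` topspace X"
      using openin_topspace[of "quotient_topology X f"] openin_quotient_topology[of X f]
      by (simp only:)
    have "{x \<in> topspace X. f x \<in> f ` topspace X} = topspace X"
      by auto
    then have "openin (quotient_topology X f) (f ` topspace X)"
      by (simp add: openin_quotient_topology)
    then show "f ` topspace X \<subseteq> topspace (quotient_topology X f)"
      by (rule openin_subset)
  qed
  then show ?thesis
    unfolding quotient_map_def openin_quotient_topology by simp
qed

definition complex_M :: "(nat \<times> (real^5)) set topology" where
  "complex_M = quotient_topology (top_of_set simplices) glue_class"


section \<open>Hyperbolic space and its isometry group\<close>

text \<open>The hyperboloid model; coordinate $4$ is timelike.\<close>

definition lorentz :: "real^5 \<Rightarrow> real^5 \<Rightarrow> real" where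
  "lorentz x y = (\<Sum>i\<in>UNIV - {4}. x $ i * y $ i) - x $ 4 * y $ 4"

definition H4 :: "(real^5) set" where
  "H4 = {x. lorentz x x = -1 \<and> x $ 4 > 0}"

definition O41 :: "(real^5^5) monoid" where
  "O41 = \<lparr>carrier = {A. (\<forall>x y. lorentz (A *v x) (A *v y) = lorentz x y) \<and> (\<forall>x\<in>H4. A *v x \<in> H4)},
          monoid.mult = (**), one = mat 1\<rparr>"

definition orbit_of :: "(real^5^5) set \<Rightarrow> real^5 \<Rightarrow> (real^5) set" where
  "orbit_of \<Gamma> x = {A *v x | A. A \<in> \<Gamma>}"

definition H4_mod :: "(real^5^5) set \<Rightarrow> (real^5) set topology" where
  "H4_mod \<Gamma> = quotient_topology (top_of_set H4) (orbit_of \<Gamma>)"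

text \<open>In the cone over the hyperboloid, writing $x = r u$ with $r > 0$ and $u$ on the hyperboloid,
  Lebesgue measure is $r^4\,dr\,d\mathrm{vol}(u)$, and $\int_0^1 r^4\,dr = 1/5$.\<close>

definition hyperbolic_volume :: "(real^5) set \<Rightarrow> ennreal" where
  "hyperbolic_volume F = 5 * emeasure lborel {r *\<^sub>R u | r u. 0 < r \<and> r \<le> 1 \<and> u \<in> F}"

text \<open>Point stabilizers in the isometry group are compact, so finite covolume in the group (for Haar
  measure) is the same as finite volume of the quotient of hyperbolic space, i.e. the existence of a
  Borel set of finite volume whose translates cover.\<close>

definition hyperbolic_lattice :: "(real^5^5) set \<Rightarrow> bool" where
  "hyperbolic_lattice \<Gamma> \<longleftrightarrow> subgroup \<Gamma> O41 \<and> discrete \<Gamma> \<and>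
     (\<exists>F\<in>sets borel. F \<subseteq> H4 \<and> H4 \<subseteq> (\<Union>A\<in>\<Gamma>. (\<lambda>x. A *v x) ` F) \<and> hyperbolic_volume F < \<infinity>)"


section \<open>The Coxeter simplex\<close>

definition outer_normal :: "(5 \<Rightarrow> real^5) \<Rightarrow> 5 \<Rightarrow> real^5" where
  "outer_normal v i =
     (THE n. lorentz n n = 1 \<and> (\<forall>j. j \<noteq> i \<longrightarrow> lorentz n (v j) = 0) \<and> lorentz n (v i) < 0)"

text \<open>The dihedral angle between the facets opposite to \<open>d\<close> and \<open>e\<close>, that is, the angle at the
  triangle spanned by the other three vertices.\<close>

definition dihedral_angle :: "(5 \<Rightarrow> real^5) \<Rightarrow> 5 \<Rightarrow> 5 \<Rightarrow> real" where
  "dihedral_angle v d e = arccos (- lorentz (outer_normal v d) (outer_normal v e))"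

definition lanner_simplex :: "(5 \<Rightarrow> real^5) \<Rightarrow> bool" where
  "lanner_simplex v \<longleftrightarrow> range v \<subseteq> H4 \<and> inj v \<and> independent (range v) \<and>
     (\<forall>a b c d e. {a, b, c, d, e} = UNIV \<longrightarrow>
        dihedral_angle v d e =
          (if {a, b, c} = {0, 1, 2} then pi / 4
           else if {a, b, c} \<in> {{0, 1, 4}, {0, 3, 4}, {2, 3, 4}, {1, 2, 3}} then pi / 3
           else pi / 2))"

text \<open>The label-preserving identification of the standard simplex with the hyperbolic simplex with
  vertices \<open>v\<close>: take the linear combination and project radially to the hyperboloid.\<close>

definition simplex_map :: "(5 \<Rightarrow> real^5) \<Rightarrow> real^5 \<Rightarrow> real^5" where
  "simplex_map v t = (let w = (\<Sum>i\<in>UNIV. t $ i *\<^sub>R v i) in (1 / sqrt (- lorentz w w)) *\<^sub>R w)"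


section \<open>The orbifold as a quotient of hyperbolic space\<close>

text \<open>$O = \mathbb{H}^4/\Gamma$: the underlying space of the quotient is the complex, and in the quotient each of the
  sixty simplices carries the geometry of the Coxeter simplex, i.e. its label-preserving
  identification with the simplex followed by a hyperbolic isometry is a lift of its inclusion.\<close>

definition uniformizes_O :: "(5 \<Rightarrow> real^5) \<Rightarrow> (real^5^5) set \<Rightarrow> bool" where
  "uniformizes_O v \<Gamma> \<longleftrightarrow> subgroup \<Gamma> O41 \<and> discrete \<Gamma> \<and>
     (\<exists>h. homeomorphic_map complex_M (H4_mod \<Gamma>) h \<and>
        (\<forall>j<60. \<exists>g\<in>carrier O41. \<forall>t\<in>std_simplex.
           h (glue_class (j, t)) = orbit_of \<Gamma> (g *v simplex_map v t)))"


section \<open>Arithmetic subgroups\<close>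

definition finite_index :: "('a, 'b) monoid_scheme \<Rightarrow> 'a set \<Rightarrow> 'a set \<Rightarrow> bool" where
  "finite_index G A B \<longleftrightarrow> finite (rcosets\<^bsub>G\<lparr>carrier := A\<rparr>\<^esub> B)"

definition commensurable :: "('a, 'b) monoid_scheme \<Rightarrow> 'a set \<Rightarrow> 'a set \<Rightarrow> bool" where
  "commensurable G A B \<longleftrightarrow> finite_index G A (A \<inter> B) \<and> finite_index G B (A \<inter> B)"

text \<open>Complex matrices of arbitrary size \<open>N\<close> are functions vanishing outside \<open>{..<N} \<times> {..<N}\<close>, so that
  the product topology of the function type is the usual topology on them.\<close>

type_synonym cmatrix = "nat \<Rightarrow> nat \<Rightarrow> complex"

definition matrix_monoid :: "nat \<Rightarrow> cmatrix monoid" where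
  "matrix_monoid N =
     \<lparr>carrier = {A. \<forall>i j. \<not> (i < N \<and> j < N) \<longrightarrow> A i j = 0},
      monoid.mult = (\<lambda>A B i j. \<Sum>k<N. A i k * B k j),
      one = (\<lambda>i j. if i = j \<and> i < N then 1 else 0)\<rparr>"

definition GL :: "nat \<Rightarrow> cmatrix monoid" where
  "GL N = units_of (matrix_monoid N)"

inductive rational_polynomial :: "nat \<Rightarrow> (cmatrix \<Rightarrow> complex) \<Rightarrow> bool" for N where
  const: "c \<in> \<rat> \<Longrightarrow> rational_polynomial N (\<lambda>A. c)"
| entry: "i < N \<Longrightarrow> j < N \<Longrightarrow> rational_polynomial N (\<lambda>A. A i j)"
| add: "rational_polynomial N f \<Longrightarrow> rational_polynomial N g \<Longrightarrow> rational_polynomial N (\<lambda>A. f A + g A)"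
| mult: "rational_polynomial N f \<Longrightarrow> rational_polynomial N g \<Longrightarrow> rational_polynomial N (\<lambda>A. f A * g A)"

definition algebraic_group_over_Q :: "nat \<Rightarrow> cmatrix set \<Rightarrow> bool" where
  "algebraic_group_over_Q N H \<longleftrightarrow> subgroup H (GL N) \<and>
     (\<exists>P. (\<forall>f\<in>P. rational_polynomial N f) \<and> H = {A \<in> carrier (GL N). \<forall>f\<in>P. f A = 0})"

definition real_points :: "cmatrix set \<Rightarrow> cmatrix set" where
  "real_points H = {A \<in> H. \<forall>i j. A i j \<in> \<real>}"

definition integer_points :: "nat \<Rightarrow> cmatrix set \<Rightarrow> cmatrix set" where
  "integer_points N H = {A \<in> H. \<forall>i j. A i j \<in> \<int> \<and> (inv\<^bsub>GL N\<^esub> A) i j \<in> \<int>}"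

text \<open>For a semisimple Lie group \<open>G\<close>: up to commensurability, the image of the integer points of a
  linear algebraic group over the rationals under a continuous epimorphism of its real points onto
  \<open>G\<close> with compact kernel. Semisimplicity of \<open>H\<close> need not be required: compactness of the kernel
  forces the unipotent radical of \<open>H\<close> to be trivial and the real points of the central torus to be
  compact, so this torus has finitely many integer points and replacing \<open>H\<close> by its derived group
  changes the image of the integer points only up to commensurability.\<close>

definition arithmetic_subgroup :: "('g :: topological_space) monoid \<Rightarrow> 'g set \<Rightarrow> bool" where
  "arithmetic_subgroup G \<Gamma> \<longleftrightarrow> subgroup \<Gamma> G \<and>
     (\<exists>N H \<phi>. algebraic_group_over_Q N H \<and>
        \<phi> \<in> hom (GL N\<lparr>carrier := real_points H\<rparr>) G \<and>
        \<phi> ` real_points H = carrier G \<and>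
        continuous_on (real_points H) \<phi> \<and>
        compact (kernel (GL N\<lparr>carrier := real_points H\<rparr>) G \<phi>) \<and>
        commensurable G \<Gamma> (\<phi> ` integer_points N H))"

definition arithmetic_lattice :: "(real^5^5) set \<Rightarrow> bool" where
  "arithmetic_lattice \<Gamma> \<longleftrightarrow> hyperbolic_lattice \<Gamma> \<and> arithmetic_subgroup O41 \<Gamma>"

end

theory Submission
  imports Defs "HOL-Algebra.Generated_Groups"
begin

text \<open>The fundamental group $\Gamma$ of the orbifold and the group $W$ generated by the reflections in the
facets of one lifted simplex have a common subgroup of finite index, and $W$ is arithmetic because
its Gram matrix has entries in $\mathbb{Z}[\sqrt 2]$ (after doubling) and a positive definite Galois
conjugate.

The comparison with $W$ rests on the gluing. Let $g_j$ place the $j$-th simplex in hyperbolic space.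
If the facet $i$ of simplex $j$ is glued to simplex $k$, the two placements agree on that facet up
to an element $A$ of $\Gamma$. Hence $A g_j$ and $g_k$ differ by an isometry that fixes a hyperplane
pointwise: the identity or the reflection $r_i$. The identity would identify interior points of the
simplices $j$ and $k$, and no row of the gluing table lists its own index. So $g_j r_i \in \Gamma
g_k$ (\<open>neighbouring_lifts\<close>), and by induction $g_0 W$ is covered by the sixty cosets
$\Gamma g_k$. When $g_0 = 1$, which can be arranged by moving the simplex, $\Gamma \cap W$ therefore
has finite index in $W$.

On the other side, let $q_{\pm}$ be the forms whose Gram matrices are $C_0 \pm \sqrt 2\, C_1$, twice
the Gram matrix of the unit normals and its conjugate. Writing $\sqrt 2$ as a $2 \times 2$ matrix
turns the pairs $(P, Q) \in \mathrm{O}(q_+) \times \mathrm{O}(q_-)$ into an algebraic group of $10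
\times 10$ matrices over $\mathbb{Q}$, whose integer points are the isometries of $q_+$ over
$\mathbb{Z}[\sqrt 2]$. As $q_+$ is equivalent to the Lorentz form and $q_-$ is positive definite
(\<open>conjugate_lanner_form_definite\<close>), the real points map onto $\mathrm{O}^+(4,1)$ by
$(P, Q) \mapsto \pm P$, with compact kernel. Let $\Lambda$ be the image of the integer points. It is
discrete, because bounding $P$ bounds the integral matrix of $(P, Q)$, and it contains $W$.

Both commensurability and finite covolume now follow from one covering statement: for some $R$ the
translates of the ball of radius $R$ under $\Gamma \cap \Lambda$ cover hyperbolic space
(\<open>common_subgroup_cobounded\<close>). A discrete group that contains such a subgroup contains
it with finite index (\<open>finite_index_if_cobounded\<close>). The covering statement holds since
$W$ moves every point into the simplex: in the orbit of $x$ under the discrete group $W$, choose the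
point closest to the sum of the vertices; were it on the wrong side of a facet, reflecting it would
bring it closer (\<open>reflection_group_moves_into_chamber\<close>).\<close>

section \<open>The index type with five elements\<close>

lemma UNIV_5: "(UNIV::5 set) = {0,1,2,3,4}"
proof -
  have "card {0,1,2,3,4::5} = 5" by simp
  then show ?thesis by (intro card_seteq[symmetric]) auto
qed

lemma sum_UNIV_5: "(\<Sum>i\<in>UNIV. f i) = f 0 + f 1 + f 2 + f 3 + f (4::5)"
  for f :: "5 \<Rightarrow> 'a::comm_monoid_add"
  unfolding UNIV_5 by (simp add: add.assoc)

lemma forall_5: "(\<forall>i::5. P i) \<longleftrightarrow> P 0 \<and> P 1 \<and> P 2 \<and> P 3 \<and> P 4"
proof -
  have "(\<forall>i\<in>{0,1,2,3,4::5}. P i) \<longleftrightarrow> P 0 \<and> P 1 \<and> P 2 \<and> P 3 \<and> P 4" by simp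
  then show ?thesis by (metis UNIV_5 UNIV_I)
qed

lemma cases_5: "i = 0 \<or> i = 1 \<or> i = 2 \<or> i = 3 \<or> i = 4" for i :: 5
  using UNIV_I[of i] unfolding UNIV_5 by simp

section \<open>The Lorentz form\<close>

text \<open>The Gram matrix of the Lorentz form; it turns preservation of the form into a matrix
  equation.\<close>

definition eta :: "real^5^5" where
  "eta = (\<chi> i j. if i = j then (if i = 4 then -1 else 1) else 0)"

lemma lorentz_expand:
  "lorentz x y = x$0 * y$0 + x$1 * y$1 + x$2 * y$2 + x$3 * y$3 - x$4 * y$4"
proof -
  have "UNIV - {4::5} = {0,1,2,3}" unfolding UNIV_5 by auto
  then show ?thesis by (simp add: lorentz_def)
qed

lemma eta_mult_vec: "(eta *v x) $ i = (if i = 4 then - x$4 else x$i)"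
  by (simp add: eta_def matrix_vector_mult_def if_distrib[where f="\<lambda>c. c * _"] sum.delta' cong: if_cong)

lemma lorentz_inner: "lorentz x y = x \<bullet> (eta *v y)"
  by (simp add: lorentz_expand inner_vec_def sum_UNIV_5 eta_mult_vec)

lemma lorentz_sym: "lorentz x y = lorentz y x"
  by (simp add: lorentz_expand algebra_simps)

lemma lorentz_bilinear [simp]:
  "lorentz (x + y) z = lorentz x z + lorentz y z"
  "lorentz z (x + y) = lorentz z x + lorentz z y"
  "lorentz (x - y) z = lorentz x z - lorentz y z"
  "lorentz z (x - y) = lorentz z x - lorentz z y"
  "lorentz (c *\<^sub>R x) z = c * lorentz x z"
  "lorentz z (c *\<^sub>R x) = c * lorentz z x"
  "lorentz (- x) z = - lorentz x z"
  "lorentz z (- x) = - lorentz z x"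
  "lorentz 0 z = 0"
  "lorentz z 0 = 0"
  by (simp_all add: lorentz_expand algebra_simps)

lemma lorentz_sum:
  "lorentz (\<Sum>i\<in>I. f i) z = (\<Sum>i\<in>I. lorentz (f i) z)"
  "lorentz z (\<Sum>i\<in>I. f i) = (\<Sum>i\<in>I. lorentz z (f i))"
  by (induction I rule: infinite_finite_induct) auto

lemma lorentz_nondegenerate:
  assumes "\<And>y. lorentz x y = 0"
  shows "x = 0"
proof -
  have "x \<bullet> (eta *v (eta *v x)) = 0" using assms[of "eta *v x"] by (simp add: lorentz_inner)
  moreover have "eta *v (eta *v x) = x" by (simp add: vec_eq_iff eta_mult_vec)
  ultimately show ?thesis by simp
qed

lemma spatial_Cauchy_Schwarz:
  fixes a b c d p q r s :: real
  shows "(a * p + b * q + c * r + d * s)\<^sup>2 \<le> (a\<^sup>2 + b\<^sup>2 + c\<^sup>2 + d\<^sup>2) * (p\<^sup>2 + q\<^sup>2 + r\<^sup>2 + s\<^sup>2)"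
proof -
  have "(a\<^sup>2 + b\<^sup>2 + c\<^sup>2 + d\<^sup>2) * (p\<^sup>2 + q\<^sup>2 + r\<^sup>2 + s\<^sup>2) - (a * p + b * q + c * r + d * s)\<^sup>2
    = (a * q - b * p)\<^sup>2 + (a * r - c * p)\<^sup>2 + (a * s - d * p)\<^sup>2 + (b * r - c * q)\<^sup>2
      + (b * s - d * q)\<^sup>2 + (c * s - d * r)\<^sup>2"
    by algebra
  also have "\<dots> \<ge> 0" by simp
  finally show ?thesis by simp
qed

lemma H4_D: "x \<in> H4 \<Longrightarrow> lorentz x x = -1" "x \<in> H4 \<Longrightarrow> x $ 4 > 0"
  by (auto simp: H4_def)

text \<open>The basic comparison between the pairing on the hyperboloid and Euclidean size. The
  Cauchy-Schwarz inequality gives $-\langle x,y\rangle \ge y_4 (x_4 - |x'|)$ for the spatial part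
  $x'$ of $x$, and $(x_4 - |x'|)(x_4 + |x'|) = 1$ with $x_4 + |x'| \le 2 x_4$. Fixing $x$, it shows
  that sublevel sets of $y \mapsto -\langle x,y\rangle$ are bounded.\<close>

lemma H4_time_bound:
  assumes x: "x \<in> H4" and y: "y \<in> H4"
  shows "y $ 4 \<le> 2 * x $ 4 * (- lorentz x y)"
proof -
  define a where "a = (x$0)\<^sup>2 + (x$1)\<^sup>2 + (x$2)\<^sup>2 + (x$3)\<^sup>2"
  define b where "b = (y$0)\<^sup>2 + (y$1)\<^sup>2 + (y$2)\<^sup>2 + (y$3)\<^sup>2"
  define p where "p = x$0*y$0 + x$1*y$1 + x$2*y$2 + x$3*y$3"
  have a: "a = (x$4)\<^sup>2 - 1" and b: "b = (y$4)\<^sup>2 - 1"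
    using H4_D(1)[OF x] H4_D(1)[OF y] by (auto simp: a_def b_def lorentz_expand power2_eq_square)
  have a0: "a \<ge> 0" and b0: "b \<ge> 0" by (auto simp: a_def b_def)
  have "p\<^sup>2 \<le> a * b" unfolding p_def a_def b_def by (rule spatial_Cauchy_Schwarz)
  also have "\<dots> \<le> a * (y$4)\<^sup>2" using a0 b by (intro mult_left_mono) auto
  also have "\<dots> = (sqrt a * y$4)\<^sup>2" using a0 by (simp add: power_mult_distrib)
  finally have p: "p \<le> sqrt a * y$4"
    using H4_D(2)[OF y] a0 by (meson abs_le_square_iff abs_le_D1 order.trans abs_of_nonneg
      mult_nonneg_nonneg real_sqrt_ge_zero less_imp_le power2_le_imp_le)
  have sa: "sqrt a \<le> x$4" using a H4_D(2)[OF x] by (intro real_le_lsqrt) auto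
  have "1 = (x$4 - sqrt a) * (x$4 + sqrt a)"
    using a a0 by (simp add: algebra_simps flip: power2_eq_square)
  also have "(x$4 - sqrt a) * (x$4 + sqrt a) \<le> (x$4 - sqrt a) * (2 * x$4)"
    using sa by (intro mult_left_mono) auto
  finally have "1 * y$4 \<le> (x$4 - sqrt a) * (2 * x$4) * y$4"
    using H4_D(2)[OF y] by (intro mult_right_mono) auto
  also have "\<dots> = 2 * x$4 * (x$4 * y$4 - sqrt a * y$4)" by (simp add: algebra_simps)
  also have "\<dots> \<le> 2 * x$4 * (- lorentz x y)"
    using p H4_D(2)[OF x] by (intro mult_left_mono) (auto simp: lorentz_expand p_def)
  finally show ?thesis by simp
qed

lemma H4_lorentz_neg:
  assumes "x \<in> H4" "y \<in> H4"
  shows "lorentz x y < 0"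
proof -
  have "0 < 2 * x $ 4 * (- lorentz x y)"
    using H4_time_bound[OF assms] H4_D(2)[OF assms(2)] by linarith
  then show ?thesis using H4_D(2)[OF assms(1)] by (simp add: zero_less_mult_iff mult_less_0_iff)
qed

text \<open>Orthogonality says $m_4 x_4 = m' \cdot x'$ for the spatial parts. As $|x'| < x_4$, the
  Cauchy-Schwarz inequality makes $|m_4|$ smaller than $|m'|$ unless both vanish.\<close>

lemma spacelike_if_orthogonal:
  assumes x: "x \<in> H4" and m: "lorentz m x = 0" "m \<noteq> 0"
  shows "lorentz m m > 0"
proof (rule ccontr)
  assume neg: "\<not> ?thesis"
  define a where "a = (x$0)\<^sup>2 + (x$1)\<^sup>2 + (x$2)\<^sup>2 + (x$3)\<^sup>2"
  define b where "b = (m$0)\<^sup>2 + (m$1)\<^sup>2 + (m$2)\<^sup>2 + (m$3)\<^sup>2"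
  have a: "a = (x$4)\<^sup>2 - 1" and b: "b \<le> (m$4)\<^sup>2"
    using H4_D(1)[OF x] neg by (auto simp: a_def b_def lorentz_expand power2_eq_square)
  have a0: "a \<ge> 0" by (simp add: a_def)
  have "(m$4 * x$4)\<^sup>2 = (m$0*x$0 + m$1*x$1 + m$2*x$2 + m$3*x$3)\<^sup>2"
    using m(1) by (simp add: lorentz_expand)
  also have "\<dots> \<le> b * a" unfolding a_def b_def by (rule spatial_Cauchy_Schwarz)
  also have "\<dots> \<le> (m$4)\<^sup>2 * a" using a0 b by (intro mult_right_mono)
  finally have "(m$4)\<^sup>2 \<le> 0" by (simp add: a power_mult_distrib algebra_simps)
  then have m4: "m$4 = 0" by simp
  with b have "b \<le> 0" by simp
  then have "(m$0)\<^sup>2 \<le> 0 \<and> (m$1)\<^sup>2 \<le> 0 \<and> (m$2)\<^sup>2 \<le> 0 \<and> (m$3)\<^sup>2 \<le> 0"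
    unfolding b_def by (smt (verit) zero_le_power2)
  then have "m$0 = 0 \<and> m$1 = 0 \<and> m$2 = 0 \<and> m$3 = 0" by simp
  with m4 have "m = 0" by (simp add: vec_eq_iff forall_5)
  with m(2) show False by simp
qed

section \<open>The isometry group of hyperbolic space\<close>

definition origin :: "real^5" where "origin = axis 4 1"

lemma origin_H4: "origin \<in> H4"
  by (simp add: H4_def origin_def lorentz_expand axis_def)

lemma lorentz_origin: "lorentz origin x = - x$4"
  by (simp add: origin_def lorentz_expand axis_def)

lemma mult_vec_origin: "(A *v origin) $ i = A $ i $ 4"
  by (simp add: origin_def matrix_vector_mul_component inner_axis)

lemma transpose_eta [simp]: "transpose eta = eta"
  by (simp add: eta_def transpose_def vec_eq_iff)

lemma eta_eta [simp]: "eta ** eta = mat 1"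
  by (simp add: matrix_eq vec_eq_iff eta_mult_vec flip: matrix_vector_mul_assoc)

lemma inner_mult_vec: "(A *v x) \<bullet> y = x \<bullet> (transpose A *v y)" for A :: "real^'n^'n"
  by (metis dot_lmul_matrix vector_transpose_matrix)

lemma eq_matrix_iff_inner: "A = B \<longleftrightarrow> (\<forall>x y. x \<bullet> (A *v y) = x \<bullet> (B *v y))" for A B :: "real^'n^'n"
  by (metis matrix_eq vector_eq_ldot)

lemma preserves_lorentz_iff:
  "(\<forall>x y. lorentz (A *v x) (A *v y) = lorentz x y) \<longleftrightarrow> transpose A ** eta ** A = eta"
  unfolding eq_matrix_iff_inner
  by (simp add: lorentz_inner inner_mult_vec matrix_vector_mul_assoc matrix_mul_assoc)

text \<open>The equation $A^T \eta A = \eta$ exhibits $\eta A^T \eta$ as a left inverse of $A$,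
  hence as its inverse.\<close>

lemma preserves_lorentz_right_inverse:
  assumes "transpose A ** eta ** A = eta"
  shows "A ** (eta ** transpose A ** eta) = mat 1"
proof -
  have "(eta ** transpose A ** eta) ** A = mat 1"
    using assms by (metis eta_eta matrix_mul_assoc)
  then show ?thesis by (simp add: matrix_left_right_inverse)
qed

text \<open>An isometry of the form either preserves the upper sheet or exchanges the two sheets,
  since points of the same sheet pair negatively; the image of the origin decides which.\<close>

lemma H4_image_if:
  assumes A: "\<And>x y. lorentz (A *v x) (A *v y) = lorentz x y" and pos: "A $ 4 $ 4 > 0" and x: "x \<in> H4"
  shows "A *v x \<in> H4"
proof (rule ccontr)
  assume no: "A *v x \<notin> H4"
  have o: "A *v origin \<in> H4"
    using pos A H4_D(1)[OF origin_H4] by (simp add: H4_def mult_vec_origin)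
  have n: "lorentz (A *v x) (A *v x) = -1" using A H4_D(1)[OF x] by simp
  have "(A *v x) $ 4 \<noteq> 0"
  proof
    assume "(A *v x) $ 4 = 0"
    then have "lorentz (A *v x) (A *v x) \<ge> 0" by (simp add: lorentz_expand)
    with n show False by simp
  qed
  then have "- (A *v x) \<in> H4" using n no by (auto simp: H4_def)
  from H4_lorentz_neg[OF o this] have "lorentz origin x > 0" by (simp add: A)
  with H4_lorentz_neg[OF origin_H4 x] show False by simp
qed

lemma carrier_O41: "A \<in> carrier O41 \<longleftrightarrow> transpose A ** eta ** A = eta \<and> A $ 4 $ 4 > 0"
proof -
  have "(\<forall>x\<in>H4. A *v x \<in> H4) \<longleftrightarrow> A $ 4 $ 4 > 0" if "\<forall>x y. lorentz (A *v x) (A *v y) = lorentz x y"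
    using H4_image_if[of A] that H4_D(2)[of "A *v origin"] origin_H4 by (auto simp: mult_vec_origin)
  then show ?thesis
    using preserves_lorentz_iff[of A] by (auto simp: O41_def)
qed

lemma O41_lorentz: "A \<in> carrier O41 \<Longrightarrow> lorentz (A *v x) (A *v y) = lorentz x y"
  by (simp add: O41_def)

lemma O41_H4: "A \<in> carrier O41 \<Longrightarrow> x \<in> H4 \<Longrightarrow> A *v x \<in> H4"
  by (simp add: O41_def)

lemma O41_simps [simp]: "mult O41 = (**)" "one O41 = mat 1"
  by (simp_all add: O41_def)

lemma O41_inverse_in: "A \<in> carrier O41 \<Longrightarrow> eta ** transpose A ** eta \<in> carrier O41"
proof -
  assume A: "A \<in> carrier O41"
  then have AI: "A ** (eta ** transpose A ** eta) = mat 1"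
    by (simp add: carrier_O41 preserves_lorentz_right_inverse)
  have "lorentz ((eta ** transpose A ** eta) *v x) ((eta ** transpose A ** eta) *v y) = lorentz x y" for x y
    using O41_lorentz[OF A, of "(eta ** transpose A ** eta) *v x" "(eta ** transpose A ** eta) *v y"]
    by (simp add: matrix_vector_mul_assoc AI)
  moreover have "(eta ** transpose A ** eta) $ 4 $ 4 = A $ 4 $ 4"
    by (simp add: matrix_matrix_mult_def eta_def transpose_def if_distrib[where f="\<lambda>c. c * _"]
        if_distrib[where f="\<lambda>c. _ * c"] sum.delta' cong: if_cong)
  ultimately show "eta ** transpose A ** eta \<in> carrier O41"
    using A by (auto simp: carrier_O41 simp flip: preserves_lorentz_iff)
qed

lemma O41_group: "group O41"
proof (rule groupI)
  show "x \<otimes>\<^bsub>O41\<^esub> y \<in> carrier O41" if "x \<in> carrier O41" "y \<in> carrier O41" for x y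
    using that by (auto simp: O41_def simp flip: matrix_vector_mul_assoc)
  show "\<one>\<^bsub>O41\<^esub> \<in> carrier O41" by (simp add: O41_def)
  show "\<exists>y\<in>carrier O41. y \<otimes>\<^bsub>O41\<^esub> x = \<one>\<^bsub>O41\<^esub>" if x: "x \<in> carrier O41" for x
    using O41_inverse_in[OF x] x preserves_lorentz_right_inverse[of x]
    by (auto simp: carrier_O41 matrix_left_right_inverse)
qed (auto simp: matrix_mul_assoc)

interpretation O41: group O41 by (rule O41_group)

lemma O41_inv_eq: "A \<in> carrier O41 \<Longrightarrow> inv\<^bsub>O41\<^esub> A = eta ** transpose A ** eta"
  using O41.inv_equality[of "eta ** transpose A ** eta" A] O41_inverse_in[of A] preserves_lorentz_right_inverse[of A]
  by (auto simp: carrier_O41 matrix_left_right_inverse)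

lemma O41_inv_mult_vec:
  assumes "A \<in> carrier O41"
  shows "inv\<^bsub>O41\<^esub> A *v (A *v x) = x" "A *v (inv\<^bsub>O41\<^esub> A *v x) = x"
  using O41.l_inv[OF assms] O41.r_inv[OF assms] by (auto simp: matrix_vector_mul_assoc)

lemma O41_inv_44:
  assumes "A \<in> carrier O41"
  shows "(inv\<^bsub>O41\<^esub> A) $ i $ 4 = (if i = 4 then A $ 4 $ 4 else - A $ 4 $ i)"
  unfolding O41_inv_eq[OF assms]
  by (simp add: matrix_matrix_mult_def eta_def transpose_def if_distrib[where f="\<lambda>c. c * _"]
        if_distrib[where f="\<lambda>c. _ * c"] sum.delta sum.delta' cong: if_cong)

lemma O41_column_norm:
  assumes A: "A \<in> carrier O41"
  shows "(A $ 0 $ j)\<^sup>2 + (A $ 1 $ j)\<^sup>2 + (A $ 2 $ j)\<^sup>2 + (A $ 3 $ j)\<^sup>2 - (A $ 4 $ j)\<^sup>2 = (if j = 4 then -1 else 1)"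
proof -
  have "lorentz (A *v axis j 1) (A *v axis j 1) = lorentz (axis j 1) (axis j 1)"
    using A by (rule O41_lorentz)
  also have "\<dots> = (if j = 4 then -1 else 1)"
    by (simp add: lorentz_inner inner_axis' eta_mult_vec)
  finally show ?thesis
    by (simp add: lorentz_expand matrix_vector_mul_component inner_axis power2_eq_square)
qed

text \<open>By the defining equation for $A$ and for its inverse, the last row and all the columns
  of $A$ have prescribed Lorentz norm. The corner entry is the hyperbolic cosine of the distance by
  which $A$ moves the origin, so a bound on that distance bounds the whole matrix.\<close>

lemma O41_entry_le:
  assumes A: "A \<in> carrier O41"
  shows "\<bar>A $ i $ j\<bar> \<le> A $ 4 $ 4"
proof -
  have pos: "A $ 4 $ 4 > 0" using A by (simp add: carrier_O41)
  have B: "inv\<^bsub>O41\<^esub> A \<in> carrier O41" using A by simp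
  have row: "(A $ 4 $ 0)\<^sup>2 + (A $ 4 $ 1)\<^sup>2 + (A $ 4 $ 2)\<^sup>2 + (A $ 4 $ 3)\<^sup>2 - (A $ 4 $ 4)\<^sup>2 = -1"
    using O41_column_norm[OF B, of 4] by (simp add: O41_inv_44[OF A])
  have row': "j \<noteq> 4 \<Longrightarrow> (A $ 4 $ j)\<^sup>2 \<le> (A $ 4 $ 4)\<^sup>2 - 1"
    using row zero_le_power2[of "A $ 4 $ 0"] zero_le_power2[of "A $ 4 $ 1"]
      zero_le_power2[of "A $ 4 $ 2"] zero_le_power2[of "A $ 4 $ 3"] cases_5[of j]
    by (elim disjE; hypsubst; linarith?) simp
  have col: "(A $ 0 $ j)\<^sup>2 + (A $ 1 $ j)\<^sup>2 + (A $ 2 $ j)\<^sup>2 + (A $ 3 $ j)\<^sup>2 \<le> (A $ 4 $ 4)\<^sup>2"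
    using O41_column_norm[OF A, of j] row' by (cases "j = 4") auto
  have "(A $ 4 $ j)\<^sup>2 \<le> (A $ 4 $ 4)\<^sup>2" using row' by (cases "j = 4") auto
  then have "(A $ i $ j)\<^sup>2 \<le> (A $ 4 $ 4)\<^sup>2"
    using col cases_5[of i]
      zero_le_power2[of "A $ 0 $ j"] zero_le_power2[of "A $ 1 $ j"]
      zero_le_power2[of "A $ 2 $ j"] zero_le_power2[of "A $ 3 $ j"]
    by (elim disjE; hypsubst; linarith)
  then show ?thesis using pos by (metis abs_le_square_iff abs_of_pos)
qed

text \<open>Moving any point of a bounded set to a point of a bounded set also limits how far the
  origin moves.\<close>

lemma O41_44_le:
  assumes A: "A \<in> carrier O41" and x: "x \<in> H4"
  shows "A $ 4 $ 4 \<le> 2 * (A *v x) $ 4 * x $ 4"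
  using H4_time_bound[OF O41_H4[OF A x] O41_H4[OF A origin_H4]]
  by (simp add: mult_vec_origin O41_lorentz[OF A] lorentz_sym[of x] lorentz_origin)

section \<open>Discrete subgroups\<close>

text \<open>Only finitely many elements move the origin by at most a given distance. Finiteness is
  phrased through the corner entry because that is the quantity the estimates control.\<close>

definition properly_discontinuous :: "(real^5^5) set \<Rightarrow> bool" where
  "properly_discontinuous D \<longleftrightarrow> D \<subseteq> carrier O41 \<and> (\<forall>c. finite {A \<in> D. A $ 4 $ 4 \<le> c})"

lemma tendsto_matrix_mult:
  fixes f g :: "nat \<Rightarrow> real^'n^'n"
  assumes "f \<longlonglongrightarrow> A" "g \<longlonglongrightarrow> B"
  shows "(\<lambda>n. f n ** g n) \<longlonglongrightarrow> A ** B"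
  by (intro vec_tendstoI) (simp add: matrix_matrix_mult_def, intro tendsto_sum tendsto_mult tendsto_vec_nth assms)

lemma tendsto_matrix_transpose:
  fixes f :: "nat \<Rightarrow> real^'n^'n"
  assumes "f \<longlonglongrightarrow> A"
  shows "(\<lambda>n. transpose (f n)) \<longlonglongrightarrow> transpose A"
  by (intro vec_tendstoI) (simp add: transpose_def, intro tendsto_vec_nth assms)

lemma bounded_matrices:
  fixes S :: "(real^'n^'m) set"
  assumes "\<And>A i j. A \<in> S \<Longrightarrow> \<bar>A $ i $ j\<bar> \<le> c"
  shows "bounded S"
proof -
  have "norm A \<le> real CARD('m) * (real CARD('n) * c)" if A: "A \<in> S" for A
  proof -
    have "norm (A $ i) \<le> real CARD('n) * c" for i
      using norm_le_l1_cart[of "A $ i"] sum_mono[of UNIV "\<lambda>j. \<bar>A $ i $ j\<bar>" "\<lambda>_. c"] assms[OF A]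
      by (auto intro: order.trans)
    then have "(\<Sum>i\<in>UNIV. norm (A $ i)) \<le> real CARD('m) * (real CARD('n) * c)"
      using sum_mono[of UNIV "\<lambda>i. norm (A $ i)" "\<lambda>_. real CARD('n) * c"] by auto
    moreover have "norm A \<le> (\<Sum>i\<in>UNIV. norm (A $ i))"
      unfolding norm_vec_def by (rule L2_set_le_sum) auto
    ultimately show ?thesis by linarith
  qed
  then show ?thesis by (auto simp: bounded_iff)
qed

text \<open>Infinitely many elements with bounded corner entry would contain a convergent sequence
  of distinct elements. The quotients of successive terms then converge to the identity without
  being equal to it, which discreteness forbids. The limit itself need not lie in the
  subgroup.\<close>

lemma properly_discontinuous_if_discrete:
  assumes D: "subgroup D O41" and disc: "discrete D"
  shows "properly_discontinuous D"
  unfolding properly_discontinuous_def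
proof (intro conjI allI)
  show sub: "D \<subseteq> carrier O41" using D by (rule subgroup.subset)
  fix c
  define T where "T = {A \<in> D. A $ 4 $ 4 \<le> c}"
  have "mat 1 \<in> D" using subgroup.one_closed[OF D] by simp
  then obtain U where U: "open U" "U \<inter> D = {mat 1}"
    using discreteD[OF disc] unfolding isolated_in_def by blast
  have bT: "bounded T"
  proof (rule bounded_matrices)
    fix A i j assume "A \<in> T"
    then show "\<bar>A $ i $ j\<bar> \<le> c" using O41_entry_le[of A i j] sub unfolding T_def by force
  qed
  show "finite {A \<in> D. A $ 4 $ 4 \<le> c}"
  proof (rule ccontr)
    assume "infinite {A \<in> D. A $ 4 $ 4 \<le> c}"
    then obtain f :: "nat \<Rightarrow> real^5^5" where f: "inj f" "range f \<subseteq> T"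
      using infinite_iff_countable_subset[of T] by (auto simp: T_def)
    have "bounded (range f)" using bT f(2) by (rule bounded_subset)
    then obtain L r where r: "strict_mono r" and L: "(f \<circ> r) \<longlonglongrightarrow> L"
      using bounded_imp_convergent_subsequence by blast
    define g where "g = f \<circ> r"
    have gD: "g n \<in> D" for n using f(2) by (auto simp: g_def T_def)
    then have gc: "g n \<in> carrier O41" for n using sub by auto
    have g1: "(\<lambda>n. eta ** transpose (g n) ** eta ** g (Suc n)) \<longlonglongrightarrow> eta ** transpose L ** eta ** L"
      using L LIMSEQ_Suc[OF L]
      by (intro tendsto_matrix_mult tendsto_matrix_transpose tendsto_const) (auto simp: g_def o_def)
    have g0: "(\<lambda>n. eta ** transpose (g n) ** eta ** g n) \<longlonglongrightarrow> eta ** transpose L ** eta ** L"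
      using L
      by (intro tendsto_matrix_mult tendsto_matrix_transpose tendsto_const) (auto simp: g_def o_def)
    have "eta ** transpose (g n) ** eta ** g n = mat 1" for n
      using O41.l_inv[OF gc] by (simp add: O41_inv_eq[OF gc])
    then have "eta ** transpose L ** eta ** L = mat 1"
      using g0 LIMSEQ_unique[OF _ tendsto_const, of "mat 1" "eta ** transpose L ** eta ** L"] by simp
    with g1 U have "eventually (\<lambda>n. eta ** transpose (g n) ** eta ** g (Suc n) \<in> U) sequentially"
      by (auto simp: tendsto_def)
    then obtain n where "eta ** transpose (g n) ** eta ** g (Suc n) \<in> U"
      by (auto simp: eventually_sequentially)
    then have "inv\<^bsub>O41\<^esub> (g n) ** g (Suc n) \<in> U" by (simp add: O41_inv_eq[OF gc])
    moreover have "inv\<^bsub>O41\<^esub> (g n) ** g (Suc n) \<in> D"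
      using subgroup.m_closed[OF D subgroup.m_inv_closed[OF D gD] gD] by simp
    ultimately have "inv\<^bsub>O41\<^esub> (g n) ** g (Suc n) = mat 1" using U by blast
    then have "g (Suc n) = g n"
      using O41.inv_solve_left'[of "mat 1" "g n" "g (Suc n)"] gc O41.one_closed by simp
    then have "r (Suc n) = r n" using f(1) by (auto simp: g_def inj_def)
    with r show False by (metis less_irrefl lessI strict_mono_less)
  qed
qed

section \<open>Cocompact subgroups\<close>

text \<open>A coset of the subgroup contains an element that moves the origin into the ball of
  radius $R$, and the larger group has only finitely many of those.\<close>

lemma finite_index_if_cobounded:
  assumes D: "subgroup D O41" "properly_discontinuous D"
    and E: "subgroup E O41" "E \<subseteq> D"
    and cover: "\<And>x. x \<in> H4 \<Longrightarrow> \<exists>A\<in>E. \<exists>y\<in>H4. norm y \<le> R \<and> x = A *v y"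
  shows "finite_index O41 D E"
proof -
  define F where "F = {A \<in> D. A $ 4 $ 4 \<le> R}"
  have "finite F" using D(2) by (simp add: F_def properly_discontinuous_def)
  have sub: "D \<subseteq> carrier O41" using D(1) by (rule subgroup.subset)
  have "rcosets\<^bsub>O41\<lparr>carrier := D\<rparr>\<^esub> E \<subseteq> (\<lambda>f. E #>\<^bsub>O41\<^esub> f) ` F"
  proof
    fix X assume "X \<in> rcosets\<^bsub>O41\<lparr>carrier := D\<rparr>\<^esub> E"
    then obtain a where a: "a \<in> D" and X: "X = E #>\<^bsub>O41\<^esub> a"
      by (auto simp: RCOSETS_def r_coset_def)
    obtain A y where A: "A \<in> E" and y: "y \<in> H4" "norm y \<le> R" "a *v origin = A *v y"
      using cover[OF O41_H4[OF _ origin_H4]] a sub by blast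
    define f where "f = inv\<^bsub>O41\<^esub> A ** a"
    have Ac: "A \<in> carrier O41" and ac: "a \<in> carrier O41" using A E a sub by auto
    have "f \<in> D"
      using subgroup.m_closed[OF D(1) subgroup.m_inv_closed[OF D(1)]] A E a by (auto simp: f_def)
    moreover have "f *v origin = y"
      using y(3) O41_inv_mult_vec[OF Ac] by (simp add: f_def flip: matrix_vector_mul_assoc)
    then have "f $ 4 $ 4 \<le> R"
      using mult_vec_origin[of f 4] component_le_norm_cart[of y 4] y(2) by simp
    ultimately have "f \<in> F" by (simp add: F_def)
    moreover have "E #>\<^bsub>O41\<^esub> a = E #>\<^bsub>O41\<^esub> f"
    proof -
      have "a = A ** f" using O41.r_inv[OF Ac] by (simp add: f_def matrix_mul_assoc)
      moreover have "f \<in> carrier O41" using \<open>f \<in> D\<close> sub by auto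
      ultimately show ?thesis
        using O41.coset_mult_assoc[of E A f] O41.coset_join2[OF Ac E(1) A] E Ac sub by auto
    qed
    ultimately show "X \<in> (\<lambda>f. E #>\<^bsub>O41\<^esub> f) ` F" using X by auto
  qed
  then show ?thesis
    unfolding finite_index_def using \<open>finite F\<close> by (meson finite_imageI finite_subset)
qed

text \<open>The part of the hyperboloid inside a ball serves as the set of finite volume: the cone
  over it lies in the ball.\<close>

lemma finite_covolume_if_cobounded:
  assumes cover: "\<And>x. x \<in> H4 \<Longrightarrow> \<exists>A\<in>\<Gamma>. \<exists>y\<in>H4. norm y \<le> R \<and> x = A *v y"
  shows "\<exists>F\<in>sets borel. F \<subseteq> H4 \<and> H4 \<subseteq> (\<Union>A\<in>\<Gamma>. (\<lambda>x. A *v x) ` F) \<and> hyperbolic_volume F < \<infinity>"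
proof -
  define F where "F = H4 \<inter> cball 0 R"
  have "continuous_on UNIV (\<lambda>x::real^5. lorentz x x)"
    unfolding lorentz_expand by (intro continuous_intros)
  then have "H4 \<in> sets borel"
  proof -
    assume c: "continuous_on UNIV (\<lambda>x::real^5. lorentz x x)"
    have eq: "H4 = {x. lorentz x x = -1} \<inter> {x. x $ 4 > 0}" by (auto simp: H4_def)
    have cl: "closed {x. lorentz x x = -1}"
      using continuous_closed_preimage_constant[OF c closed_UNIV] by simp
    have op: "open {x::real^5. x $ 4 > 0}" by (rule open_halfspace_component_gt_cart)
    show ?thesis unfolding eq by (rule sets.Int[OF borel_closed[OF cl] borel_open[OF op]])
  qed
  then have "F \<in> sets borel"
    unfolding F_def by (rule sets.Int) (rule borel_closed[OF closed_cball])
  moreover have "H4 \<subseteq> (\<Union>A\<in>\<Gamma>. (\<lambda>x. A *v x) ` F)"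
    using cover by (force simp: F_def)
  moreover have "hyperbolic_volume F < \<infinity>"
  proof -
    let ?C = "{r *\<^sub>R u | r u. 0 < r \<and> r \<le> 1 \<and> u \<in> F}"
    have "?C \<subseteq> cball 0 R"
    proof
      fix z assume "z \<in> ?C"
      then obtain r u where z: "z = r *\<^sub>R u" "0 < r" "r \<le> 1" "norm u \<le> R" by (auto simp: F_def)
      have "r * norm u \<le> 1 * norm u" using z by (intro mult_right_mono) auto
      then show "z \<in> cball 0 R" using z by simp
    qed
    then have "emeasure lborel ?C \<le> emeasure lborel (cball 0 R :: (real^5) set)"
      by (intro emeasure_mono) auto
    also have "\<dots> < \<infinity>" by (rule emeasure_lborel_cball_finite)
    finally show ?thesis by (simp add: hyperbolic_volume_def ennreal_mult_less_top)
  qed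
  ultimately show ?thesis by (auto simp: F_def)
qed

section \<open>Reflections and simplices\<close>

definition reflection :: "real^5 \<Rightarrow> real^5^5" where
  "reflection e = (\<chi> a b. (if a = b then 1 else 0) - 2 * e $ a * (eta *v e) $ b)"

lemma reflection_apply: "reflection e *v x = x - (2 * lorentz x e) *\<^sub>R e"
proof -
  have "(reflection e *v x) $ a = (x - (2 * lorentz x e) *\<^sub>R e) $ a" for a
  proof -
    have "(reflection e *v x) $ a = (\<Sum>b\<in>UNIV. (if a = b then x $ b else 0)) - (\<Sum>b\<in>UNIV. 2 * e $ a * (x $ b * (eta *v e) $ b))"
      unfolding matrix_vector_mul_component[of "reflection e"] inner_vec_def sum_subtractf[symmetric]
      by (rule sum.cong) (auto simp: reflection_def algebra_simps)
    also have "\<dots> = (x - (2 * lorentz x e) *\<^sub>R e) $ a"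
      by (simp add: lorentz_inner inner_vec_def flip: sum_distrib_left)
    finally show ?thesis .
  qed
  then show ?thesis by (simp add: vec_eq_iff)
qed

lemma reflection_involution: "lorentz e e = 1 \<Longrightarrow> reflection e ** reflection e = mat 1"
  by (simp add: matrix_eq reflection_apply flip: matrix_vector_mul_assoc)

lemma reflection_O41:
  assumes "lorentz e e = 1"
  shows "reflection e \<in> carrier O41"
proof -
  have "lorentz (reflection e *v x) (reflection e *v y) = lorentz x y" for x y
    using assms by (simp add: reflection_apply lorentz_sym[of e y])
  moreover have "reflection e $ 4 $ 4 = 1 + 2 * (e $ 4)\<^sup>2"
    by (simp add: reflection_def eta_mult_vec power2_eq_square)
  then have "reflection e $ 4 $ 4 > 0" by (simp add: add_pos_nonneg)
  ultimately show ?thesis by (auto simp: carrier_O41 simp flip: preserves_lorentz_iff)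
qed

lemma reflection_conj:
  assumes "A \<in> carrier O41"
  shows "reflection (A *v e) ** A = A ** reflection e"
  by (simp add: matrix_eq reflection_apply O41_lorentz[OF assms] matrix_vector_mult_diff_distrib
      matrix_vector_mult_scaleR flip: matrix_vector_mul_assoc)

text \<open>A simplex with its vertices $v_i$ and its outer unit normals $e_i$, the normal with
  index $i$ belonging to the facet opposite to $v_i$. The two families are dual up to scaling, which
  is what makes all the computations in coordinates possible.\<close>

locale hyperbolic_simplex =
  fixes v e :: "5 \<Rightarrow> real^5"
  assumes vertex: "v i \<in> H4"
    and normal_unit: "lorentz (e i) (e i) = 1"
    and normal_orthogonal: "i \<noteq> j \<Longrightarrow> lorentz (e i) (v j) = 0"
    and normal_outward: "lorentz (e i) (v i) < 0"
begin

text \<open>Duality makes the matrix of the $v_i$ left invertible with an explicit inverse, so it is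
  also right invertible.\<close>

lemma coordinates: "x = (\<Sum>i\<in>UNIV. (lorentz (e i) x / lorentz (e i) (v i)) *\<^sub>R v i)"
proof -
  define V where "V = (\<chi> a i. v i $ a)"
  define W where "W = (\<chi> i a. (eta *v e i) $ a / lorentz (e i) (v i))"
  have W: "(W *v y) $ i = lorentz (e i) y / lorentz (e i) (v i)" for y i
    unfolding lorentz_sym[of "e i" y]
    unfolding matrix_vector_mul_component[of W]
    by (simp add: W_def lorentz_inner inner_vec_def sum_divide_distrib mult_ac)
  have V: "V *v y = (\<Sum>i\<in>UNIV. y $ i *\<^sub>R v i)" for y
    by (simp add: V_def vec_eq_iff matrix_vector_mult_def mult_ac)
  have "W *v (V *v y) = y" for y
  proof -
    have "(W *v (V *v y)) $ i = y $ i" for i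
    proof -
      have "(\<Sum>j\<in>UNIV. y $ j * lorentz (e i) (v j)) = (\<Sum>j\<in>{i}. y $ j * lorentz (e i) (v j))"
        by (rule sum.mono_neutral_right) (auto simp: normal_orthogonal)
      then show ?thesis using normal_outward[of i] by (simp add: W V lorentz_sum)
    qed
    then show ?thesis by (simp add: vec_eq_iff)
  qed
  then have "W ** V = mat 1" by (simp add: matrix_eq flip: matrix_vector_mul_assoc)
  then have "V ** W = mat 1" by (simp add: matrix_left_right_inverse)
  then have "x = V *v (W *v x)" by (simp add: matrix_vector_mul_assoc)
  then show ?thesis by (simp add: V W)
qed

lemma eq_0_if_orthogonal_vertices:
  assumes "\<And>i. lorentz y (v i) = 0"
  shows "y = 0"
  by (rule lorentz_nondegenerate) (subst coordinates, simp add: lorentz_sum assms)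

definition chamber :: "(real^5) set" where
  "chamber = {x \<in> H4. \<forall>i. lorentz (e i) x \<le> 0}"

text \<open>The coordinates $c_i$ of a point $x$ of the simplex are nonnegative, and all pairings
  between vertices are negative. Therefore $-1 = \langle x, x\rangle \le c_i \langle v_i, x \rangle
  \le - c_i^2$, so every coordinate is at most $1$.\<close>

lemma chamber_norm_le:
  assumes x: "x \<in> chamber"
  shows "norm x \<le> (\<Sum>i\<in>UNIV. norm (v i))"
proof -
  define c where "c i = lorentz (e i) x / lorentz (e i) (v i)" for i
  have xH: "x \<in> H4" using x by (simp add: chamber_def)
  have xc: "x = (\<Sum>i\<in>UNIV. c i *\<^sub>R v i)" unfolding c_def by (rule coordinates)
  have c0: "c i \<ge> 0" for i
    using x normal_outward[of i] by (auto simp: c_def chamber_def divide_nonpos_neg)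
  have c1: "c i \<le> 1" for i
  proof -
    have "lorentz (v i) x = (\<Sum>j\<in>UNIV. c j * lorentz (v i) (v j))"
      by (subst xc) (simp add: lorentz_sum)
    also have "\<dots> = c i * lorentz (v i) (v i) + (\<Sum>j\<in>UNIV - {i}. c j * lorentz (v i) (v j))"
      by (rule sum.remove) auto
    also have "\<dots> \<le> - c i"
    proof -
      have "(\<Sum>j\<in>UNIV - {i}. c j * lorentz (v i) (v j)) \<le> 0"
      by (intro sum_nonpos mult_nonneg_nonpos c0 less_imp_le[OF H4_lorentz_neg[OF vertex vertex]])
      then show ?thesis by (simp add: H4_D(1)[OF vertex])
    qed
    finally have 1: "c i * lorentz (v i) x \<le> c i * (- c i)" using c0 by (intro mult_left_mono)
    have "- 1 = lorentz x x" using H4_D(1)[OF xH] by simp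
    also have "\<dots> = (\<Sum>j\<in>UNIV. c j * lorentz (v j) x)"
      by (subst (1) xc) (simp add: lorentz_sum)
    also have "\<dots> = c i * lorentz (v i) x + (\<Sum>j\<in>UNIV - {i}. c j * lorentz (v j) x)"
      by (rule sum.remove) auto
    also have "\<dots> \<le> c i * lorentz (v i) x"
    proof -
      have "(\<Sum>j\<in>UNIV - {i}. c j * lorentz (v j) x) \<le> 0"
      by (intro sum_nonpos mult_nonneg_nonpos c0 less_imp_le[OF H4_lorentz_neg[OF vertex xH]])
      then show ?thesis by simp
    qed
    finally have "c i * c i \<le> 1 * 1" using 1 by simp
    then show ?thesis using c0 by (metis abs_of_nonneg abs_square_le_1 mult_1 power2_eq_square)
  qed
  have "norm x \<le> (\<Sum>i\<in>UNIV. norm (c i *\<^sub>R v i))" by (subst xc) (rule norm_sum)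
  also have "\<dots> \<le> (\<Sum>i\<in>UNIV. norm (v i))"
    using c0 c1 by (intro sum_mono) (simp add: mult_left_le_one_le)
  finally show ?thesis .
qed

abbreviation reflection_group :: "(real^5^5) set" where
  "reflection_group \<equiv> generate O41 (range (\<lambda>i. reflection (e i)))"

lemma reflection_group_subgroup: "subgroup reflection_group O41"
  by (rule O41.generate_is_subgroup) (auto simp: reflection_O41 normal_unit)

text \<open>The reflections need to lie in a properly discontinuous group $D$ for a minimum to
  exist: then only finitely many translates of $x$ are as close to the sum $u$ of the vertices as
  $x$ itself. Applying the reflection $r_i$ to a translate $y$ changes $-\langle u, y\rangle$ by $2
  \langle y, e_i\rangle \langle e_i, v_i\rangle$, where the last factor is negative, so at a minimum
  $\langle y, e_i\rangle \le 0$ for all $i$.\<close>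

lemma reflection_group_moves_into_chamber:
  assumes proper: "properly_discontinuous D" and D: "subgroup D O41" "\<And>i. reflection (e i) \<in> D"
    and x: "x \<in> H4"
  shows "\<exists>w\<in>reflection_group. w *v x \<in> chamber"
proof -
  have WD: "reflection_group \<subseteq> D"
    using D by (intro O41.generate_subgroup_incl) auto
  have Wc: "w \<in> carrier O41" if "w \<in> reflection_group" for w
    using that subgroup.subset[OF reflection_group_subgroup] by auto
  define u where "u = (\<Sum>i\<in>UNIV. v i)"
  \<comment> \<open>a substitute for the distance from \<open>w *v x\<close> to the simplex\<close>
  define f where "f w = - lorentz u (w *v x)" for w
  define T where "T = {w \<in> reflection_group. f w \<le> f (mat 1)}"
  define b where "b = 2 * v 0 $ 4 * f (mat 1)"
  have "T \<subseteq> {A \<in> D. A $ 4 $ 4 \<le> 2 * b * x $ 4}"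
  proof
    fix w assume w: "w \<in> T"
    then have wc: "w \<in> carrier O41" and wD: "w \<in> D" using Wc WD by (auto simp: T_def)
    have wx: "w *v x \<in> H4" using wc x by (rule O41_H4)
    have "- lorentz (v 0) (w *v x) \<le> (\<Sum>i\<in>UNIV. - lorentz (v i) (w *v x))"
      using H4_lorentz_neg[OF vertex wx] by (intro member_le_sum) (auto intro: less_imp_le)
    also have "\<dots> = f w" by (simp add: f_def u_def lorentz_sum sum_negf)
    also have "\<dots> \<le> f (mat 1)" using w by (simp add: T_def)
    finally have "2 * v 0 $ 4 * (- lorentz (v 0) (w *v x)) \<le> b"
      unfolding b_def using H4_D(2)[OF vertex[of 0]] by (intro mult_left_mono) auto
    with H4_time_bound[OF vertex wx, of 0] have "(w *v x) $ 4 \<le> b" by linarith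
    then have "2 * (w *v x) $ 4 * x $ 4 \<le> 2 * b * x $ 4"
      using H4_D(2)[OF x] by (intro mult_right_mono mult_left_mono) auto
    with O41_44_le[OF wc x] wD show "w \<in> {A \<in> D. A $ 4 $ 4 \<le> 2 * b * x $ 4}"
      by simp
  qed
  then have fin: "finite T" using proper finite_subset unfolding properly_discontinuous_def by blast
  have "mat 1 \<in> T" using generate.one[of O41] by (simp add: T_def)
  then have ne: "T \<noteq> {}" by blast
  define w where "w = arg_min_on f T"
  have w: "w \<in> T" "\<And>w'. w' \<in> T \<Longrightarrow> f w \<le> f w'"
    unfolding w_def using arg_min_if_finite(1)[OF fin ne] arg_min_least[OF fin ne] by auto
  have wW: "w \<in> reflection_group" using w(1) by (simp add: T_def)
  have min: "f w \<le> f w'" if "w' \<in> reflection_group" for w'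
    using w that by (cases "w' \<in> T") (auto simp: T_def)
  have "lorentz (e i) (w *v x) \<le> 0" for i
  proof -
    have "reflection (e i) ** w \<in> reflection_group"
      using generate.eng[OF generate.incl[of "reflection (e i)"] wW] by auto
    from min[OF this] have "lorentz u (w *v x - (2 * lorentz (w *v x) (e i)) *\<^sub>R e i) \<le> lorentz u (w *v x)"
      by (simp add: f_def reflection_apply flip: matrix_vector_mul_assoc)
    then have "0 \<le> lorentz (e i) (w *v x) * lorentz (e i) u"
      by (simp add: lorentz_sym[of u] lorentz_sym[of "w *v x" "e i"] mult.commute)
    also have "lorentz (e i) u = lorentz (e i) (v i)"
    proof -
      have "(\<Sum>j\<in>UNIV. lorentz (e i) (v j)) = (\<Sum>j\<in>{i}. lorentz (e i) (v j))"
        by (rule sum.mono_neutral_right) (auto simp: normal_orthogonal)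
      then show ?thesis by (simp add: u_def lorentz_sum)
    qed
    finally show ?thesis using normal_outward[of i] by (simp add: zero_le_mult_iff)
  qed
  then have "w *v x \<in> chamber" using O41_H4[OF Wc[OF wW] x] by (simp add: chamber_def)
  with wW show ?thesis by blast
qed

lemma isometric_image:
  assumes "g \<in> carrier O41"
  shows "hyperbolic_simplex (\<lambda>i. g *v v i) (\<lambda>i. g *v e i)"
  by standard (use assms vertex normal_unit normal_orthogonal normal_outward in \<open>auto simp: O41_lorentz O41_H4\<close>)

end

section \<open>The normals and the Gram matrix of the Lanner simplex\<close>

text \<open>Linear independence of the vertices yields a dual family $m_i$ for the Lorentz form.
  Each $m_i$ is orthogonal to a vertex, hence spacelike, so that it can be normalized; and any
  vector that satisfies the conditions on the $i$-th outer normal is a multiple of $m_i$ because the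
  vertices span.\<close>

lemma normals_exist:
  assumes v: "range v \<subseteq> H4" "inj v" "independent (range v)"
  shows "hyperbolic_simplex v (outer_normal v)"
proof -
  have vH: "v i \<in> H4" for i using v(1) by auto
  define V :: "real^5^5" where "V = (\<chi> a i. v i $ a)"
  have V: "V *v y = (\<Sum>i\<in>UNIV. y $ i *\<^sub>R v i)" for y
    by (simp add: V_def vec_eq_iff matrix_vector_mult_def mult_ac)
  have "y = 0" if "V *v y = 0" for y
  proof -
    have "(\<Sum>w\<in>range v. y $ (inv_into UNIV v w) *\<^sub>R w) = 0"
      using that v(2) by (simp add: V sum.reindex o_def)
    then have "y $ (inv_into UNIV v (v i)) = 0" for i
      using v(3) unfolding real_vector.independent_explicit_finite_subsets by fastforce
    then show ?thesis using v(2) by (simp add: vec_eq_iff)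
  qed
  then obtain B where BV: "B ** V = mat 1"
    by (metis matrix_left_invertible_ker)
  then have VB: "V ** B = mat 1" by (simp add: matrix_left_right_inverse)
  have orth0: "y = 0" if "\<And>i. lorentz y (v i) = 0" for y
  proof (rule lorentz_nondegenerate)
    fix x
    have "lorentz y (V *v z) = 0" for z by (simp only: V lorentz_sum lorentz_bilinear that) simp
    moreover have "x = V *v (B *v x)" by (simp add: matrix_vector_mul_assoc VB)
    ultimately show "lorentz y x = 0" by metis
  qed
  define m where "m i = - (eta *v (B $ i))" for i
  have m: "lorentz (m i) (v j) = (if i = j then -1 else 0)" for i j
  proof -
    have "(B ** V) $ i $ j = B $ i \<bullet> v j"
      by (simp add: matrix_matrix_mult_def V_def inner_vec_def)
    moreover have "lorentz (m i) (v j) = - (B $ i \<bullet> v j)"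
      by (simp add: m_def lorentz_inner inner_mult_vec matrix_vector_mul_assoc)
    ultimately show ?thesis by (simp add: BV mat_def split: if_splits)
  qed
  have mm: "lorentz (m i) (m i) > 0" for i
  proof -
    obtain j :: 5 where "j \<noteq> i" by (metis zero_neq_one)
    then show ?thesis
      using m[of i j] m[of i i] by (intro spacelike_if_orthogonal[OF vH[of j]]) auto
  qed
  have n: "outer_normal v i = (1 / sqrt (lorentz (m i) (m i))) *\<^sub>R m i" for i
    unfolding outer_normal_def
  proof (rule the_equality)
    show "lorentz ((1 / sqrt (lorentz (m i) (m i))) *\<^sub>R m i) ((1 / sqrt (lorentz (m i) (m i))) *\<^sub>R m i) = 1 \<and>
      (\<forall>j. j \<noteq> i \<longrightarrow> lorentz ((1 / sqrt (lorentz (m i) (m i))) *\<^sub>R m i) (v j) = 0) \<and>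
      lorentz ((1 / sqrt (lorentz (m i) (m i))) *\<^sub>R m i) (v i) < 0"
      using mm[of i] by (simp add: m)
  next
    fix n assume n: "lorentz n n = 1 \<and> (\<forall>j. j \<noteq> i \<longrightarrow> lorentz n (v j) = 0) \<and> lorentz n (v i) < 0"
    define c where "c = - lorentz n (v i)"
    have "n - c *\<^sub>R m i = 0"
      by (rule orth0) (use n in \<open>auto simp: m c_def\<close>)
    then have nc: "n = c *\<^sub>R m i" by simp
    have c: "c > 0" using n by (simp add: c_def)
    have "c\<^sup>2 * lorentz (m i) (m i) = 1" using n by (simp add: nc power2_eq_square)
    then have "sqrt (c\<^sup>2 * lorentz (m i) (m i)) = 1" by simp
    then have "c * sqrt (lorentz (m i) (m i)) = 1" using c by (simp add: real_sqrt_mult)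
    then have "c = 1 / sqrt (lorentz (m i) (m i))" using mm[of i] by (simp add: field_simps)
    then show "n = (1 / sqrt (lorentz (m i) (m i))) *\<^sub>R m i" by (simp add: nc)
  qed
  show ?thesis
  proof
    show "lorentz (outer_normal v i) (outer_normal v i) = 1" for i using mm[of i] by (simp add: n)
    show "lorentz (outer_normal v i) (v i) < 0" for i using mm[of i] by (simp add: n m)
  qed (simp_all add: vH n m)
qed

text \<open>Twice the Gram matrix of the outer normals is $C_0 + \sqrt 2\, C_1$: minus twice the
  cosine of $\pi/3$ is $-1$ and that of $\pi/4$ is $-\sqrt 2$. The facets opposite to $d$ and $e$
  meet in the triangle spanned by the three other vertices; the diagram is the cycle $0, 1, 2, 3, 4$
  whose doubled edge joins $3$ and $4$.\<close>

definition lanner_C0 :: "5 \<Rightarrow> 5 \<Rightarrow> int" where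
  "lanner_C0 i j = (if i = j then 2 else if {i, j} \<in> {{0,1},{1,2},{2,3},{0,4}} then -1 else 0)"

definition lanner_C1 :: "5 \<Rightarrow> 5 \<Rightarrow> int" where
  "lanner_C1 i j = (if {i, j} = {3,4} then -1 else 0)"

text \<open>Both normals are orthogonal to a third vertex, so they lie in a positive definite
  subspace. The bound is what allows the Gram matrix to be recovered from the dihedral angles,
  because the value of \<^const>\<open>arccos\<close> outside $[-1,1]$ says nothing about its
  argument.\<close>

lemma (in hyperbolic_simplex) abs_gram_le_1:
  assumes "i \<noteq> j"
  shows "\<bar>lorentz (e i) (e j)\<bar> \<le> 1"
proof -
  obtain k :: 5 where k: "k \<noteq> i" "k \<noteq> j"
  proof -
    have "\<exists>k\<in>{0,1,2}. k \<noteq> i \<and> k \<noteq> j"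
      by (cases "i = 0"; cases "i = 1"; cases "j = 0"; cases "j = 1") auto
    then show ?thesis using that by blast
  qed
  have "lorentz y y \<ge> 0" if "lorentz y (v k) = 0" for y
    using spacelike_if_orthogonal[OF vertex that] by (cases "y = 0") (auto intro: less_imp_le)
  from this[of "e i + e j"] this[of "e i - e j"] show ?thesis
    using k by (simp add: normal_orthogonal normal_unit lorentz_sym[of "e j" "e i"])
qed

lemma lanner_gram:
  assumes v: "lanner_simplex v"
  shows "2 * lorentz (outer_normal v i) (outer_normal v j) = lanner_C0 i j + sqrt 2 * lanner_C1 i j"
proof -
  interpret hyperbolic_simplex v "outer_normal v"
    using v by (intro normals_exist) (auto simp: lanner_simplex_def)
  have set_UNIV_5: "{a, b, c, d, e} = UNIV \<longleftrightarrow> 0 \<in> {a, b, c, d, e} \<and> 1 \<in> {a, b, c, d, e} \<and> 2 \<in> {a, b, c, d, e}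
      \<and> 3 \<in> {a, b, c, d, e} \<and> 4 \<in> {a, b, c, d, e}" for a b c d e :: 5
    unfolding set_eq_iff forall_5 by simp
  have angle: "0 \<in> {a, b, c, d, e} \<and> 1 \<in> {a, b, c, d, e} \<and> 2 \<in> {a, b, c, d, e}
      \<and> 3 \<in> {a, b, c, d, e} \<and> 4 \<in> {a, b, c, d, e} \<Longrightarrow>
        dihedral_angle v d e =
          (if {a, b, c} = {0, 1, 2} then pi / 4
           else if {a, b, c} \<in> {{0, 1, 4}, {0, 3, 4}, {2, 3, 4}, {1, 2, 3}} then pi / 3
           else pi / 2)" for a b c d e
    by (rule v[unfolded lanner_simplex_def, THEN conjunct2, THEN conjunct2, THEN conjunct2, rule_format])
      (simp only: set_UNIV_5)
  have gram: "lorentz (outer_normal v i) (outer_normal v j) = - cos (dihedral_angle v i j)" if "i \<noteq> j" for i j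
    using abs_gram_le_1[OF that] by (simp add: dihedral_angle_def cos_arccos)
  have a01: "dihedral_angle v 0 1 = pi / 3"
    using angle[of 2 3 4 0 1] by (simp add: set_eq_subset)
  have a02: "dihedral_angle v 0 2 = pi / 2"
    using angle[of 1 3 4 0 2] by (simp add: set_eq_subset)
  have a03: "dihedral_angle v 0 3 = pi / 2"
    using angle[of 1 2 4 0 3] by (simp add: set_eq_subset)
  have a04: "dihedral_angle v 0 4 = pi / 3"
    using angle[of 1 2 3 0 4] by (simp add: set_eq_subset)
  have a12: "dihedral_angle v 1 2 = pi / 3"
    using angle[of 0 3 4 1 2] by (simp add: set_eq_subset)
  have a13: "dihedral_angle v 1 3 = pi / 2"
    using angle[of 0 2 4 1 3] by (simp add: set_eq_subset)
  have a14: "dihedral_angle v 1 4 = pi / 2"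
    using angle[of 0 2 3 1 4] by (simp add: set_eq_subset)
  have a23: "dihedral_angle v 2 3 = pi / 3"
    using angle[of 0 1 4 2 3] by (simp add: set_eq_subset)
  have a24: "dihedral_angle v 2 4 = pi / 2"
    using angle[of 0 1 3 2 4] by (simp add: set_eq_subset)
  have a34: "dihedral_angle v 3 4 = pi / 4"
    using angle[of 0 1 2 3 4] by (simp add: set_eq_subset)
  note angles = a01 a02 a03 a04 a12 a13 a14 a23 a24 a34
  have less: "2 * lorentz (outer_normal v i) (outer_normal v j) = lanner_C0 i j + sqrt 2 * lanner_C1 i j"
    if "(i, j) \<in> {(0,1),(0,2),(0,3),(0,4),(1,2),(1,3),(1,4),(2,3),(2,4),(3,4)}" for i j
    using that by (elim insertE emptyE; simp add: gram angles lanner_C0_def lanner_C1_def set_eq_subset cos_45 cos_60)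
  have "lanner_C0 i j = lanner_C0 j i" "lanner_C1 i j = lanner_C1 j i"
    by (simp_all add: lanner_C0_def lanner_C1_def insert_commute)
  moreover have "i = j \<or> (i, j) \<in> {(0,1),(0,2),(0,3),(0,4),(1,2),(1,3),(1,4),(2,3),(2,4),(3,4)}
      \<or> (j, i) \<in> {(0,1),(0,2),(0,3),(0,4),(1,2),(1,3),(1,4),(2,3),(2,4),(3,4)}"
    using cases_5[of i] cases_5[of j] by (elim disjE) simp_all
  ultimately show ?thesis
    using less[of i j] less[of j i] lorentz_sym[of "outer_normal v i" "outer_normal v j"]
    by (elim disjE) (simp_all add: normal_unit lanner_C0_def lanner_C1_def set_eq_subset)
qed

section \<open>Matrices over the ring obtained by adjoining a square root of two\<close>

lemma matrix_monoid_simps [simp]: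
  "carrier (matrix_monoid N) = {A. \<forall>i j. \<not> (i < N \<and> j < N) \<longrightarrow> A i j = 0}"
  "mult (matrix_monoid N) A B = (\<lambda>i j. \<Sum>k<N. A i k * B k j)"
  "one (matrix_monoid N) = (\<lambda>i j. if i = j \<and> i < N then 1 else 0)"
  by (simp_all add: matrix_monoid_def)

lemma matrix_monoid_monoid: "monoid (matrix_monoid N)"
proof (rule monoidI)
  fix A B C :: cmatrix
  show "A \<otimes>\<^bsub>matrix_monoid N\<^esub> B \<otimes>\<^bsub>matrix_monoid N\<^esub> C = A \<otimes>\<^bsub>matrix_monoid N\<^esub> (B \<otimes>\<^bsub>matrix_monoid N\<^esub> C)"
  proof (intro ext)
    fix i j
    have "(\<Sum>k<N. (\<Sum>l<N. A i l * B l k) * C k j) = (\<Sum>k<N. \<Sum>l<N. A i l * (B l k * C k j))"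
      by (simp add: sum_distrib_right mult.assoc)
    also have "\<dots> = (\<Sum>l<N. A i l * (\<Sum>k<N. B l k * C k j))"
      by (subst sum.swap) (simp add: sum_distrib_left)
    finally show "(A \<otimes>\<^bsub>matrix_monoid N\<^esub> B \<otimes>\<^bsub>matrix_monoid N\<^esub> C) i j
      = (A \<otimes>\<^bsub>matrix_monoid N\<^esub> (B \<otimes>\<^bsub>matrix_monoid N\<^esub> C)) i j" by simp
  qed
next
  fix A :: cmatrix
  assume A: "A \<in> carrier (matrix_monoid N)"
  show "\<one>\<^bsub>matrix_monoid N\<^esub> \<otimes>\<^bsub>matrix_monoid N\<^esub> A = A"
  proof (intro ext)
    fix i j
    have "(\<Sum>k<N. (if i = k \<and> i < N then 1 else 0) * A k j) = (\<Sum>k<N. if i = k then A k j else 0)"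
      by (rule sum.cong) auto
    then show "(\<one>\<^bsub>matrix_monoid N\<^esub> \<otimes>\<^bsub>matrix_monoid N\<^esub> A) i j = A i j"
      using A by simp
  qed
  show "A \<otimes>\<^bsub>matrix_monoid N\<^esub> \<one>\<^bsub>matrix_monoid N\<^esub> = A"
  proof (intro ext)
    fix i j
    have "(\<Sum>k<N. A i k * (if k = j \<and> k < N then 1 else 0)) = (\<Sum>k<N. if k = j then A i k else 0)"
      by (rule sum.cong) auto
    then show "(A \<otimes>\<^bsub>matrix_monoid N\<^esub> \<one>\<^bsub>matrix_monoid N\<^esub>) i j = A i j"
      using A by simp
  qed
qed auto

lemma GL_group: "group (GL N)"
  unfolding GL_def by (rule monoid.units_group[OF matrix_monoid_monoid])

lemma GL_simps [simp]:
  "carrier (GL N) = Units (matrix_monoid N)"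
  "mult (GL N) = mult (matrix_monoid N)"
  "one (GL N) = one (matrix_monoid N)"
  by (simp_all only: GL_def units_of_carrier units_of_mult units_of_one)

definition idx :: "5 \<Rightarrow> nat" where
  "idx i = (if i = 0 then 0 else if i = 1 then 1 else if i = 2 then 2 else if i = 3 then 3 else 4)"

lemma idx_less [simp]: "idx i < 5" "idx i + 5 < 10" "idx i < 10"
  by (simp_all add: idx_def)

lemma of_nat_idx [simp]: "of_nat (idx i) = i"
  using cases_5[of i] by (elim disjE) (simp_all add: idx_def)

lemma idx_neq [simp]: "idx i + 5 \<noteq> idx j" "idx j \<noteq> idx i + 5"
  using idx_less(1)[of j] by linarith+

lemma idx_eq_iff [simp]: "idx i = idx j \<longleftrightarrow> i = j"
  by (metis of_nat_idx)

lemma ex_idx: "m < 5 \<Longrightarrow> \<exists>i. m = idx i"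
proof -
  assume "m < 5"
  then have "m = idx 0 \<or> m = idx 1 \<or> m = idx 2 \<or> m = idx 3 \<or> m = idx 4"
    by (auto simp: idx_def)
  then show ?thesis by blast
qed

lemma sum_idx: "(\<Sum>k<5. f k) = (\<Sum>i\<in>UNIV. f (idx i))" for f :: "nat \<Rightarrow> 'a::comm_monoid_add"
  unfolding sum_UNIV_5 by (simp add: idx_def eval_nat_numeral add.assoc)

lemma sum_idx_10: "(\<Sum>k<10. f k) = (\<Sum>i\<in>UNIV. f (idx i)) + (\<Sum>i\<in>UNIV. f (idx i + 5))"
  for f :: "nat \<Rightarrow> 'a::comm_monoid_add"
  unfolding sum_UNIV_5 by (simp add: idx_def eval_nat_numeral add.assoc)

definition block :: "cmatrix \<Rightarrow> nat \<Rightarrow> nat \<Rightarrow> complex^5^5" where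
  "block A p q = (\<chi> i j. A (idx i + p) (idx j + q))"

lemma eq_if_blocks_eq:
  assumes A: "A \<in> carrier (matrix_monoid 10)" and B: "B \<in> carrier (matrix_monoid 10)"
    and eq: "\<And>p q. p \<in> {0, 5} \<Longrightarrow> q \<in> {0, 5} \<Longrightarrow> block A p q = block B p q"
  shows "A = B"
proof (intro ext)
  fix m n
  have split: "\<exists>i p. p \<in> {0, 5} \<and> m = idx i + p" if m: "m < 10" for m
  proof (cases "m < 5")
    case True
    then obtain i where "m = idx i" using ex_idx by blast
    then show ?thesis by (intro exI[of _ i] exI[of _ 0]) simp
  next
    case False
    have "m - 5 < 5" using m False by arith
    then obtain i where "m - 5 = idx i" using ex_idx by blast
    then show ?thesis using False by (intro exI[of _ i] exI[of _ 5]) auto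
  qed
  show "A m n = B m n"
  proof (cases "m < 10 \<and> n < 10")
    case True
    then obtain i p j q where "p \<in> {0, 5}" "m = idx i + p" "q \<in> {0, 5}" "n = idx j + q"
      using split by metis
    then show ?thesis using eq[of p q] by (auto simp: block_def vec_eq_iff)
  next
    case False
    then show ?thesis using A B by auto
  qed
qed

lemma block_mult:
  "block (A \<otimes>\<^bsub>matrix_monoid 10\<^esub> B) p q = block A p 0 ** block B 0 q + block A p 5 ** block B 5 q"
  by (simp add: vec_eq_iff block_def sum_idx_10 matrix_matrix_mult_def)

text \<open>With respect to the basis $e_i, \sqrt 2\, e_i$ of $\mathbb{Q}(\sqrt 2)^5$ over
  $\mathbb{Q}$, the matrix $X + \sqrt 2\, Y$ acts by the blocks $X$, $2Y$ in the first row and $Y$,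
  $X$ in the second.\<close>

definition block_form :: "cmatrix \<Rightarrow> bool" where
  "block_form A \<longleftrightarrow> A \<in> carrier (matrix_monoid 10) \<and>
     block A 5 5 = block A 0 0 \<and> block A 0 5 = 2 *\<^sub>R block A 5 0"

text \<open>The two homomorphisms that send $\sqrt 2$ to one of the two square roots $s$ of $2$.
  Together they identify the block matrices with pairs of matrices of size $5$.\<close>

definition specialise :: "real \<Rightarrow> cmatrix \<Rightarrow> complex^5^5" where
  "specialise s A = block A 0 0 + s *\<^sub>R block A 5 0"

text \<open>The inverse of the pair of homomorphisms: $X = (P + Q)/2$ and $Y = (P - Q)/(2 \sqrt
  2)$.\<close>

definition combine :: "complex^5^5 \<Rightarrow> complex^5^5 \<Rightarrow> cmatrix" where
  "combine P Q = (let X = (1/2) *\<^sub>R (P + Q); Y = (1 / (2 * sqrt 2)) *\<^sub>R (P - Q) in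
     (\<lambda>m n. if m < 5 \<and> n < 5 then X $ of_nat m $ of_nat n
       else if m < 5 \<and> n < 10 then 2 * Y $ of_nat m $ of_nat (n - 5)
       else if m < 10 \<and> n < 5 then Y $ of_nat (m - 5) $ of_nat n
       else if m < 10 \<and> n < 10 then X $ of_nat (m - 5) $ of_nat (n - 5)
       else 0))"

lemma block_combine:
  "block (combine P Q) 0 0 = (1/2) *\<^sub>R (P + Q)"
  "block (combine P Q) 0 5 = 2 *\<^sub>R ((1 / (2 * sqrt 2)) *\<^sub>R (P - Q))"
  "block (combine P Q) 5 0 = (1 / (2 * sqrt 2)) *\<^sub>R (P - Q)"
  "block (combine P Q) 5 5 = (1/2) *\<^sub>R (P + Q)"
  by (simp_all add: block_def combine_def Let_def vec_eq_iff scaleR_conv_of_real)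

lemma block_form_combine: "block_form (combine P Q)"
  unfolding block_form_def by (simp add: block_combine) (simp add: combine_def Let_def)

lemma specialise_combine:
  "specialise (sqrt 2) (combine P Q) = P" "specialise (- sqrt 2) (combine P Q) = Q"
proof -
  have "sqrt 2 * (1 / (2 * sqrt 2)) = 1 / 2" by simp
  then show "specialise (sqrt 2) (combine P Q) = P" "specialise (- sqrt 2) (combine P Q) = Q"
    unfolding specialise_def block_combine scaleR_scaleR minus_mult_left[symmetric]
    by (simp_all only:) (simp_all add: vec_eq_iff complex_eq_iff field_simps)
qed

lemma combine_specialise:
  assumes "block_form A"
  shows "combine (specialise (sqrt 2) A) (specialise (- sqrt 2) A) = A"
proof (rule eq_if_blocks_eq)
  show "combine (specialise (sqrt 2) A) (specialise (- sqrt 2) A) \<in> carrier (matrix_monoid 10)"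
    using block_form_combine by (auto simp: block_form_def)
  show "A \<in> carrier (matrix_monoid 10)" using assms by (simp add: block_form_def)
  have 1: "(1/2) *\<^sub>R (specialise (sqrt 2) A + specialise (- sqrt 2) A) = block A 0 0"
    by (simp add: specialise_def vec_eq_iff)
  have 2: "(1 / (2 * sqrt 2)) *\<^sub>R (specialise (sqrt 2) A - specialise (- sqrt 2) A) = block A 5 0"
    by (simp add: specialise_def vec_eq_iff complex_eq_iff field_simps)
  fix p q :: nat assume "p \<in> {0, 5}" "q \<in> {0, 5}"
  then show "block (combine (specialise (sqrt 2) A) (specialise (- sqrt 2) A)) p q = block A p q"
    using assms unfolding block_form_def by (elim insertE emptyE) (simp_all add: block_combine 1 2)
qed

lemma eq_if_specialise_eq:
  assumes "block_form A" "block_form B"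
    and "specialise (sqrt 2) A = specialise (sqrt 2) B"
    and "specialise (- sqrt 2) A = specialise (- sqrt 2) B"
  shows "A = B"
  using assms combine_specialise by metis

lemma scaleR_matrix_mult [simp]:
  "(c *\<^sub>R A) ** B = c *\<^sub>R (A ** B)" "A ** (c *\<^sub>R B) = c *\<^sub>R (A ** B)"
  for A B :: "'a::real_algebra_1^'n^'n"
  by (simp_all add: vec_eq_iff matrix_matrix_mult_def scaleR_sum_right)

lemma matrix_add_mult: "(A + B) ** C = A ** C + B ** C" for A B C :: "'a::semiring_1^'n^'n"
  by (simp add: vec_eq_iff matrix_matrix_mult_def distrib_right sum.distrib)

lemma block_form_mult:
  assumes "block_form A" "block_form B"
  shows "block_form (A \<otimes>\<^bsub>matrix_monoid 10\<^esub> B)"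
proof -
  have "A \<otimes>\<^bsub>matrix_monoid 10\<^esub> B \<in> carrier (matrix_monoid 10)"
    using assms by (auto simp: block_form_def)
  then show ?thesis
    using assms unfolding block_form_def block_mult by (simp add: scaleR_add_right add.commute)
qed

lemma specialise_mult:
  assumes "block_form A" "block_form B" and s: "s * s = 2"
  shows "specialise s (A \<otimes>\<^bsub>matrix_monoid 10\<^esub> B) = specialise s A ** specialise s B"
  using assms unfolding block_form_def specialise_def block_mult
  by (simp add: matrix_add_ldistrib matrix_add_mult scaleR_add_right scaleR_scaleR s algebra_simps)

lemma one_block_form: "block_form (\<one>\<^bsub>matrix_monoid 10\<^esub>)"
  by (simp add: block_form_def block_def vec_eq_iff)

lemma specialise_one: "specialise s (\<one>\<^bsub>matrix_monoid 10\<^esub>) = mat 1"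
  by (simp add: specialise_def block_def vec_eq_iff mat_def)

definition complexify :: "real^'n^'m \<Rightarrow> complex^'n^'m" where
  "complexify M = (\<chi> i j. complex_of_real (M $ i $ j))"

definition real_part :: "complex^'n^'m \<Rightarrow> real^'n^'m" where
  "real_part M = (\<chi> i j. Re (M $ i $ j))"

lemma real_part_complexify [simp]: "real_part (complexify M) = M"
  by (simp add: real_part_def complexify_def vec_eq_iff)

lemma complexify_eq_iff [simp]: "complexify A = complexify B \<longleftrightarrow> A = B"
  by (metis real_part_complexify)

lemma complexify_mult: "complexify (A ** B) = complexify A ** complexify B"
  by (simp add: complexify_def vec_eq_iff matrix_matrix_mult_def)

lemma complexify_one: "complexify (mat 1) = mat 1"
  by (simp add: complexify_def vec_eq_iff mat_def)

lemma complexify_transpose: "complexify (transpose A) = transpose (complexify A)"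
  by (simp add: complexify_def vec_eq_iff transpose_def)

section \<open>An algebraic group over the rationals from two conjugate forms\<close>

definition form_matrix :: "(5 \<Rightarrow> 5 \<Rightarrow> int) \<Rightarrow> (5 \<Rightarrow> 5 \<Rightarrow> int) \<Rightarrow> real \<Rightarrow> real^5^5" where
  "form_matrix C0 C1 s = (\<chi> i j. of_int (C0 i j) + s * of_int (C1 i j))"

definition isometries :: "('a::comm_semiring_1^'n^'n) \<Rightarrow> ('a^'n^'n) set" where
  "isometries C = {P. transpose P ** C ** P = C}"

lemma isometries_one: "mat 1 \<in> isometries C"
  by (simp add: isometries_def transpose_mat)

lemma isometries_mult: "P \<in> isometries C \<Longrightarrow> Q \<in> isometries C \<Longrightarrow> P ** Q \<in> isometries C"
  by (simp add: isometries_def matrix_transpose_mul) (metis matrix_mul_assoc)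

lemma isometries_inverse:
  fixes C :: "'a::field^'n^'n"
  assumes P: "P \<in> isometries C" and G: "G ** C = mat 1"
  shows "\<exists>Q\<in>isometries C. Q ** P = mat 1 \<and> P ** Q = mat 1"
proof -
  define Q where "Q = G ** transpose P ** C"
  have QP: "Q ** P = mat 1"
    using P G by (simp add: Q_def isometries_def) (metis matrix_mul_assoc)
  then have PQ: "P ** Q = mat 1" by (simp add: matrix_left_right_inverse)
  have "transpose Q ** transpose P = mat 1"
    using PQ by (metis matrix_transpose_mul transpose_mat)
  then have "transpose Q ** C ** Q = C"
  proof -
    assume QtPt: "transpose Q ** transpose P = mat 1"
    have "transpose Q ** C ** Q = transpose Q ** (transpose P ** C ** P) ** Q"
      using P by (simp add: isometries_def)
    also have "\<dots> = (transpose Q ** transpose P) ** C ** (P ** Q)" by (simp only: matrix_mul_assoc)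
    also have "\<dots> = C" by (simp add: QtPt PQ)
    finally show ?thesis .
  qed
  then show ?thesis using QP PQ by (auto simp: isometries_def)
qed

lemma rational_polynomial_sum:
  assumes "\<And>x. x \<in> S \<Longrightarrow> rational_polynomial N (f x)"
  shows "rational_polynomial N (\<lambda>A. \<Sum>x\<in>S. f x A)"
  using assms
proof (induction S rule: infinite_finite_induct)
  case (insert x S)
  then show ?case using rational_polynomial.add[of N "f x" "\<lambda>A. \<Sum>x\<in>S. f x A"] by simp
qed (auto intro: rational_polynomial.const)

lemma rational_polynomial_diff:
  assumes "rational_polynomial N f" "rational_polynomial N g"
  shows "rational_polynomial N (\<lambda>A. f A - g A)"
  using rational_polynomial.add[OF assms(1) rational_polynomial.mult[OF rational_polynomial.const[of "-1"] assms(2)]]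
  by simp

lemma transpose_mult_mult_entry:
  "(transpose P ** C ** P) $ i $ j = (\<Sum>k\<in>UNIV. \<Sum>l\<in>UNIV. P $ k $ i * C $ k $ l * P $ l $ j)"
  for P C :: "'a::comm_semiring_1^'n^'n"
  by (simp add: matrix_matrix_mult_def transpose_def sum_distrib_right) (rule sum.swap)

text \<open>The situation in which restriction of scalars from $\mathbb{Q}(\sqrt 2)$ to $\mathbb{Q}$
  produces an arithmetic group of isometries of hyperbolic space: the form $C_0 + \sqrt 2\, C_1$ is
  the Lorentz form in the basis given by the columns of $E$, and its conjugate $C_0 - \sqrt 2\, C_1$
  is positive definite and so has a compact isometry group.\<close>

locale conjugate_forms =
  fixes C0 C1 :: "5 \<Rightarrow> 5 \<Rightarrow> int" and E F :: "real^5^5" and c :: real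
  assumes FE: "F ** E = mat 1"
    and lorentz_form: "transpose E ** eta ** E = form_matrix C0 C1 (sqrt 2)"
    and c_pos: "c > 0"
    and definite: "c * (x \<bullet> x) \<le> x \<bullet> (form_matrix C0 C1 (- sqrt 2) *v x)"
begin

abbreviation C :: "real \<Rightarrow> real^5^5" where "C \<equiv> form_matrix C0 C1"

lemma EF: "E ** F = mat 1"
  using FE by (simp add: matrix_left_right_inverse)

lemma form_invertible:
  assumes "s \<in> {sqrt 2, - sqrt 2}"
  shows "\<exists>G. G ** C s = mat 1"
  using assms
proof (elim insertE emptyE)
  assume s: "s = sqrt 2"
  have "(F ** eta ** transpose F) ** C s = F ** eta ** (transpose F ** transpose E) ** eta ** E"
    by (simp add: s flip: lorentz_form) (simp only: matrix_mul_assoc)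
  also have "transpose F ** transpose E = mat 1"
    by (metis EF matrix_transpose_mul transpose_mat)
  finally have "(F ** eta ** transpose F) ** C s = F ** (eta ** eta) ** E"
    by (simp only: matrix_mul_assoc matrix_mul_rid)
  then show ?thesis by (auto simp: FE)
next
  assume s: "s = - sqrt 2"
  have "x = 0" if "C s *v x = 0" for x
  proof -
    have "c * (x \<bullet> x) \<le> 0" using definite[of x] that s by simp
    then show ?thesis using c_pos by (metis inner_gt_zero_iff mult_pos_pos not_le)
  qed
  then show ?thesis by (simp add: matrix_left_invertible_ker)
qed

definition unit_group :: "cmatrix set" where
  "unit_group = {A. block_form A \<and> (\<forall>s\<in>{sqrt 2, - sqrt 2}. specialise s A \<in> isometries (complexify (C s)))}"

lemma unit_groupD:
  assumes "A \<in> unit_group"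
  shows "block_form A" "specialise (sqrt 2) A \<in> isometries (complexify (C (sqrt 2)))"
    "specialise (- sqrt 2) A \<in> isometries (complexify (C (- sqrt 2)))"
  using assms by (auto simp: unit_group_def)

lemma combine_unit_group:
  assumes "P \<in> isometries (complexify (C (sqrt 2)))" "Q \<in> isometries (complexify (C (- sqrt 2)))"
  shows "combine P Q \<in> unit_group"
  using assms by (simp add: unit_group_def block_form_combine specialise_combine)

lemma unit_group_one: "\<one>\<^bsub>matrix_monoid 10\<^esub> \<in> unit_group"
  unfolding unit_group_def by (simp add: one_block_form specialise_one isometries_one del: matrix_monoid_simps)

lemma specialise_unit_group_mult:
  assumes "A \<in> unit_group" "B \<in> unit_group" "s \<in> {sqrt 2, - sqrt 2}"
  shows "specialise s (A \<otimes>\<^bsub>matrix_monoid 10\<^esub> B) = specialise s A ** specialise s B"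
  using assms by (intro specialise_mult) (auto simp: unit_group_def)

lemma unit_group_mult:
  assumes "A \<in> unit_group" "B \<in> unit_group"
  shows "A \<otimes>\<^bsub>matrix_monoid 10\<^esub> B \<in> unit_group"
proof -
  have "specialise s (A \<otimes>\<^bsub>matrix_monoid 10\<^esub> B) \<in> isometries (complexify (C s))" if "s \<in> {sqrt 2, - sqrt 2}" for s
    unfolding specialise_unit_group_mult[OF assms that]
    using assms that by (intro isometries_mult) (auto simp: unit_group_def)
  moreover have "block_form (A \<otimes>\<^bsub>matrix_monoid 10\<^esub> B)"
    using assms by (intro block_form_mult) (auto simp: unit_group_def)
  ultimately show ?thesis by (simp add: unit_group_def del: matrix_monoid_simps)
qed

lemma unit_group_eqI:
  assumes "A \<in> unit_group" "B \<in> unit_group"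
    and "specialise (sqrt 2) A = specialise (sqrt 2) B"
    and "specialise (- sqrt 2) A = specialise (- sqrt 2) B"
  shows "A = B"
  using assms by (intro eq_if_specialise_eq) (auto simp: unit_group_def)

lemma unit_group_inverse:
  assumes A: "A \<in> unit_group"
  shows "\<exists>B\<in>unit_group. B \<otimes>\<^bsub>matrix_monoid 10\<^esub> A = \<one>\<^bsub>matrix_monoid 10\<^esub>
    \<and> A \<otimes>\<^bsub>matrix_monoid 10\<^esub> B = \<one>\<^bsub>matrix_monoid 10\<^esub>"
proof -
  have inv: "\<exists>Q\<in>isometries (complexify (C s)). Q ** specialise s A = mat 1 \<and> specialise s A ** Q = mat 1"
    if s: "s \<in> {sqrt 2, - sqrt 2}" for s
  proof -
    obtain G where "G ** C s = mat 1" using form_invertible[OF s] by blast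
    then have "complexify G ** complexify (C s) = mat 1" by (metis complexify_mult complexify_one)
    moreover have "specialise s A \<in> isometries (complexify (C s))" using A s by (auto simp: unit_group_def)
    ultimately show ?thesis by (rule isometries_inverse[rotated])
  qed
  obtain P where P: "P \<in> isometries (complexify (C (sqrt 2)))" "P ** specialise (sqrt 2) A = mat 1"
      "specialise (sqrt 2) A ** P = mat 1"
    using inv[of "sqrt 2"] by auto
  obtain Q where Q: "Q \<in> isometries (complexify (C (- sqrt 2)))" "Q ** specialise (- sqrt 2) A = mat 1"
      "specialise (- sqrt 2) A ** Q = mat 1"
    using inv[of "- sqrt 2"] by auto
  have B: "combine P Q \<in> unit_group" using P Q by (intro combine_unit_group)
  have "combine P Q \<otimes>\<^bsub>matrix_monoid 10\<^esub> A = \<one>\<^bsub>matrix_monoid 10\<^esub>"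
    using P Q by (intro unit_group_eqI unit_group_mult unit_group_one A B)
      (simp_all add: specialise_unit_group_mult[OF B A] specialise_combine specialise_one del: matrix_monoid_simps)
  moreover have "A \<otimes>\<^bsub>matrix_monoid 10\<^esub> combine P Q = \<one>\<^bsub>matrix_monoid 10\<^esub>"
    using P Q by (intro unit_group_eqI unit_group_mult unit_group_one A B)
      (simp_all add: specialise_unit_group_mult[OF A B] specialise_combine specialise_one del: matrix_monoid_simps)
  ultimately show ?thesis using B by blast
qed

lemma unit_group_GL: "unit_group \<subseteq> carrier (GL 10)"
proof
  fix A assume A: "A \<in> unit_group"
  then obtain B where B: "B \<in> unit_group" "B \<otimes>\<^bsub>matrix_monoid 10\<^esub> A = \<one>\<^bsub>matrix_monoid 10\<^esub>"
      "A \<otimes>\<^bsub>matrix_monoid 10\<^esub> B = \<one>\<^bsub>matrix_monoid 10\<^esub>"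
    using unit_group_inverse by blast
  moreover have "A \<in> carrier (matrix_monoid 10)" "B \<in> carrier (matrix_monoid 10)"
    using A B(1) unit_groupD(1) unfolding block_form_def by blast+
  ultimately show "A \<in> carrier (GL 10)" unfolding GL_simps Units_def by blast
qed

lemma unit_group_inv:
  assumes "A \<in> unit_group"
  shows "inv\<^bsub>GL 10\<^esub> A \<in> unit_group"
proof -
  obtain B where B: "B \<in> unit_group" "B \<otimes>\<^bsub>matrix_monoid 10\<^esub> A = \<one>\<^bsub>matrix_monoid 10\<^esub>"
    using unit_group_inverse[OF assms] by blast
  then have "inv\<^bsub>GL 10\<^esub> A = B"
    using assms unit_group_GL by (intro group.inv_equality[OF GL_group]) (auto simp del: matrix_monoid_simps)
  then show ?thesis using B(1) by simp
qed

lemma unit_group_subgroup: "subgroup unit_group (GL 10)"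
proof (rule group.subgroupI[OF GL_group])
  show "unit_group \<noteq> {}" using unit_group_one by blast
qed (use unit_group_GL unit_group_inv unit_group_mult in \<open>auto simp del: matrix_monoid_simps\<close>)

text \<open>A matrix $X + s Y$ preserves $C_0 + s\, C_1$ exactly if $F_0 + s F_1 = 0$ for certain
  rational polynomials $F_0$ and $F_1$ in the entries of $X$ and $Y$. Asking this for both square
  roots $s$ of $2$ amounts to $F_0 = F_1 = 0$, so that no irrational coefficient is left. The
  polynomials $G_0$ and $G_1$ express the block form.\<close>

lemma unit_group_algebraic: "algebraic_group_over_Q 10 unit_group"
proof -
  define c0 where "c0 k l = complex_of_int (C0 k l)" for k l
  define c1 where "c1 k l = complex_of_int (C1 k l)" for k l
  define X where "X A = block A 0 0" for A
  define Y where "Y A = block A 5 0" for A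
  define F0 where "F0 i j A = (\<Sum>k\<in>UNIV. \<Sum>l\<in>UNIV. X A $ k $ i * c0 k l * X A $ l $ j
      + 2 * (X A $ k $ i * c1 k l * Y A $ l $ j) + 2 * (Y A $ k $ i * c1 k l * X A $ l $ j)
      + 2 * (Y A $ k $ i * c0 k l * Y A $ l $ j)) - c0 i j" for i j A
  define F1 where "F1 i j A = (\<Sum>k\<in>UNIV. \<Sum>l\<in>UNIV. X A $ k $ i * c1 k l * X A $ l $ j
      + X A $ k $ i * c0 k l * Y A $ l $ j + Y A $ k $ i * c0 k l * X A $ l $ j
      + 2 * (Y A $ k $ i * c1 k l * Y A $ l $ j)) - c1 i j" for i j A
  define G0 where "G0 i j A = A (idx i + 5) (idx j + 5) - A (idx i) (idx j)" for i j and A :: cmatrix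
  define G1 where "G1 i j A = A (idx i) (idx j + 5) - 2 * A (idx i + 5) (idx j)" for i j and A :: cmatrix
  define P where "P = (\<Union>i j. {F0 i j, F1 i j, G0 i j, G1 i j})"
  have "rational_polynomial 10 f" if "f \<in> P" for f
  proof -
    have X: "rational_polynomial 10 (\<lambda>A. X A $ k $ i)" and Y: "rational_polynomial 10 (\<lambda>A. Y A $ k $ i)" for k i
      unfolding X_def Y_def block_def by (auto intro: rational_polynomial.entry)
    have c: "rational_polynomial 10 (\<lambda>A. c0 k i)" "rational_polynomial 10 (\<lambda>A. c1 k i)" for k i
      unfolding c0_def c1_def by (auto intro: rational_polynomial.const)
    have two: "rational_polynomial 10 (\<lambda>A. 2)" by (auto intro: rational_polynomial.const)
    have "rational_polynomial 10 (F0 i j)" "rational_polynomial 10 (F1 i j)" for i j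
      unfolding F0_def F1_def
      by (intro rational_polynomial_diff rational_polynomial_sum rational_polynomial.add
          rational_polynomial.mult X Y c two)+
    moreover have "rational_polynomial 10 (G0 i j)" "rational_polynomial 10 (G1 i j)" for i j
      unfolding G0_def G1_def
      by (intro rational_polynomial_diff rational_polynomial.mult two rational_polynomial.entry; simp)+
    ultimately show ?thesis using that unfolding P_def by blast
  qed
  moreover have "unit_group = {A \<in> carrier (GL 10). \<forall>f\<in>P. f A = 0}"
  proof -
    have "A \<in> unit_group \<longleftrightarrow> (\<forall>f\<in>P. f A = 0)" if A: "A \<in> carrier (matrix_monoid 10)" for A
    proof -
      have form: "specialise s A \<in> isometries (complexify (C s)) \<longleftrightarrow> (\<forall>i j. F0 i j A + s * F1 i j A = 0)"
        if s: "s * s = 2" for s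
      proof -
        have s': "complex_of_real s * complex_of_real s = 2" by (metis s of_real_mult of_real_numeral)
        have "(transpose (specialise s A) ** complexify (C s) ** specialise s A) $ i $ j - complexify (C s) $ i $ j
          = F0 i j A + s * F1 i j A" for i j
        proof -
          have "(\<Sum>k\<in>UNIV. \<Sum>l\<in>UNIV. specialise s A $ k $ i * complexify (C s) $ k $ l * specialise s A $ l $ j)
            = (\<Sum>k\<in>UNIV. \<Sum>l\<in>UNIV. (X A $ k $ i * c0 k l * X A $ l $ j
                + 2 * (X A $ k $ i * c1 k l * Y A $ l $ j) + 2 * (Y A $ k $ i * c1 k l * X A $ l $ j)
                + 2 * (Y A $ k $ i * c0 k l * Y A $ l $ j))
              + s * (X A $ k $ i * c1 k l * X A $ l $ j
                + X A $ k $ i * c0 k l * Y A $ l $ j + Y A $ k $ i * c0 k l * X A $ l $ j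
                + 2 * (Y A $ k $ i * c1 k l * Y A $ l $ j)))"
          proof (intro sum.cong refl)
            fix k l :: 5
            have "(x + t * y) * (a + t * b) * (x' + t * y') = (x * a * x' + 2 * (x * b * y') + 2 * (y * b * x')
              + 2 * (y * a * y')) + t * (x * b * x' + x * a * y' + y * a * x' + 2 * (y * b * y'))"
              if "t * t = 2" for t x y a b x' y' :: complex
            proof -
              have "(x + t * y) * (a + t * b) * (x' + t * y') = x * a * x'
                + (t * t) * (x * b * y' + y * b * x' + y * a * y')
                + t * (x * b * x' + x * a * y' + y * a * x' + (t * t) * (y * b * y'))"
                by (simp add: algebra_simps)
              then show ?thesis unfolding that by (simp add: algebra_simps)
            qed
            from this[OF s']
            show "specialise s A $ k $ i * complexify (C s) $ k $ l * specialise s A $ l $ j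
              = (X A $ k $ i * c0 k l * X A $ l $ j
                + 2 * (X A $ k $ i * c1 k l * Y A $ l $ j) + 2 * (Y A $ k $ i * c1 k l * X A $ l $ j)
                + 2 * (Y A $ k $ i * c0 k l * Y A $ l $ j))
              + s * (X A $ k $ i * c1 k l * X A $ l $ j
                + X A $ k $ i * c0 k l * Y A $ l $ j + Y A $ k $ i * c0 k l * X A $ l $ j
                + 2 * (Y A $ k $ i * c1 k l * Y A $ l $ j))"
              unfolding specialise_def X_def Y_def c0_def c1_def complexify_def form_matrix_def
              by (simp add: scaleR_conv_of_real[where 'a=complex])
          qed
          also have "\<dots> = (F0 i j A + c0 i j) + s * (F1 i j A + c1 i j)"
          proof -
            have "(\<Sum>k\<in>UNIV. \<Sum>l\<in>UNIV. f k l + t * g k l)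
              = (\<Sum>k\<in>UNIV. \<Sum>l\<in>UNIV. f k l) + t * (\<Sum>k\<in>UNIV. \<Sum>l\<in>UNIV. g k l)"
              for f g :: "5 \<Rightarrow> 5 \<Rightarrow> complex" and t
              by (simp add: sum.distrib sum_distrib_left)
            then show ?thesis unfolding F0_def F1_def diff_add_cancel .
          qed
          finally show ?thesis
            unfolding transpose_mult_mult_entry
            by (simp add: complexify_def form_matrix_def c0_def c1_def algebra_simps)
        qed
        then show ?thesis unfolding isometries_def vec_eq_iff mem_Collect_eq by (metis right_minus_eq)
      qed
      have "(\<forall>s\<in>{sqrt 2, - sqrt 2}. specialise s A \<in> isometries (complexify (C s)))
        \<longleftrightarrow> (\<forall>i j. F0 i j A + sqrt 2 * F1 i j A = 0 \<and> F0 i j A + (- sqrt 2) * F1 i j A = 0)"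
        using form[of "sqrt 2"] form[of "- sqrt 2"] by auto
      also have "\<dots> \<longleftrightarrow> (\<forall>i j. F0 i j A = 0 \<and> F1 i j A = 0)"
      proof -
        have "x + sqrt 2 * y = 0 \<and> x + (- sqrt 2) * y = 0 \<longleftrightarrow> x = 0 \<and> y = 0" for x y :: complex
        proof safe
          assume "x + sqrt 2 * y = 0" "x + (- sqrt 2) * y = 0"
          then have "(x + sqrt 2 * y) + (x + (- sqrt 2) * y) = 0" by simp
          then show "x = 0" by simp
          with \<open>x + sqrt 2 * y = 0\<close> show "y = 0" by simp
        qed auto
        then show ?thesis by simp
      qed
      finally have "A \<in> unit_group \<longleftrightarrow> block_form A \<and> (\<forall>i j. F0 i j A = 0 \<and> F1 i j A = 0)"
        unfolding unit_group_def by blast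
      moreover have "block_form A \<longleftrightarrow> (\<forall>i j. G0 i j A = 0 \<and> G1 i j A = 0)"
        using A unfolding block_form_def G0_def G1_def block_def
        by (auto simp: vec_eq_iff scaleR_conv_of_real[where 'a=complex] simp del: matrix_monoid_simps)
      ultimately show ?thesis unfolding P_def by auto
    qed
    moreover have "carrier (GL 10) \<subseteq> carrier (matrix_monoid 10)" unfolding GL_simps Units_def by blast
    ultimately show ?thesis using unit_group_GL by blast
  qed
  ultimately show ?thesis
    unfolding algebraic_group_over_Q_def using unit_group_subgroup by blast
qed

end

section \<open>The real points\<close>

lemma matrix_minus_mult [simp]: "(- A) ** B = - (A ** B)" "A ** (- B) = - (A ** B)"
  for A B :: "'a::ring_1^'n^'n"
  by (simp_all add: vec_eq_iff matrix_matrix_mult_def sum_negf)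

lemma transpose_minus [simp]: "transpose (- A) = - transpose A"
  by (simp add: vec_eq_iff transpose_def)

text \<open>The isometry among $M$ and $-M$ that preserves the upper sheet; this is the isomorphism
  of $\mathrm{O}(4,1)/\{\pm 1\}$ with $\mathrm{O}^+(4,1)$.\<close>

definition orthochronous :: "real^5^5 \<Rightarrow> real^5^5" where
  "orthochronous M = sgn (M $ 4 $ 4) *\<^sub>R M"

lemma preserves_lorentz_44:
  assumes "transpose M ** eta ** M = eta"
  shows "1 \<le> \<bar>M $ 4 $ 4\<bar>"
proof -
  have "lorentz (M *v origin) (M *v origin) = -1"
    using assms preserves_lorentz_iff[of M] H4_D(1)[OF origin_H4] by simp
  then have "1 \<le> (M $ 4 $ 4) * (M $ 4 $ 4)"
    by (simp add: lorentz_expand mult_vec_origin)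
      (smt (verit) zero_le_square)
  then show ?thesis by (metis abs_le_square_iff abs_one mult_1 power2_eq_square)
qed

lemma orthochronous_cases:
  assumes "transpose M ** eta ** M = eta"
  obtains "orthochronous M = M" | "orthochronous M = - M"
proof -
  have "M $ 4 $ 4 \<noteq> 0" using preserves_lorentz_44[OF assms] by auto
  then show ?thesis using that by (cases "M $ 4 $ 4 > 0") (auto simp: orthochronous_def sgn_if)
qed

lemma orthochronous_O41:
  assumes M: "transpose M ** eta ** M = eta"
  shows "orthochronous M \<in> carrier O41"
proof -
  have "transpose (orthochronous M) ** eta ** orthochronous M
    = (sgn (M $ 4 $ 4) * sgn (M $ 4 $ 4)) *\<^sub>R (transpose M ** eta ** M)"
    by (simp add: orthochronous_def transpose_scalar)
  also have "sgn (M $ 4 $ 4) * sgn (M $ 4 $ 4) = 1"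
  proof -
    have "M $ 4 $ 4 \<noteq> 0" using preserves_lorentz_44[OF M] by auto
    then show ?thesis by (simp add: sgn_if)
  qed
  finally have "transpose (orthochronous M) ** eta ** orthochronous M = eta" using M by simp
  moreover have "orthochronous M $ 4 $ 4 > 0"
    using preserves_lorentz_44[OF M] by (auto simp: orthochronous_def sgn_if)
  ultimately show ?thesis by (simp add: carrier_O41)
qed

lemma orthochronous_eq_self: "M \<in> carrier O41 \<Longrightarrow> orthochronous M = M"
  by (simp add: carrier_O41 orthochronous_def)

text \<open>Both sides are $\pm M N$ and both have a positive corner entry.\<close>

lemma orthochronous_mult:
  assumes M: "transpose M ** eta ** M = eta" and N: "transpose N ** eta ** N = eta"
  shows "orthochronous (M ** N) = orthochronous M ** orthochronous N"
proof -
  define t where "t = sgn (M $ 4 $ 4) * sgn (N $ 4 $ 4)"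
  have t: "t = 1 \<or> t = -1"
    using preserves_lorentz_44[OF M] preserves_lorentz_44[OF N] by (auto simp: t_def sgn_if)
  have tMN: "orthochronous M ** orthochronous N = t *\<^sub>R (M ** N)"
    by (simp add: orthochronous_def t_def)
  moreover have "orthochronous M ** orthochronous N \<in> carrier O41"
    using O41.m_closed[OF orthochronous_O41[OF M] orthochronous_O41[OF N]] by simp
  ultimately have "t * (M ** N) $ 4 $ 4 > 0" by (simp add: carrier_O41)
  then have "sgn ((M ** N) $ 4 $ 4) = t" using t by (auto simp: sgn_if)
  then show ?thesis by (simp add: tMN) (simp add: orthochronous_def)
qed

text \<open>The $j$-th column of an isometry has the same value of the form as the $j$-th basis
  vector, and definiteness turns this value into a bound on its length.\<close>

lemma isometry_entry_bound:
  fixes C :: "real^'n^'n"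
  assumes pos: "c > 0" "\<And>x. c * (x \<bullet> x) \<le> x \<bullet> (C *v x)" and P: "P \<in> isometries C"
  shows "\<bar>P $ i $ j\<bar> \<le> 1 + (\<Sum>k\<in>UNIV. \<bar>C $ k $ k\<bar>) / c"
proof -
  define x where "x = P *v axis j 1"
  have xi: "x $ i = P $ i $ j" by (simp add: x_def matrix_vector_mul_component inner_axis)
  have "x \<bullet> (C *v x) = axis j 1 \<bullet> ((transpose P ** C ** P) *v axis j 1)"
    by (simp add: x_def inner_mult_vec matrix_vector_mul_assoc matrix_mul_assoc)
  also have "\<dots> = C $ j $ j"
    using P by (simp add: isometries_def inner_axis' matrix_vector_mul_component inner_axis)
  also have "\<dots> \<le> (\<Sum>k\<in>UNIV. \<bar>C $ k $ k\<bar>)"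
    using member_le_sum[of j UNIV "\<lambda>k. \<bar>C $ k $ k\<bar>"] by simp
  finally have "x \<bullet> (C *v x) \<le> (\<Sum>k\<in>UNIV. \<bar>C $ k $ k\<bar>)" .
  with pos(2)[of x] have "c * (x \<bullet> x) \<le> (\<Sum>k\<in>UNIV. \<bar>C $ k $ k\<bar>)" by linarith
  then have xx: "x \<bullet> x \<le> (\<Sum>k\<in>UNIV. \<bar>C $ k $ k\<bar>) / c" using pos(1) by (simp add: field_simps)
  have "\<bar>x $ i\<bar> \<le> 1 + (x $ i)\<^sup>2"
    using zero_le_power2[of "\<bar>x $ i\<bar> - 1"] zero_le_power2[of "x $ i"] by (simp add: power2_eq_square algebra_simps)
  also have "(x $ i)\<^sup>2 \<le> x \<bullet> x"
    using component_le_norm_cart[of x i] by (metis abs_ge_zero power2_abs power2_norm_eq_inner power_mono)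
  finally show ?thesis using xx xi by simp
qed

lemma compact_isometries:
  fixes C :: "real^'n^'n"
  assumes pos: "c > 0" "\<And>x. c * (x \<bullet> x) \<le> x \<bullet> (C *v x)"
  shows "compact (isometries C)"
proof -
  have "bounded (isometries C)"
    using isometry_entry_bound[OF pos] by (intro bounded_matrices)
  moreover have "closed (isometries C)"
    unfolding isometries_def vec_eq_iff[of "transpose _ ** _ ** _"] vec_eq_iff[of "(transpose _ ** _ ** _) $ _"]
      transpose_mult_mult_entry
    by (intro closed_Collect_all closed_Collect_eq continuous_intros)
  ultimately show ?thesis by (simp add: compact_eq_bounded_closed)
qed

text \<open>With \<open>finite_bounded_integer_matrices\<close>, this is the source of discreteness:
  bounds on both conjugates of an integral matrix leave finitely many possibilities.\<close>

lemma norm_combine_le: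
  assumes "\<And>i j. norm (P $ i $ j) \<le> a" "\<And>i j. norm (Q $ i $ j) \<le> b"
  shows "norm (combine P Q m n) \<le> a + b"
proof -
  have a0: "0 \<le> a" "0 \<le> b" using assms[of 0 0] norm_ge_zero order.trans by blast+
  have p: "norm (P $ i $ j + Q $ i $ j) \<le> a + b" "norm (P $ i $ j - Q $ i $ j) \<le> a + b" for i j
    using norm_triangle_ineq[of "P $ i $ j" "Q $ i $ j"] norm_triangle_ineq4[of "P $ i $ j" "Q $ i $ j"]
      assms(1)[of i j] assms(2)[of i j] by linarith+
  have X: "norm ((1/2::real) *\<^sub>R (P $ i $ j + Q $ i $ j)) \<le> a + b" for i j
    using p(1)[of i j] norm_ge_zero[of "P $ i $ j + Q $ i $ j"] a0 unfolding norm_scaleR by simp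
  have Y: "norm ((1 / (2 * sqrt 2)) *\<^sub>R (P $ i $ j - Q $ i $ j)) \<le> (a + b) / 2" for i j
  proof -
    have "\<bar>1 / (2 * sqrt 2)\<bar> * norm (P $ i $ j - Q $ i $ j) \<le> (1/2) * (a + b)"
      using p(2)[of i j] a0 by (intro mult_mono) (auto simp: field_simps)
    then show ?thesis by simp
  qed
  have Y1: "norm ((1 / (2 * sqrt 2)) *\<^sub>R (P $ i $ j - Q $ i $ j)) \<le> a + b" for i j
    using a0 by (intro order.trans[OF Y]) simp
  have Y2: "norm (2 * ((1 / (2 * sqrt 2)) *\<^sub>R (P $ i $ j - Q $ i $ j))) \<le> a + b" for i j
    using Y[of i j] unfolding norm_mult by simp
  show ?thesis
    unfolding combine_def Let_def vector_scaleR_component vector_add_component vector_minus_component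
    using X Y1 Y2 a0 by simp
qed

lemma finite_bounded_integer_matrices:
  "finite {A \<in> carrier (matrix_monoid N). \<forall>i j. A i j \<in> \<int> \<and> norm (A i j) \<le> B}"
proof -
  define Z where "Z = {z::complex. z \<in> \<int> \<and> norm z \<le> B}"
  have "Z \<subseteq> of_int ` {-\<lceil>B\<rceil>..\<lceil>B\<rceil>}"
  proof
    fix z assume "z \<in> Z"
    then obtain n :: int where n: "z = of_int n" "norm z \<le> B" by (auto simp: Z_def elim: Ints_cases)
    then have "real_of_int \<bar>n\<bar> \<le> real_of_int \<lceil>B\<rceil>"
      using le_of_int_ceiling[of B] by (simp only: norm_of_int of_int_abs)
    then have "\<bar>n\<bar> \<le> \<lceil>B\<rceil>" by (simp only: of_int_le_iff)
    then have "n \<in> {-\<lceil>B\<rceil>..\<lceil>B\<rceil>}" unfolding atLeastAtMost_iff by linarith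
    then show "z \<in> of_int ` {-\<lceil>B\<rceil>..\<lceil>B\<rceil>}" using n by blast
  qed
  then have Z: "finite Z" using finite_subset by blast
  have R: "finite {f::nat \<Rightarrow> complex. \<forall>x. (x \<in> {..<N} \<longrightarrow> f x \<in> Z) \<and> (x \<notin> {..<N} \<longrightarrow> f x = 0)}"
    by (rule finite_set_of_finite_funs[OF finite_lessThan Z])
  have "finite {A::cmatrix. \<forall>x. (x \<in> {..<N} \<longrightarrow> A x \<in> {f. \<forall>x. (x \<in> {..<N} \<longrightarrow> f x \<in> Z) \<and> (x \<notin> {..<N} \<longrightarrow> f x = 0)})
      \<and> (x \<notin> {..<N} \<longrightarrow> A x = (\<lambda>_. 0))}"
    by (rule finite_set_of_finite_funs[OF finite_lessThan R])
  then show ?thesis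
    by (rule finite_subset[rotated]) (auto simp: Z_def fun_eq_iff)
qed

context conjugate_forms
begin

lemma real_pointsD:
  assumes "A \<in> real_points unit_group"
  shows "A \<in> unit_group" "complexify (real_part (specialise s A)) = specialise s A"
proof -
  show "A \<in> unit_group" using assms by (simp add: real_points_def)
  have "A i j = of_real (Re (A i j))" for i j
    using assms by (simp add: real_points_def complex_is_Real_iff complex_eq_iff)
  then show "complexify (real_part (specialise s A)) = specialise s A"
    by (simp add: complexify_def real_part_def specialise_def block_def vec_eq_iff complex_eq_iff)
qed

lemma real_part_isometries:
  assumes A: "A \<in> real_points unit_group" and s: "s \<in> {sqrt 2, - sqrt 2}"
  shows "real_part (specialise s A) \<in> isometries (C s)"
proof -
  have "complexify (real_part (specialise s A)) \<in> isometries (complexify (C s))"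
    using real_pointsD[OF A] s by (auto simp: unit_group_def)
  then show ?thesis
    by (simp add: isometries_def flip: complexify_mult complexify_transpose)
qed

lemma combine_real_points:
  assumes "P \<in> isometries (C (sqrt 2))" "Q \<in> isometries (C (- sqrt 2))"
  shows "combine (complexify P) (complexify Q) \<in> real_points unit_group"
proof -
  have "complexify P \<in> isometries (complexify (C (sqrt 2)))" "complexify Q \<in> isometries (complexify (C (- sqrt 2)))"
    using assms by (simp_all add: isometries_def flip: complexify_mult complexify_transpose)
  then have "combine (complexify P) (complexify Q) \<in> unit_group" by (rule combine_unit_group)
  moreover have "combine (complexify P) (complexify Q) i j \<in> \<real>" for i j
    by (simp add: combine_def Let_def complexify_def complex_is_Real_iff)
  ultimately show ?thesis by (simp add: real_points_def)
qed

lemma real_points_eq_combine: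
  assumes A: "A \<in> real_points unit_group"
  shows "A = combine (complexify (real_part (specialise (sqrt 2) A))) (complexify (real_part (specialise (- sqrt 2) A)))"
  using real_pointsD[OF A] combine_specialise[of A] by (simp add: unit_group_def)

definition to_O41 :: "cmatrix \<Rightarrow> real^5^5" where
  "to_O41 A = orthochronous (E ** real_part (specialise (sqrt 2) A) ** F)"

lemma E_conj_preserves:
  assumes "P \<in> isometries (C (sqrt 2))"
  shows "transpose (E ** P ** F) ** eta ** (E ** P ** F) = eta"
proof -
  have "transpose (E ** P ** F) ** eta ** (E ** P ** F)
      = transpose F ** (transpose P ** (transpose E ** eta ** E) ** P) ** F"
    by (simp add: matrix_transpose_mul matrix_mul_assoc)
  also have "\<dots> = transpose F ** (transpose E ** eta ** E) ** F"
    using assms by (simp add: lorentz_form isometries_def)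
  also have "\<dots> = (transpose F ** transpose E) ** eta ** (E ** F)" by (simp only: matrix_mul_assoc)
  also have "\<dots> = eta" by (simp add: EF transpose_mat flip: matrix_transpose_mul)
  finally show ?thesis .
qed

lemma real_preserves:
  assumes "A \<in> real_points unit_group"
  shows "transpose (E ** real_part (specialise (sqrt 2) A) ** F) ** eta ** (E ** real_part (specialise (sqrt 2) A) ** F) = eta"
  using real_part_isometries[OF assms, of "sqrt 2"] by (intro E_conj_preserves) simp

lemma to_O41_mult:
  assumes A: "A \<in> real_points unit_group" and B: "B \<in> real_points unit_group"
  shows "to_O41 (A \<otimes>\<^bsub>GL 10\<^esub> B) = to_O41 A ** to_O41 B"
proof -
  have "specialise (sqrt 2) (A \<otimes>\<^bsub>matrix_monoid 10\<^esub> B) = specialise (sqrt 2) A ** specialise (sqrt 2) B"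
    using real_pointsD(1)[OF A] real_pointsD(1)[OF B] by (intro specialise_unit_group_mult) auto
  also have "\<dots> = complexify (real_part (specialise (sqrt 2) A) ** real_part (specialise (sqrt 2) B))"
    by (simp add: complexify_mult real_pointsD(2)[OF A] real_pointsD(2)[OF B])
  finally have "real_part (specialise (sqrt 2) (A \<otimes>\<^bsub>GL 10\<^esub> B))
      = real_part (specialise (sqrt 2) A) ** real_part (specialise (sqrt 2) B)"
    by (simp del: matrix_monoid_simps)
  then have "E ** real_part (specialise (sqrt 2) (A \<otimes>\<^bsub>GL 10\<^esub> B)) ** F
      = E ** real_part (specialise (sqrt 2) A) ** (F ** E) ** real_part (specialise (sqrt 2) B) ** F"
    by (simp add: FE matrix_mul_assoc)
  also have "\<dots> = (E ** real_part (specialise (sqrt 2) A) ** F) ** (E ** real_part (specialise (sqrt 2) B) ** F)"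
    by (simp only: matrix_mul_assoc)
  finally show ?thesis
    unfolding to_O41_def using orthochronous_mult[OF real_preserves[OF A] real_preserves[OF B]] by simp
qed

lemma to_O41_carrier: "A \<in> real_points unit_group \<Longrightarrow> to_O41 A \<in> carrier O41"
  unfolding to_O41_def by (intro orthochronous_O41 real_preserves)

lemma to_O41_combine:
  "to_O41 (combine (complexify P) Q) = orthochronous (E ** P ** F)"
  by (simp add: to_O41_def specialise_combine)

text \<open>A preimage of $M$ is the pair that consists of $M$ in the basis $E$ and the
  identity.\<close>

lemma to_O41_surj: "to_O41 ` real_points unit_group = carrier O41"
proof
  show "to_O41 ` real_points unit_group \<subseteq> carrier O41" using to_O41_carrier by blast
  show "carrier O41 \<subseteq> to_O41 ` real_points unit_group"
  proof
    fix M assume M: "M \<in> carrier O41"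
    define P where "P = F ** M ** E"
    have FEt: "transpose F ** transpose E = mat 1"
      by (simp add: EF transpose_mat flip: matrix_transpose_mul)
    have "transpose P ** C (sqrt 2) ** P
        = transpose E ** transpose M ** (transpose F ** transpose E) ** eta ** (E ** F) ** M ** E"
      unfolding P_def matrix_transpose_mul lorentz_form[symmetric] by (simp only: matrix_mul_assoc)
    also have "\<dots> = transpose E ** (transpose M ** eta ** M) ** E"
      unfolding FEt EF matrix_mul_rid by (simp only: matrix_mul_assoc)
    also have "\<dots> = C (sqrt 2)" using M by (simp add: carrier_O41 lorentz_form)
    finally have "P \<in> isometries (C (sqrt 2))" by (simp add: isometries_def)
    then have "combine (complexify P) (complexify (mat 1)) \<in> real_points unit_group"
      by (intro combine_real_points isometries_one)
    moreover have "E ** P ** F = (E ** F) ** M ** (E ** F)"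
      by (simp only: P_def matrix_mul_assoc)
    then have "to_O41 (combine (complexify P) (complexify (mat 1))) = M"
      by (simp add: to_O41_combine EF orthochronous_eq_self[OF M])
    ultimately show "M \<in> to_O41 ` real_points unit_group" by (metis image_eqI)
  qed
qed

lemma to_O41_continuous: "continuous_on (real_points unit_group) to_O41"
proof -
  have entry: "continuous_on S (\<lambda>A::cmatrix. A i j)" for S i j
    by (rule continuous_on_product_then_coordinatewise[OF continuous_on_product_then_coordinatewise[OF continuous_on_id]])
  define M where "M A = E ** real_part (specialise (sqrt 2) A) ** F" for A
  have "continuous_on (real_points unit_group) (\<lambda>A. real_part (specialise (sqrt 2) A))"
    unfolding real_part_def
  proof (intro continuous_on_vec_lambda)
    fix i j
    show "continuous_on (real_points unit_group) (\<lambda>A. Re (specialise (sqrt 2) A $ i $ j))"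
      unfolding specialise_def block_def vector_add_component vector_scaleR_component vec_lambda_beta
      by (intro continuous_on_Re continuous_on_add continuous_on_scaleR continuous_on_const entry)
  qed
  then have "continuous_on (real_points unit_group) M"
    unfolding M_def matrix_matrix_mult_def
    by (intro continuous_on_vec_lambda) (simp, intro continuous_on_sum continuous_on_mult continuous_on_const continuous_on_component)
  moreover have "M A $ 4 $ 4 \<noteq> 0" if "A \<in> real_points unit_group" for A
    using preserves_lorentz_44[OF real_preserves[OF that]] by (auto simp: M_def)
  ultimately have "continuous_on (real_points unit_group) (\<lambda>A. sgn (M A $ 4 $ 4) *\<^sub>R M A)"
    by (intro continuous_on_scaleR continuous_on_sgn continuous_on_component) auto
  then show ?thesis by (simp add: M_def to_O41_def orthochronous_def[abs_def] cong: continuous_on_cong)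
qed

text \<open>The kernel is $\{\pm 1\} \times \mathrm{O}(q_-)$, where $q_-$ is the positive definite
  conjugate form.\<close>

lemma compact_kernel: "compact (kernel (GL 10\<lparr>carrier := real_points unit_group\<rparr>) O41 to_O41)"
proof -
  let ?f = "\<lambda>p. combine (complexify (fst p)) (complexify (snd p))"
  have K: "kernel (GL 10\<lparr>carrier := real_points unit_group\<rparr>) O41 to_O41
    = ?f ` ({mat 1, - mat 1} \<times> isometries (C (- sqrt 2)))" (is "?K = ?I")
  proof
    show "?K \<subseteq> ?I"
    proof
      fix A assume "A \<in> ?K"
      then have A: "A \<in> real_points unit_group" and ker: "to_O41 A = mat 1" by (auto simp: kernel_def)
      define P where "P = real_part (specialise (sqrt 2) A)"
      have P: "P = F ** (E ** P ** F) ** E"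
      proof -
        have "F ** (E ** P ** F) ** E = (F ** E) ** P ** (F ** E)" by (simp only: matrix_mul_assoc)
        then show ?thesis by (simp add: FE)
      qed
      have "E ** P ** F = mat 1 \<or> E ** P ** F = - mat 1"
        using ker real_preserves[OF A] unfolding to_O41_def P_def
        by (metis orthochronous_cases minus_minus)
      then have "P = mat 1 \<or> P = - mat 1"
      proof
        assume "E ** P ** F = - mat 1"
        then show ?thesis using P by (simp add: FE)
      qed (use P FE in simp)
      moreover have "real_part (specialise (- sqrt 2) A) \<in> isometries (C (- sqrt 2))"
        by (rule real_part_isometries[OF A]) simp
      ultimately show "A \<in> ?I"
        using real_points_eq_combine[OF A] unfolding P_def[symmetric]
        by (intro image_eqI[of _ _ "(P, real_part (specialise (- sqrt 2) A))"]) auto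
    qed
    show "?I \<subseteq> ?K"
    proof
      fix A assume "A \<in> ?I"
      then obtain P Q where A: "A = combine (complexify P) (complexify Q)" and P: "P = mat 1 \<or> P = - mat 1"
        and Q: "Q \<in> isometries (C (- sqrt 2))" by auto
      have "P \<in> isometries (C (sqrt 2))"
        using P by (auto simp: isometries_def transpose_mat transpose_scalar)
      then have "A \<in> real_points unit_group" unfolding A using Q by (rule combine_real_points)
      moreover have "E ** P ** F = mat 1 \<or> E ** P ** F = - mat 1"
        using P by (auto simp: EF)
      then have "to_O41 A = mat 1"
        unfolding A to_O41_combine by (auto simp: orthochronous_def mat_def vec_eq_iff)
      ultimately show "A \<in> ?K" by (simp add: kernel_def)
    qed
  qed
  have cp: "compact ({mat 1, - mat 1} \<times> isometries (C (- sqrt 2)))"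
    by (intro compact_Times compact_isometries[OF c_pos definite]) (simp add: finite_imp_compact)
  have ct: "continuous_on S ?f" for S
  proof (rule continuous_on_coordinatewise_then_product, rule continuous_on_coordinatewise_then_product)
    fix m n
    have nth: "continuous_on S (\<lambda>p. complex_of_real (fst p $ i $ j))" "continuous_on S (\<lambda>p. complex_of_real (snd p $ i $ j))" for i j
      by (intro continuous_intros)+
    show "continuous_on S (\<lambda>p. ?f p m n)"
      unfolding combine_def Let_def vector_scaleR_component vector_add_component vector_minus_component complexify_def
      by (cases "m < 5"; cases "n < 5"; cases "m < 10"; cases "n < 10"; simp; intro continuous_intros nth)
  qed
  show ?thesis unfolding K by (rule compact_continuous_image[OF ct cp])
qed

section \<open>The integer points\<close>

definition arithmetic_group :: "(real^5^5) set" where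
  "arithmetic_group = to_O41 ` integer_points 10 unit_group"

lemma integer_points_real: "integer_points 10 unit_group \<subseteq> real_points unit_group"
  unfolding integer_points_def real_points_def by clarify (metis Ints_cases Reals_of_int)

lemma integer_points_subgroup: "subgroup (integer_points 10 unit_group) (GL 10)"
proof (rule group.subgroupI[OF GL_group])
  show "integer_points 10 unit_group \<subseteq> carrier (GL 10)" using unit_group_GL by (auto simp: integer_points_def)
  have "\<one>\<^bsub>matrix_monoid 10\<^esub> \<in> integer_points 10 unit_group"
    using unit_group_one monoid.inv_one[OF group.is_monoid[OF GL_group], of 10] by (simp add: integer_points_def)
  then show "integer_points 10 unit_group \<noteq> {}" by blast
next
  fix A assume "A \<in> integer_points 10 unit_group"
  then show "inv\<^bsub>GL 10\<^esub> A \<in> integer_points 10 unit_group"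
    using unit_group_inv[of A] unit_group_GL group.inv_inv[OF GL_group, of A 10]
    by (auto simp: integer_points_def)
next
  fix A B assume AB: "A \<in> integer_points 10 unit_group" "B \<in> integer_points 10 unit_group"
  then have "inv\<^bsub>GL 10\<^esub> (A \<otimes>\<^bsub>GL 10\<^esub> B) = inv\<^bsub>GL 10\<^esub> B \<otimes>\<^bsub>GL 10\<^esub> inv\<^bsub>GL 10\<^esub> A"
    using unit_group_GL by (intro group.inv_mult_group[OF GL_group]) (auto simp: integer_points_def)
  then show "A \<otimes>\<^bsub>GL 10\<^esub> B \<in> integer_points 10 unit_group"
    using AB unit_group_mult[of A B] by (auto simp: integer_points_def)
qed

lemma arithmetic_group_subgroup: "subgroup arithmetic_group O41"
proof (rule O41.subgroupI)
  note sub = integer_points_subgroup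
  show "arithmetic_group \<subseteq> carrier O41"
    using integer_points_real to_O41_carrier by (auto simp: arithmetic_group_def)
  show "arithmetic_group \<noteq> {}"
    using subgroup.one_closed[OF sub] by (auto simp: arithmetic_group_def)
  have mult: "to_O41 A ** to_O41 B = to_O41 (A \<otimes>\<^bsub>GL 10\<^esub> B)"
    if "A \<in> integer_points 10 unit_group" "B \<in> integer_points 10 unit_group" for A B
    using that integer_points_real by (intro to_O41_mult[symmetric]) auto
  show "M \<otimes>\<^bsub>O41\<^esub> N \<in> arithmetic_group" if MN: "M \<in> arithmetic_group" "N \<in> arithmetic_group" for M N
  proof -
    obtain A B where A: "A \<in> integer_points 10 unit_group" "M = to_O41 A"
      and B: "B \<in> integer_points 10 unit_group" "N = to_O41 B"
      using MN unfolding arithmetic_group_def by blast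
    show ?thesis
      unfolding O41_simps A(2) B(2) mult[OF A(1) B(1)] arithmetic_group_def
      using subgroup.m_closed[OF sub A(1) B(1)] by blast
  qed
  have one: "to_O41 (\<one>\<^bsub>GL 10\<^esub>) = mat 1"
  proof -
    have "real_part (specialise (sqrt 2) (\<one>\<^bsub>GL 10\<^esub>)) = mat 1"
      unfolding GL_simps specialise_one complexify_one[symmetric] real_part_complexify ..
    then show ?thesis
      by (simp add: to_O41_def EF del: matrix_monoid_simps GL_simps) (simp add: orthochronous_def mat_def)
  qed
  show "inv\<^bsub>O41\<^esub> M \<in> arithmetic_group" if M: "M \<in> arithmetic_group" for M
  proof -
    obtain A where A: "A \<in> integer_points 10 unit_group" "M = to_O41 A" using M by (auto simp: arithmetic_group_def)
    have iA: "inv\<^bsub>GL 10\<^esub> A \<in> integer_points 10 unit_group" using A(1) subgroup.m_inv_closed[OF sub] by simp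
    have "A \<in> carrier (GL 10)" using A(1) subgroup.subset[OF sub] by blast
    then have "to_O41 (inv\<^bsub>GL 10\<^esub> A) ** M = mat 1"
      using mult[OF iA A(1)] group.l_inv[OF GL_group, of A 10] one A(2) by (simp del: GL_simps matrix_monoid_simps)
    then have "inv\<^bsub>O41\<^esub> M = to_O41 (inv\<^bsub>GL 10\<^esub> A)"
      using A iA integer_points_real to_O41_carrier by (intro O41.inv_equality) auto
    then show ?thesis using iA by (auto simp: arithmetic_group_def)
  qed
qed

text \<open>A bound on the image bounds the first component of the pair, the second one ranges over
  a compact group, and integrality leaves finitely many matrices.\<close>

lemma arithmetic_group_properly_discontinuous: "properly_discontinuous arithmetic_group"
  unfolding properly_discontinuous_def
proof (intro conjI allI)
  show "arithmetic_group \<subseteq> carrier O41" using arithmetic_group_subgroup by (rule subgroup.subset)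
  fix b
  define a where "a = (\<Sum>i\<in>UNIV. \<Sum>j\<in>UNIV. \<Sum>k\<in>UNIV. \<Sum>l\<in>UNIV. \<bar>F $ i $ k\<bar> * \<bar>b\<bar> * \<bar>E $ l $ j\<bar>)"
  define d where "d = 1 + (\<Sum>k\<in>UNIV. \<bar>C (- sqrt 2) $ k $ k\<bar>) / c"
  let ?S = "{A \<in> integer_points 10 unit_group. to_O41 A $ 4 $ 4 \<le> b}"
  have "norm (A m n) \<le> a + d" if "A \<in> ?S" for A m n
  proof -
    have A: "A \<in> real_points unit_group" and le: "to_O41 A $ 4 $ 4 \<le> b" using that integer_points_real by auto
    define P where "P = real_part (specialise (sqrt 2) A)"
    define Q where "Q = real_part (specialise (- sqrt 2) A)"
    define M where "M = E ** P ** F"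
    have M: "\<bar>M $ k $ l\<bar> \<le> \<bar>b\<bar>" for k l
    proof -
      have "\<bar>to_O41 A $ k $ l\<bar> \<le> to_O41 A $ 4 $ 4" by (rule O41_entry_le[OF to_O41_carrier[OF A]])
      moreover have "\<bar>to_O41 A $ k $ l\<bar> = \<bar>M $ k $ l\<bar>"
        using real_preserves[OF A] unfolding to_O41_def P_def[symmetric] M_def[symmetric]
        by (cases rule: orthochronous_cases) auto
      ultimately show ?thesis using le by linarith
    qed
    have "P = (F ** E) ** P ** (F ** E)" by (simp add: FE)
    then have PM: "P = F ** M ** E" by (simp add: M_def matrix_mul_assoc)
    have Pb: "\<bar>P $ i $ j\<bar> \<le> a" for i j
    proof -
      have "P $ i $ j = (\<Sum>k\<in>UNIV. \<Sum>l\<in>UNIV. F $ i $ k * M $ k $ l * E $ l $ j)"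
        by (subst PM) (simp add: matrix_matrix_mult_def sum_distrib_right, rule sum.swap)
      also have "\<bar>\<dots>\<bar> \<le> (\<Sum>k\<in>UNIV. \<Sum>l\<in>UNIV. \<bar>F $ i $ k\<bar> * \<bar>b\<bar> * \<bar>E $ l $ j\<bar>)"
        by (intro order.trans[OF sum_abs] sum_mono) (auto simp: abs_mult intro!: mult_right_mono mult_left_mono M)
      also have "\<dots> \<le> (\<Sum>j\<in>UNIV. \<Sum>k\<in>UNIV. \<Sum>l\<in>UNIV. \<bar>F $ i $ k\<bar> * \<bar>b\<bar> * \<bar>E $ l $ j\<bar>)"
        by (rule member_le_sum) (auto intro!: sum_nonneg)
      also have "\<dots> \<le> a"
        unfolding a_def by (rule member_le_sum[where i=i]) (auto intro!: sum_nonneg)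
      finally show ?thesis .
    qed
    have Qb: "\<bar>Q $ i $ j\<bar> \<le> d" for i j
      unfolding d_def Q_def using real_part_isometries[OF A, of "- sqrt 2"]
      by (intro isometry_entry_bound[OF c_pos definite]) simp
    have "norm (combine (complexify P) (complexify Q) m n) \<le> a + d"
      using Pb Qb by (intro norm_combine_le) (auto simp: complexify_def)
    then show ?thesis using real_points_eq_combine[OF A] unfolding P_def Q_def by simp
  qed
  moreover have "A \<in> carrier (matrix_monoid 10) \<and> (\<forall>i j. A i j \<in> \<int>)" if "A \<in> ?S" for A
    using that unfolding integer_points_def unit_group_def block_form_def by blast
  ultimately have "?S \<subseteq> {A \<in> carrier (matrix_monoid 10). \<forall>i j. A i j \<in> \<int> \<and> norm (A i j) \<le> a + d}"
    by blast
  then have "finite ?S" by (rule finite_subset[OF _ finite_bounded_integer_matrices])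
  moreover have "{M \<in> arithmetic_group. M $ 4 $ 4 \<le> b} = to_O41 ` ?S" by (auto simp: arithmetic_group_def)
  ultimately show "finite {M \<in> arithmetic_group. M $ 4 $ 4 \<le> b}" by simp
qed

lemma arithmetic_subgroup_if_commensurable:
  assumes "subgroup \<Gamma> O41" "commensurable O41 \<Gamma> arithmetic_group"
  shows "arithmetic_subgroup O41 \<Gamma>"
proof -
  have "to_O41 \<in> hom (GL 10\<lparr>carrier := real_points unit_group\<rparr>) O41"
    by (rule homI) (use to_O41_carrier to_O41_mult in \<open>auto simp del: matrix_monoid_simps\<close>)
  then show ?thesis
    unfolding arithmetic_subgroup_def
    using assms unit_group_algebraic to_O41_surj to_O41_continuous compact_kernel
    unfolding arithmetic_group_def by blast
qed

text \<open>In the basis $E$ the reflection is $x \mapsto x - (C x)_i\, q$ for the $i$-th basis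
  vector $q$. Its coefficients lie in $\mathbb{Z}[\sqrt 2]$, its conjugate is given by the same
  formula with the conjugate form, and being an involution it is its own inverse, so the integrality
  of the inverse is free.\<close>

lemma reflection_in_arithmetic_group:
  assumes sym: "\<And>k l. C0 k l = C0 l k" "\<And>k l. C1 k l = C1 l k" and i: "C0 i i = 2" "C1 i i = 0"
  shows "reflection ((1 / sqrt 2) *\<^sub>R (E *v axis i 1)) \<in> arithmetic_group"
proof -
  define q :: "real^5" where "q = axis i 1"
  define P :: "real \<Rightarrow> real^5^5"
    where "P s = (\<chi> a b. (if a = b then 1 else 0) - (if a = i then C s $ i $ b else 0))" for s
  have P: "P s *v x = x - (C s *v x) $ i *\<^sub>R q" for s x
  proof -
    have "(P s *v x) $ a = x $ a - (C s *v x) $ i * q $ a" for a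
    proof -
      have "(P s *v x) $ a = (\<Sum>b\<in>UNIV. (if a = b then x $ b else 0)) - (\<Sum>b\<in>UNIV. (if a = i then C s $ i $ b * x $ b else 0))"
        unfolding matrix_vector_mul_component inner_vec_def sum_subtractf[symmetric]
        by (rule sum.cong) (auto simp: P_def algebra_simps)
      also have "\<dots> = x $ a - (C s *v x) $ i * q $ a"
        by (simp add: q_def axis_def matrix_vector_mul_component inner_vec_def)
      finally show ?thesis .
    qed
    then show ?thesis by (simp add: vec_eq_iff)
  qed
  have Cii: "C s $ i $ i = 2" for s by (simp add: form_matrix_def i)
  have symC: "transpose (C s) = C s" for s
    by (simp add: form_matrix_def transpose_def vec_eq_iff sym)
  have qC: "q \<bullet> (C s *v y) = (C s *v y) $ i" for s y by (simp add: q_def inner_axis')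
  have Cq: "x \<bullet> (C s *v q) = (C s *v x) $ i" for s x
    using inner_mult_vec[of "C s" x q] by (simp add: symC q_def inner_axis)
  have Cqi: "(C s *v q) $ i = 2" for s
    by (simp add: q_def matrix_vector_mul_component inner_axis Cii)
  have iso: "P s \<in> isometries (C s)" for s
  proof -
    have "x \<bullet> ((transpose (P s) ** C s ** P s) *v y) = x \<bullet> (C s *v y)" for x y
    proof -
      have "x \<bullet> ((transpose (P s) ** C s ** P s) *v y) = (P s *v x) \<bullet> (C s *v (P s *v y))"
        by (simp add: inner_mult_vec matrix_vector_mul_assoc matrix_mul_assoc)
      also have "\<dots> = x \<bullet> (C s *v y)"
        unfolding P by (simp add: matrix_vector_mult_diff_distrib matrix_vector_mult_scaleR inner_diff_left
          inner_diff_right qC Cq Cqi)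
      finally show ?thesis .
    qed
    then show ?thesis by (simp add: isometries_def eq_matrix_iff_inner)
  qed
  have PP: "P s ** P s = mat 1" for s
    unfolding matrix_eq matrix_vector_mul_assoc[symmetric] P
    by (simp add: matrix_vector_mult_diff_distrib matrix_vector_mult_scaleR Cqi scaleR_diff_left)
  define A where "A = combine (complexify (P (sqrt 2))) (complexify (P (- sqrt 2)))"
  have AR: "A \<in> real_points unit_group" unfolding A_def by (intro combine_real_points iso)
  then have AU: "A \<in> unit_group" by (rule real_pointsD)
  have "A \<otimes>\<^bsub>matrix_monoid 10\<^esub> A = \<one>\<^bsub>matrix_monoid 10\<^esub>"
  proof (intro unit_group_eqI unit_group_mult unit_group_one AU)
    show "specialise (sqrt 2) (A \<otimes>\<^bsub>matrix_monoid 10\<^esub> A) = specialise (sqrt 2) \<one>\<^bsub>matrix_monoid 10\<^esub>"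
      by (subst specialise_unit_group_mult[OF AU AU])
        (simp_all add: A_def specialise_combine specialise_one PP complexify_one flip: complexify_mult del: matrix_monoid_simps)
    show "specialise (- sqrt 2) (A \<otimes>\<^bsub>matrix_monoid 10\<^esub> A) = specialise (- sqrt 2) \<one>\<^bsub>matrix_monoid 10\<^esub>"
      by (subst specialise_unit_group_mult[OF AU AU])
        (simp_all add: A_def specialise_combine specialise_one PP complexify_one flip: complexify_mult del: matrix_monoid_simps)
  qed
  then have inv: "inv\<^bsub>GL 10\<^esub> A = A"
    using AU unit_group_GL by (intro group.inv_equality[OF GL_group]) (auto simp del: matrix_monoid_simps)
  have X: "(1/2::real) *\<^sub>R (complexify (P (sqrt 2)) $ a $ b + complexify (P (- sqrt 2)) $ a $ b)
      = of_int ((if a = b then 1 else 0) - (if a = i then C0 i b else 0))" for a b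
    by (simp add: complexify_def P_def form_matrix_def complex_eq_iff)
  have Y: "(1 / (2 * sqrt 2)) *\<^sub>R (complexify (P (sqrt 2)) $ a $ b - complexify (P (- sqrt 2)) $ a $ b)
      = of_int (- (if a = i then C1 i b else 0))" for a b
    by (simp add: complexify_def P_def form_matrix_def complex_eq_iff)
  have "A m n \<in> \<int>" for m n
    unfolding A_def combine_def Let_def vector_scaleR_component vector_add_component vector_minus_component X Y
    by (simp del: of_int_diff of_int_minus)
  then have "A \<in> integer_points 10 unit_group" using AU inv by (simp add: integer_points_def)
  moreover have "to_O41 A = reflection ((1 / sqrt 2) *\<^sub>R (E *v q))"
  proof -
    define u where "u = (1 / sqrt 2) *\<^sub>R (E *v q)"
    have form: "lorentz (E *v x) (E *v y) = x \<bullet> (C (sqrt 2) *v y)" for x y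
      by (simp add: lorentz_inner inner_mult_vec matrix_vector_mul_assoc matrix_mul_assoc flip: lorentz_form)
    have "lorentz u u = 1" by (simp add: u_def form qC Cqi)
    then have uO: "reflection u \<in> carrier O41" by (rule reflection_O41)
    have "E ** P (sqrt 2) = reflection u ** E"
      unfolding matrix_eq matrix_vector_mul_assoc[symmetric] P reflection_apply
      by (simp add: matrix_vector_mult_diff_distrib matrix_vector_mult_scaleR u_def form Cq)
    then have "E ** P (sqrt 2) ** F = reflection u"
      by (metis EF matrix_mul_assoc matrix_mul_rid)
    then show ?thesis
      unfolding A_def to_O41_combine u_def[symmetric] by (simp add: orthochronous_eq_self[OF uO])
  qed
  ultimately show ?thesis unfolding arithmetic_group_def q_def by (metis image_eqI)
qed

end

section \<open>Lifts of neighbouring simplices\<close>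

lemma gluing_table_irreflexive:
  "list_all (\<lambda>(j, k1, k2, k3, k4, k5). k1 < 60 \<and> k2 < 60 \<and> k3 < 60 \<and> k4 < 60 \<and> k5 < 60
    \<and> k1 \<noteq> j \<and> k2 \<noteq> j \<and> k3 \<noteq> j \<and> k4 \<noteq> j \<and> k5 \<noteq> j) (zip [0..<60] gluing_table)"
  by (simp add: gluing_table_def upt_rec)

lemma length_gluing_table: "length gluing_table = 60"
  by (simp add: gluing_table_def)

lemma facet_neighbour_props:
  assumes "j < 60"
  shows "facet_neighbour j i < 60" "facet_neighbour j i \<noteq> j"
proof -
  have "zip [0..<60] gluing_table ! j = (j, gluing_table ! j)"
    using assms by (simp add: length_gluing_table)
  moreover have "j < length (zip [0..<60] gluing_table)"
    using assms by (simp add: length_gluing_table)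
  ultimately have "case (j, gluing_table ! j) of (j, k1, k2, k3, k4, k5) \<Rightarrow> k1 < 60 \<and> k2 < 60 \<and> k3 < 60 \<and> k4 < 60 \<and> k5 < 60
      \<and> k1 \<noteq> j \<and> k2 \<noteq> j \<and> k3 \<noteq> j \<and> k4 \<noteq> j \<and> k5 \<noteq> j"
    using list_all_length[THEN iffD1, OF gluing_table_irreflexive, rule_format, of j] by simp
  then show "facet_neighbour j i < 60" "facet_neighbour j i \<noteq> j"
    by (auto simp: facet_neighbour_def split: prod.splits)
qed

lemma glue_class_eq_if_glued:
  assumes "glued p q"
  shows "glue_class p = glue_class q"
proof -
  have pq: "equivclp glued p q" using assms by (rule r_into_equivclp)
  have "equivclp glued p r \<longleftrightarrow> equivclp glued q r" for r
    using equivclp_trans[OF pq, of r] equivclp_trans[OF equivclp_sym[OF pq], of r] by (rule iffI[rotated])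
  then show ?thesis by (simp only: glue_class_def)
qed

text \<open>Gluing moves only points of the boundary of a simplex.\<close>

lemma eq_if_interior_glue_class_eq:
  assumes eq: "glue_class p = glue_class q" and interior: "\<And>i. snd p $ i \<noteq> 0"
  shows "q = p"
proof -
  have "q \<in> glue_class p" unfolding eq by (simp add: glue_class_def)
  then have "equivclp glued p q" by (simp add: glue_class_def)
  then show ?thesis
  proof (induction rule: equivclp_induct)
    case (step y z)
    then show ?case using interior by (auto simp: glued_def)
  qed simp
qed

context hyperbolic_simplex
begin

lemma simplex_map_multiple:
  assumes t: "t \<in> std_simplex"
  shows "simplex_map v t \<in> chamber" "\<exists>r>0. simplex_map v t = r *\<^sub>R (\<Sum>i\<in>UNIV. t $ i *\<^sub>R v i)"
proof -
  define w where "w = (\<Sum>i\<in>UNIV. t $ i *\<^sub>R v i)"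
  have t0: "0 \<le> t $ i" and t1: "(\<Sum>i\<in>UNIV. t $ i) = 1" for i using t by (auto simp: std_simplex_def)
  have neg: "(\<Sum>i\<in>UNIV. t $ i * f i) < 0" if "\<And>i. f i < 0" for f
  proof -
    obtain k where "t $ k \<noteq> 0" using t1 by (metis sum.neutral zero_neq_one)
    then have "t $ k * f k < 0" using t0[of k] that[of k] by (simp add: mult_pos_neg)
    moreover have "t $ i * f i \<le> 0" for i using t0[of i] that[of i] by (simp add: mult_nonneg_nonpos)
    ultimately show ?thesis
      using sum.remove[of UNIV k "\<lambda>i. t $ i * f i"] sum_nonpos[of "UNIV - {k}" "\<lambda>i. t $ i * f i"] by simp
  qed
  have vw: "lorentz (v j) w < 0" for j
    using neg[of "\<lambda>i. lorentz (v j) (v i)"] H4_lorentz_neg[OF vertex vertex] by (simp add: w_def lorentz_sum)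
  have "lorentz w w = (\<Sum>i\<in>UNIV. t $ i * lorentz (v i) w)" by (subst (1) w_def) (simp add: lorentz_sum)
  then have ww: "lorentz w w < 0" using neg[of "\<lambda>i. lorentz (v i) w"] vw by simp
  have w4: "w $ 4 > 0" using neg[of "\<lambda>i. - (v i $ 4)"] H4_D(2)[OF vertex] by (simp add: w_def sum_negf)
  define r where "r = 1 / sqrt (- lorentz w w)"
  have r: "r > 0" "r * r * lorentz w w = -1" using ww by (simp_all add: r_def)
  have s: "simplex_map v t = r *\<^sub>R w" by (simp add: simplex_map_def Let_def r_def w_def)
  then show "\<exists>r>0. simplex_map v t = r *\<^sub>R (\<Sum>i\<in>UNIV. t $ i *\<^sub>R v i)" using r by (auto simp: w_def)
  have "r *\<^sub>R w \<in> H4" using r w4 by (simp add: H4_def mult.assoc)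
  moreover have "lorentz (e i) (r *\<^sub>R w) \<le> 0" for i
  proof -
    have "lorentz (e i) w = (\<Sum>j\<in>UNIV. t $ j * lorentz (e i) (v j))" by (simp add: w_def lorentz_sum)
    also have "\<dots> \<le> 0"
      using t0 normal_outward normal_orthogonal
      by (intro sum_nonpos mult_nonneg_nonpos) (metis less_imp_le order_refl)+
    finally show ?thesis using r by (simp add: mult_nonneg_nonpos)
  qed
  ultimately show "simplex_map v t \<in> chamber" by (simp add: s chamber_def)
qed

lemma norm_mult_chamber_bound:
  "\<exists>B. \<forall>x\<in>chamber. norm (P *v x) \<le> B"
proof -
  have "norm (P *v x) \<le> onorm ((*v) P) * (\<Sum>i\<in>UNIV. norm (v i))" if "x \<in> chamber" for x
    using onorm[OF matrix_vector_mul_bounded_linear, of P x]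
      mult_left_mono[OF chamber_norm_le[OF that] onorm_pos_le[OF matrix_vector_mul_bounded_linear[of P]]]
    by linarith
  then show ?thesis by blast
qed

text \<open>Each point of the facet supplies some element of $\Gamma$ that reconciles the two
  placements there, and a single element has to be found for the whole facet. Only finitely many
  elements of $\Gamma$ occur, since they move a bounded set to meet a bounded set. Along the moment
  curve with weights $\tau^l$ one of them occurs for infinitely many $\tau$; its defect is a
  polynomial in $\tau$ with vector coefficients and infinitely many zeros, so the coefficients,
  which are the defects at the vertices, vanish.\<close>

lemma agree_on_facet:
  assumes \<Gamma>: "subgroup \<Gamma> O41" "properly_discontinuous \<Gamma>" and P: "P \<in> carrier O41" and Q: "Q \<in> carrier O41"
    and orbit: "\<And>t. t \<in> std_simplex \<Longrightarrow> t $ i = 0 \<Longrightarrow>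
      orbit_of \<Gamma> (P *v simplex_map v t) = orbit_of \<Gamma> (Q *v simplex_map v t)"
  shows "\<exists>A\<in>\<Gamma>. \<forall>l. l \<noteq> i \<longrightarrow> A *v (P *v v l) = Q *v v l"
proof -
  have sub: "\<Gamma> \<subseteq> carrier O41" using \<Gamma>(1) by (rule subgroup.subset)
  obtain B1 where B1: "\<And>x. x \<in> chamber \<Longrightarrow> norm (P *v x) \<le> B1" using norm_mult_chamber_bound by blast
  obtain B2 where B2: "\<And>x. x \<in> chamber \<Longrightarrow> norm (Q *v x) \<le> B2" using norm_mult_chamber_bound by blast
  define F where "F = {A \<in> \<Gamma>. A $ 4 $ 4 \<le> 2 * B2 * B1}"
  have F: "finite F" using \<Gamma>(2) by (simp add: F_def properly_discontinuous_def)
  \<comment> \<open>barycentric weights, not yet normalized, of a point on the moment curve in the facet\<close>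
  define c where "c \<tau> l = (if l = i then 0 else \<tau> ^ idx l)" for \<tau> :: real and l
  have ex: "\<exists>A\<in>F. A *v (P *v (\<Sum>l\<in>UNIV. c \<tau> l *\<^sub>R v l)) = Q *v (\<Sum>l\<in>UNIV. c \<tau> l *\<^sub>R v l)" if \<tau>: "\<tau> > 0" for \<tau>
  proof -
    define Z where "Z = (\<Sum>l\<in>UNIV. c \<tau> l)"
    have c0: "0 \<le> c \<tau> l" for l using \<tau> by (simp add: c_def)
    obtain k :: 5 where "k \<noteq> i" by (metis zero_neq_one)
    then have "0 < c \<tau> k" using \<tau> by (simp add: c_def)
    also have "c \<tau> k \<le> Z" unfolding Z_def using c0 by (intro member_le_sum) auto
    finally have Z: "Z > 0" .
    define t where "t = (\<chi> l. c \<tau> l / Z)"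
    have t: "t \<in> std_simplex" using c0 Z by (simp add: std_simplex_def t_def Z_def flip: sum_divide_distrib)
    have ti: "t $ i = 0" by (simp add: t_def c_def)
    define s where "s = simplex_map v t"
    have sc: "s \<in> chamber" and "\<exists>r>0. s = r *\<^sub>R (\<Sum>l\<in>UNIV. t $ l *\<^sub>R v l)"
      unfolding s_def using simplex_map_multiple[OF t] by blast+
    then obtain r where r: "r > 0" "s = r *\<^sub>R (\<Sum>l\<in>UNIV. t $ l *\<^sub>R v l)" by blast
    have "(\<Sum>l\<in>UNIV. t $ l *\<^sub>R v l) = (1/Z) *\<^sub>R (\<Sum>l\<in>UNIV. c \<tau> l *\<^sub>R v l)"
      by (simp add: t_def scaleR_sum_right)
    then have cs: "(\<Sum>l\<in>UNIV. c \<tau> l *\<^sub>R v l) = (Z / r) *\<^sub>R s" using r Z by simp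
    have "mat 1 \<in> \<Gamma>" using subgroup.one_closed[OF \<Gamma>(1)] by simp
    then have "Q *v s \<in> orbit_of \<Gamma> (Q *v s)" unfolding orbit_of_def by force
    also have "\<dots> = orbit_of \<Gamma> (P *v s)" unfolding s_def using orbit[OF t ti] by simp
    finally obtain A where A: "A \<in> \<Gamma>" "Q *v s = A *v (P *v s)" by (auto simp: orbit_of_def)
    have sH: "s \<in> H4" using sc by (simp add: chamber_def)
    have Ac: "A \<in> carrier O41" using A sub by blast
    have PH: "P *v s \<in> H4" and QH: "Q *v s \<in> H4" using O41_H4 P Q sH by auto
    have "A $ 4 $ 4 \<le> 2 * (Q *v s) $ 4 * (P *v s) $ 4" using O41_44_le[OF Ac PH] A(2) by simp
    also have "\<dots> \<le> 2 * B2 * B1"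
      using H4_D(2)[OF PH] H4_D(2)[OF QH] component_le_norm_cart[of "P *v s" 4] component_le_norm_cart[of "Q *v s" 4]
        B1[OF sc] B2[OF sc] by (intro mult_mono) auto
    finally have "A \<in> F" using A by (simp add: F_def)
    then show ?thesis unfolding cs using A(2) by (auto simp: matrix_vector_mult_scaleR)
  qed
  have "\<forall>\<tau>\<in>{0<..}. \<exists>A. A \<in> F \<and>
      A *v (P *v (\<Sum>l\<in>UNIV. c \<tau> l *\<^sub>R v l)) = Q *v (\<Sum>l\<in>UNIV. c \<tau> l *\<^sub>R v l)"
    using ex unfolding greaterThan_iff by blast
  from bchoice[OF this] obtain a where a': "\<forall>\<tau>\<in>{0<..}. a \<tau> \<in> F \<and>
      a \<tau> *v (P *v (\<Sum>l\<in>UNIV. c \<tau> l *\<^sub>R v l)) = Q *v (\<Sum>l\<in>UNIV. c \<tau> l *\<^sub>R v l)" ..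
  have a: "a \<tau> \<in> F" "a \<tau> *v (P *v (\<Sum>l\<in>UNIV. c \<tau> l *\<^sub>R v l)) = Q *v (\<Sum>l\<in>UNIV. c \<tau> l *\<^sub>R v l)"
    if "\<tau> > 0" for \<tau>
    using bspec[OF a', of \<tau>] that by simp_all
  have "finite (a ` {0<..})" by (rule finite_subset[OF _ F]) (auto intro: a(1))
  with infinite_Ioi[of "0::real"] obtain \<tau>0 where \<tau>0: "\<tau>0 \<in> {0<..}" "infinite {\<tau> \<in> {0<..}. a \<tau> = a \<tau>0}"
    using pigeonhole_infinite by blast
  define A where "A = a \<tau>0"
  have inf: "infinite {\<tau>. \<tau> > 0 \<and> a \<tau> = A}" using \<tau>0(2) by (simp add: A_def)
  have A: "A \<in> \<Gamma>" using a(1) \<tau>0(1) by (auto simp: A_def F_def)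
  have "A *v (P *v v l) = Q *v v l" if l: "l \<noteq> i" for l
  proof -
    have "(A *v (P *v v l)) $ k = (Q *v v l) $ k" for k
    proof -
      define d where "d m = (if of_nat m = i then 0 else (A *v (P *v v (of_nat m))) $ k - (Q *v v (of_nat m)) $ k)" for m :: nat
      have lin: "(A *v (P *v (\<Sum>l\<in>UNIV. c \<tau> l *\<^sub>R v l))) $ k - (Q *v (\<Sum>l\<in>UNIV. c \<tau> l *\<^sub>R v l)) $ k
        = (\<Sum>m\<le>4. d m * \<tau> ^ m)" for \<tau>
      proof -
        have "(A *v (P *v (\<Sum>l\<in>UNIV. c \<tau> l *\<^sub>R v l))) $ k - (Q *v (\<Sum>l\<in>UNIV. c \<tau> l *\<^sub>R v l)) $ k
          = (\<Sum>l\<in>UNIV. c \<tau> l * ((A *v (P *v v l)) $ k - (Q *v v l) $ k))"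
          by (simp add: linear_sum[OF matrix_vector_mul_linear] matrix_vector_mult_scaleR right_diff_distrib sum_subtractf)
        also have "\<dots> = (\<Sum>l\<in>UNIV. d (idx l) * \<tau> ^ idx l)"
          by (rule sum.cong) (auto simp: d_def c_def)
        also have "\<dots> = (\<Sum>m<5. d m * \<tau> ^ m)" by (rule sum_idx[symmetric])
        also have "{..<5} = {..4::nat}" by auto
        finally show ?thesis .
      qed
      have "{\<tau>. \<tau> > 0 \<and> a \<tau> = A} \<subseteq> {\<tau>. (\<Sum>m\<le>4. d m * \<tau> ^ m) = 0}"
        unfolding lin[symmetric] using a(2) by auto
      then have "infinite {\<tau>. (\<Sum>m\<le>4. d m * \<tau> ^ m) = 0}" using inf finite_subset by blast
      then have "\<forall>m\<le>4. d m = 0" using polyfun_finite_roots[where c=d and n=4] by blast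
      moreover have "idx l \<le> 4" using idx_less(1)[of l] by linarith
      ultimately have "d (idx l) = 0" by blast
      then show ?thesis using l by (simp add: d_def)
    qed
    then show ?thesis by (simp add: vec_eq_iff)
  qed
  then show ?thesis using A by blast
qed

text \<open>The normal of the facet must go to plus or minus itself. In the first case all of a
  spanning set is fixed, and the second case is reduced to the first by composing with the
  reflection.\<close>

lemma facet_stabilizer:
  assumes B: "B \<in> carrier O41" and fix_facet: "\<And>l. l \<noteq> i \<Longrightarrow> B *v v l = v l"
  shows "B = mat 1 \<or> B = reflection (e i)"
proof -
  have multiple: "y = (lorentz y (v i) / lorentz (e i) (v i)) *\<^sub>R e i"
    if "\<And>l. l \<noteq> i \<Longrightarrow> lorentz y (v l) = 0" for y
  proof -
    have "lorentz (y - (lorentz y (v i) / lorentz (e i) (v i)) *\<^sub>R e i) (v l) = 0" for l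
      using that[of l] normal_orthogonal[of i l] normal_outward[of i] by (cases "l = i") auto
    then show ?thesis using eq_0_if_orthogonal_vertices by (metis right_minus_eq)
  qed
  \<comment> \<open>\<open>D *v x - x\<close> is orthogonal to the facet and to its normal\<close>
  have ident: "D = mat 1" if D: "D \<in> carrier O41" "\<And>l. l \<noteq> i \<Longrightarrow> D *v v l = v l" "D *v e i = e i" for D
  proof -
    have "D *v x - x = 0" for x
    proof -
      have "lorentz (D *v x - x) (v l) = 0" if "l \<noteq> i" for l
        using O41_lorentz[OF D(1), of x "v l"] D(2)[OF that] by simp
      from multiple[OF this] obtain b where b: "D *v x - x = b *\<^sub>R e i" by blast
      have "lorentz (D *v x - x) (e i) = 0" using O41_lorentz[OF D(1), of x "e i"] D(3) by simp
      then show ?thesis unfolding b by (simp add: normal_unit)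
    qed
    then show ?thesis by (simp add: matrix_eq)
  qed
  have "lorentz (B *v e i) (v l) = 0" if "l \<noteq> i" for l
    using O41_lorentz[OF B, of "e i" "v l"] fix_facet[OF that] normal_orthogonal[of i l] that by simp
  from multiple[OF this] obtain b where b: "B *v e i = b *\<^sub>R e i" by blast
  have "b * b = 1" using O41_lorentz[OF B, of "e i" "e i"] by (simp add: b normal_unit)
  then have "b = 1 \<or> b = -1" by (simp add: square_eq_1_iff)
  then show ?thesis
  proof
    assume "b = 1"
    then show ?thesis using ident[OF B fix_facet] b by simp
  next
    assume b1: "b = -1"
    have r: "reflection (e i) \<in> carrier O41" using normal_unit by (rule reflection_O41)
    have "B ** reflection (e i) = mat 1"
    proof (rule ident)
      show "B ** reflection (e i) \<in> carrier O41" using O41.m_closed[OF B r] by simp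
      show "(B ** reflection (e i)) *v v l = v l" if "l \<noteq> i" for l
        using that normal_orthogonal[of i l]
        by (simp add: reflection_apply lorentz_sym[of "v l"] fix_facet flip: matrix_vector_mul_assoc)
      show "(B ** reflection (e i)) *v e i = e i"
      proof -
        have "reflection (e i) *v e i = (-1) *\<^sub>R e i" by (simp add: reflection_apply normal_unit scaleR_2)
        then have "(B ** reflection (e i)) *v e i = (-1) *\<^sub>R (B *v e i)"
          by (simp only: matrix_vector_mul_assoc[symmetric] matrix_vector_mult_scaleR)
        then show ?thesis by (simp add: b b1)
      qed
    qed
    then have "B = reflection (e i)"
      using reflection_involution[OF normal_unit[of i]] by (metis matrix_mul_assoc matrix_mul_lid matrix_mul_rid)
    then show ?thesis ..
  qed
qed

text \<open>The element of $\Gamma$ found on the common facet leaves two possibilities. That the two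
  lifted simplices coincide is excluded by injectivity of $h$ at the barycentres, since neighbours
  have different indices.\<close>

lemma neighbouring_lifts:
  assumes \<Gamma>: "subgroup \<Gamma> O41" "properly_discontinuous \<Gamma>"
    and h: "inj_on h (glue_class ` simplices)"
    and g: "\<And>j. j < 60 \<Longrightarrow> g j \<in> carrier O41"
      "\<And>j t. j < 60 \<Longrightarrow> t \<in> std_simplex \<Longrightarrow> h (glue_class (j, t)) = orbit_of \<Gamma> (g j *v simplex_map v t)"
    and j: "j < 60"
  shows "\<exists>A\<in>\<Gamma>. g j ** reflection (e i) = A ** g (facet_neighbour j i)"
proof -
  define k where "k = facet_neighbour j i"
  have k: "k < 60" "k \<noteq> j" using facet_neighbour_props[OF j] by (auto simp: k_def)
  note gj = g(1)[OF j] and gk = g(1)[OF k(1)]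
  have sub: "\<Gamma> \<subseteq> carrier O41" using \<Gamma>(1) by (rule subgroup.subset)
  have "orbit_of \<Gamma> (g j *v simplex_map v t) = orbit_of \<Gamma> (g k *v simplex_map v t)"
    if t: "t \<in> std_simplex" "t $ i = 0" for t
  proof -
    have "glued (j, t) (k, t)" using t j k by (auto simp: glued_def simplices_def k_def)
    then show ?thesis using glue_class_eq_if_glued g(2)[OF j t(1)] g(2)[OF k(1) t(1)] by metis
  qed
  from agree_on_facet[OF \<Gamma> gj gk this] obtain A
    where A: "A \<in> \<Gamma>" "\<And>l. l \<noteq> i \<Longrightarrow> A *v (g j *v v l) = g k *v v l" by blast
  have Ac: "A \<in> carrier O41" using A sub by blast
  have Agj: "A ** g j \<in> carrier O41" using O41.m_closed[OF Ac gj] by simp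
  define B where "B = inv\<^bsub>O41\<^esub> (A ** g j) ** g k"
  have Bc: "B \<in> carrier O41" unfolding B_def using O41.m_closed[OF O41.inv_closed[OF Agj] gk] by simp
  have gkB: "g k = A ** g j ** B"
    using O41.r_inv[OF Agj] by (simp add: B_def matrix_mul_assoc)
  have "B *v v l = v l" if "l \<noteq> i" for l
    using A(2)[OF that] O41_inv_mult_vec(1)[OF Agj, of "v l"]
    by (simp add: B_def flip: matrix_vector_mul_assoc)
  from facet_stabilizer[OF Bc this] show ?thesis
  proof
    assume "B = mat 1"
    then have gk_eq: "g k = A ** g j" using gkB by simp
    define t :: "real^5" where "t = (\<chi> l. 1/5)"
    have t: "t \<in> std_simplex" by (simp add: t_def std_simplex_def)
    have "orbit_of \<Gamma> (g k *v x) = orbit_of \<Gamma> (g j *v x)" for x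
    proof -
      have "orbit_of \<Gamma> (A *v y) \<subseteq> orbit_of \<Gamma> y" if "A \<in> \<Gamma>" for A y
      proof
        fix z assume "z \<in> orbit_of \<Gamma> (A *v y)"
        then obtain D where "D \<in> \<Gamma>" "z = (D ** A) *v y" by (auto simp: orbit_of_def matrix_vector_mul_assoc)
        then show "z \<in> orbit_of \<Gamma> y" using subgroup.m_closed[OF \<Gamma>(1) _ that] by (auto simp: orbit_of_def)
      qed
      from this[OF A(1), of "g j *v x"] this[OF subgroup.m_inv_closed[OF \<Gamma>(1) A(1)], of "A *v (g j *v x)"]
      show ?thesis
        unfolding gk_eq matrix_vector_mul_assoc[symmetric] O41_inv_mult_vec(1)[OF Ac] by blast
    qed
    then have "h (glue_class (j, t)) = h (glue_class (k, t))" using g(2)[OF j t] g(2)[OF k(1) t] by simp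
    then have "glue_class (j, t) = glue_class (k, t)"
      by (rule inj_onD[OF h]) (use j k t in \<open>auto simp: simplices_def\<close>)
    then have "(k, t) = (j, t)" by (rule eq_if_interior_glue_class_eq) (simp add: t_def)
    with k(2) show ?thesis by simp
  next
    assume B: "B = reflection (e i)"
    have "inv\<^bsub>O41\<^esub> A ** g k = inv\<^bsub>O41\<^esub> A ** A ** g j ** reflection (e i)"
      unfolding gkB B by (simp only: matrix_mul_assoc)
    also have "\<dots> = g j ** reflection (e i)" using O41.l_inv[OF Ac] by simp
    finally show ?thesis
      using subgroup.m_inv_closed[OF \<Gamma>(1) A(1)] unfolding k_def by metis
  qed
qed

text \<open>The claim has to be proved for all $j$ at once, as the two factors of a product act one
  after the other.\<close>

lemma reflection_group_cosets:
  assumes \<Gamma>: "subgroup \<Gamma> O41"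
    and nb: "\<And>j i. j < n \<Longrightarrow> \<exists>k<n. \<exists>A\<in>\<Gamma>. g j ** reflection (e i) = A ** g k"
    and w: "w \<in> reflection_group" and j: "j < n"
  shows "\<exists>k<n. \<exists>A\<in>\<Gamma>. g j ** w = A ** g k"
  using w j
proof (induction arbitrary: j)
  case one
  have "mat 1 \<in> \<Gamma>" using subgroup.one_closed[OF \<Gamma>] by simp
  moreover have "g j ** \<one>\<^bsub>O41\<^esub> = mat 1 ** g j" by simp
  ultimately show ?case using one by blast
next
  case (incl w)
  then obtain i where "w = reflection (e i)" by blast
  then show ?case using nb[OF incl(2)] by blast
next
  case (inv w)
  then obtain i where w: "w = reflection (e i)" by blast
  have "inv\<^bsub>O41\<^esub> w = w"
    unfolding w by (rule O41.inv_equality) (simp_all add: reflection_involution reflection_O41 normal_unit)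
  then show ?case unfolding w using nb[OF inv(2), of i] by simp
next
  case (eng w1 w2)
  obtain k A where k: "k < n" "A \<in> \<Gamma>" "g j ** w1 = A ** g k" using eng.IH(1)[OF eng.prems] by blast
  obtain l B where l: "l < n" "B \<in> \<Gamma>" "g k ** w2 = B ** g l" using eng.IH(2)[OF k(1)] by blast
  have "g j ** (w1 ** w2) = (g j ** w1) ** w2" by (rule matrix_mul_assoc)
  also have "\<dots> = A ** (g k ** w2)" by (simp only: k(3) matrix_mul_assoc)
  also have "\<dots> = (A ** B) ** g l" by (simp only: l(3) matrix_mul_assoc)
  finally have "g j ** (w1 \<otimes>\<^bsub>O41\<^esub> w2) = (A \<otimes>\<^bsub>O41\<^esub> B) ** g l" by simp
  then show ?case using l(1) subgroup.m_closed[OF \<Gamma> k(2) l(2)] by blast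
qed

text \<open>Choose for each coset $\Gamma g_k$ that meets $W$ a representative $u_k \in W$. An
  element $w' \in W$ of this coset equals $d\, u_k$ with $d = w' u_k^{-1}$ in $\Gamma \cap W$. Since
  $W$ moves every point into the simplex, the finitely many translates $u_k S$ of the simplex $S$
  form a bounded set whose images under $\Gamma \cap W$ cover; and $W$ is contained in $D$.\<close>

lemma common_subgroup_cobounded:
  fixes n :: nat and g :: "nat \<Rightarrow> real^5^5"
  assumes \<Gamma>: "subgroup \<Gamma> O41"
    and D: "subgroup D O41" "properly_discontinuous D" "\<And>i. reflection (e i) \<in> D"
    and g: "\<And>j. j < n \<Longrightarrow> g j \<in> carrier O41" "0 < n" "g 0 = mat 1"
    and nb: "\<And>j i. j < n \<Longrightarrow> \<exists>k<n. \<exists>A\<in>\<Gamma>. g j ** reflection (e i) = A ** g k"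
  shows "\<exists>R. \<forall>x\<in>H4. \<exists>A\<in>\<Gamma> \<inter> D. \<exists>y\<in>H4. norm y \<le> R \<and> x = A *v y"
proof -
  have WD: "reflection_group \<subseteq> D"
    using D by (intro O41.generate_subgroup_incl) auto
  note W = reflection_group_subgroup
  have Wc: "reflection_group \<subseteq> carrier O41" using W by (rule subgroup.subset)
  define K where "K = {k. k < n \<and> (\<exists>w\<in>reflection_group. \<exists>A\<in>\<Gamma>. w = A ** g k)}"
  then have "\<forall>k\<in>K. \<exists>w. w \<in> reflection_group \<and> (\<exists>A\<in>\<Gamma>. w = A ** g k)" by blast
  from bchoice[OF this] obtain u
    where u: "\<forall>k\<in>K. u k \<in> reflection_group \<and> (\<exists>A\<in>\<Gamma>. u k = A ** g k)" ..
  have "\<forall>k. \<exists>b. \<forall>x\<in>chamber. norm (u k *v x) \<le> b"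
    using norm_mult_chamber_bound by blast
  from choice[OF this] obtain B where B': "\<forall>k. \<forall>x\<in>chamber. norm (u k *v x) \<le> B k" ..
  have B: "norm (u k *v x) \<le> B k" if "x \<in> chamber" for k x using B' that by blast
  have "\<exists>A\<in>\<Gamma> \<inter> D. \<exists>y\<in>H4. norm y \<le> (\<Sum>k<n. \<bar>B k\<bar>) \<and> x = A *v y" if x: "x \<in> H4" for x
  proof -
    obtain w where w: "w \<in> reflection_group" "w *v x \<in> chamber"
      using reflection_group_moves_into_chamber[OF D(2,1,3) x] by blast
    have wc: "w \<in> carrier O41" using w Wc by blast
    define w' where "w' = inv\<^bsub>O41\<^esub> w"
    have w': "w' \<in> reflection_group" using subgroup.m_inv_closed[OF W w(1)] by (simp add: w'_def)
    obtain k A where k: "k < n" "A \<in> \<Gamma>" "w' = A ** g k"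
      using reflection_group_cosets[where g=g, OF \<Gamma> nb w' g(2)] by (auto simp: g(3))
    then have kK: "k \<in> K" using w' by (auto simp: K_def)
    then obtain A' where A': "A' \<in> \<Gamma>" "u k = A' ** g k" using u by blast
    have uW: "u k \<in> reflection_group" using u kK by blast
    have Ac: "A \<in> carrier O41" "A' \<in> carrier O41" using k(2) A'(1) subgroup.subset[OF \<Gamma>] by blast+
    have uc: "u k \<in> carrier O41" using uW Wc by blast
    note gk = g(1)[OF k(1)]
    define d where "d = w' ** inv\<^bsub>O41\<^esub> (u k)"
    have "d \<in> D"
      using subgroup.m_closed[OF W w' subgroup.m_inv_closed[OF W uW]] WD by (auto simp: d_def)
    moreover have "d \<in> \<Gamma>"
    proof -
      have "inv\<^bsub>O41\<^esub> (u k) = inv\<^bsub>O41\<^esub> (g k) ** inv\<^bsub>O41\<^esub> A'"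
        using O41.inv_mult_group[OF Ac(2) gk] A'(2) by simp
      then have "d = A ** (g k ** inv\<^bsub>O41\<^esub> (g k)) ** inv\<^bsub>O41\<^esub> A'"
        unfolding d_def k(3) by (simp only: matrix_mul_assoc)
      then have "d = A ** inv\<^bsub>O41\<^esub> A'" using O41.r_inv[OF gk] by simp
      then show ?thesis using subgroup.m_closed[OF \<Gamma> k(2) subgroup.m_inv_closed[OF \<Gamma> A'(1)]] by simp
    qed
    moreover have "x = d *v (u k *v (w *v x))"
    proof -
      have "d *v (u k *v (w *v x)) = w' *v (inv\<^bsub>O41\<^esub> (u k) *v (u k *v (w *v x)))"
        unfolding d_def by (rule matrix_vector_mul_assoc[symmetric])
      also have "\<dots> = x" by (simp only: O41_inv_mult_vec(1)[OF uc] O41_inv_mult_vec(1)[OF wc] w'_def)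
      finally show ?thesis by simp
    qed
    moreover have "u k *v (w *v x) \<in> H4" using uc w(2) by (auto simp: chamber_def intro: O41_H4)
    moreover have "norm (u k *v (w *v x)) \<le> (\<Sum>k<n. \<bar>B k\<bar>)"
    proof -
      have "norm (u k *v (w *v x)) \<le> \<bar>B k\<bar>" using B[OF w(2), of k] by linarith
      also have "\<dots> \<le> (\<Sum>k<n. \<bar>B k\<bar>)" using k(1) by (intro member_le_sum) auto
      finally show ?thesis .
    qed
    ultimately show ?thesis by blast
  qed
  then show ?thesis by blast
qed

end

section \<open>Arithmeticity of the orbifold\<close>

text \<open>The quadratic form is diagonalized by completing squares in the order $x_2$, $x_1$,
  $x_0$, along the chain $3, 2, 1, 0, 4$ of the diagram; the remaining form in $x_3, x_4$ is
  nonnegative because $8000/28119 \le \sqrt 2 \le a + 8000/28119$. The slack $1/20$ is small enough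
  for this and keeps the fractions short.\<close>

lemma conjugate_lanner_form_definite:
  "1/20 * (x \<bullet> x) \<le> x \<bullet> (form_matrix lanner_C0 lanner_C1 (- sqrt 2) *v x)"
proof -
  define s where "s = sqrt 2"
  have s: "s \<le> 71/50" "1 \<le> s" unfolding s_def by (rule real_le_lsqrt; simp add: power2_eq_square) simp
  have C: "form_matrix lanner_C0 lanner_C1 (- s) $ i $ j = of_int (lanner_C0 i j) - s * of_int (lanner_C1 i j)" for i j
    by (simp add: form_matrix_def)
  obtain x0 x1 x2 x3 x4 where x: "x $ 0 = x0" "x $ 1 = x1" "x $ 2 = x2" "x $ 3 = x3" "x $ 4 = x4" by blast
  have Q: "x \<bullet> (form_matrix lanner_C0 lanner_C1 (- s) *v x)
    = 2 * (x0\<^sup>2 + x1\<^sup>2 + x2\<^sup>2 + x3\<^sup>2 + x4\<^sup>2) - 2 * (x0*x1 + x1*x2 + x2*x3 + x0*x4) + 2 * s * (x3*x4)"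
    by (simp add: inner_vec_def sum_UNIV_5 matrix_vector_mult_def C lanner_C0_def lanner_C1_def x set_eq_subset
        power2_eq_square algebra_simps)
  have xx: "x \<bullet> x = x0\<^sup>2 + x1\<^sup>2 + x2\<^sup>2 + x3\<^sup>2 + x4\<^sup>2"
    by (simp add: inner_vec_def sum_UNIV_5 x power2_eq_square)
  define b where "b = s - 8000/28119"
  define a where "a = (648241/562380 :: real)"
  have ab: "0 \<le> b" "b \<le> a" using s by (simp_all add: a_def b_def)
  have "2 * (x0\<^sup>2 + x1\<^sup>2 + x2\<^sup>2 + x3\<^sup>2 + x4\<^sup>2) - 2 * (x0*x1 + x1*x2 + x2*x3 + x0*x4) + 2 * s * (x3*x4)
      - 1/20 * (x0\<^sup>2 + x1\<^sup>2 + x2\<^sup>2 + x3\<^sup>2 + x4\<^sup>2)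
    = 39/20 * (x2 - 20/39 * x1 - 20/39 * x3)\<^sup>2 + 1121/780 * (x1 - 780/1121 * x0 - 400/1121 * x3)\<^sup>2
      + 28119/22420 * (x0 - 8000/28119 * x3 - 22420/28119 * x4)\<^sup>2
      + (a - b) * x3\<^sup>2 + (a - b) * x4\<^sup>2 + b * (x3 + x4)\<^sup>2"
    unfolding a_def b_def by (simp add: power2_eq_square field_simps)
  also have "\<dots> \<ge> 0" using ab by simp
  finally show ?thesis unfolding s_def[symmetric] Q xx by simp
qed

theorem corollary1p4:
  fixes v :: "5 \<Rightarrow> real^5" and \<Gamma> :: "(real^5^5) set"
  assumes "lanner_simplex v"
    and "uniformizes_O v \<Gamma>"
  shows "arithmetic_lattice \<Gamma>"
proof -
  define n where "n = outer_normal v"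
  interpret S: hyperbolic_simplex v n
    unfolding n_def using assms(1) by (intro normals_exist) (auto simp: lanner_simplex_def)
  have \<Gamma>: "subgroup \<Gamma> O41" and disc: "discrete \<Gamma>" using assms(2) by (auto simp: uniformizes_O_def)
  have proper: "properly_discontinuous \<Gamma>" using \<Gamma> disc by (rule properly_discontinuous_if_discrete)
  obtain h where h: "homeomorphic_map complex_M (H4_mod \<Gamma>) h"
      "\<forall>j<60. \<exists>g\<in>carrier O41. \<forall>t\<in>std_simplex. h (glue_class (j, t)) = orbit_of \<Gamma> (g *v simplex_map v t)"
    using assms(2) by (auto simp: uniformizes_O_def)
  then obtain g where g: "\<And>j. j < 60 \<Longrightarrow> g j \<in> carrier O41"
      "\<And>j t. j < 60 \<Longrightarrow> t \<in> std_simplex \<Longrightarrow> h (glue_class (j, t)) = orbit_of \<Gamma> (g j *v simplex_map v t)"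
    by metis
  have "topspace complex_M = glue_class ` simplices"
    using quotient_imp_surjective_map[OF quotient_map_quotient_topology[of "top_of_set simplices" glue_class]]
    by (simp add: complex_M_def)
  then have inj: "inj_on h (glue_class ` simplices)" using homeomorphic_imp_injective_map[OF h(1)] by simp
  have nb: "\<exists>A\<in>\<Gamma>. g j ** reflection (n i) = A ** g (facet_neighbour j i)" if "j < 60" for j i
    using \<Gamma> proper inj g that by (rule S.neighbouring_lifts)
  have g0: "g 0 \<in> carrier O41" using g(1) by simp
  \<comment> \<open>the simplex is moved to its lift by \<open>g 0\<close>, so that the new placements \<open>f j\<close> start with the identity\<close>
  define e where "e i = g 0 *v n i" for i
  interpret T: hyperbolic_simplex "\<lambda>i. g 0 *v v i" e
    unfolding e_def using g0 by (rule S.isometric_image)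
  define f where "f j = g j ** inv\<^bsub>O41\<^esub> (g 0)" for j
  have f: "f j \<in> carrier O41" if "j < 60" for j
    using O41.m_closed[OF g(1)[OF that] O41.inv_closed[OF g0]] by (simp add: f_def)
  have f0: "f 0 = mat 1" using O41.r_inv[OF g0] by (simp add: f_def)
  have nbf: "\<exists>k<60. \<exists>A\<in>\<Gamma>. f j ** reflection (e i) = A ** f k" if j: "j < 60" for j i
  proof -
    obtain A where A: "A \<in> \<Gamma>" "g j ** reflection (n i) = A ** g (facet_neighbour j i)" using nb[OF j] by blast
    have "reflection (e i) = g 0 ** reflection (n i) ** inv\<^bsub>O41\<^esub> (g 0)"
    proof -
      have "reflection (e i) = reflection (e i) ** (g 0 ** inv\<^bsub>O41\<^esub> (g 0))" using O41.r_inv[OF g0] by simp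
      also have "\<dots> = (reflection (e i) ** g 0) ** inv\<^bsub>O41\<^esub> (g 0)" by (rule matrix_mul_assoc)
      finally show ?thesis by (simp add: e_def reflection_conj[OF g0])
    qed
    then have "f j ** reflection (e i) = g j ** (inv\<^bsub>O41\<^esub> (g 0) ** g 0) ** reflection (n i) ** inv\<^bsub>O41\<^esub> (g 0)"
      by (simp only: f_def matrix_mul_assoc)
    also have "\<dots> = g j ** reflection (n i) ** inv\<^bsub>O41\<^esub> (g 0)" using O41.l_inv[OF g0] by simp
    also have "\<dots> = A ** f (facet_neighbour j i)" by (simp only: A(2) f_def matrix_mul_assoc)
    finally show ?thesis using A(1) facet_neighbour_props[OF j] by blast
  qed
  \<comment> \<open>the factor \<open>sqrt 2\<close> doubles the Gram matrix, which makes its entries algebraic integers\<close>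
  define E :: "real^5^5" where "E = (\<chi> a i. sqrt 2 * e i $ a)"
  have E: "E *v x = (\<Sum>i\<in>UNIV. (sqrt 2 * x $ i) *\<^sub>R e i)" for x
    by (simp add: E_def vec_eq_iff matrix_vector_mult_def mult_ac)
  have Eaxis: "E *v axis i 1 = sqrt 2 *\<^sub>R e i" for i
    by (simp add: E_def vec_eq_iff matrix_vector_mul_component inner_axis)
  have "x = 0" if "E *v x = 0" for x
  proof -
    have "x $ i = 0" for i
    proof -
      have "0 = lorentz (E *v x) (g 0 *v v i)" using that by simp
      also have "\<dots> = (\<Sum>j\<in>UNIV. sqrt 2 * x $ j * lorentz (e j) (g 0 *v v i))" by (simp add: E lorentz_sum)
      also have "\<dots> = (\<Sum>j\<in>{i}. sqrt 2 * x $ j * lorentz (e j) (g 0 *v v i))"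
        by (rule sum.mono_neutral_right) (auto simp: T.normal_orthogonal)
      finally show ?thesis using T.normal_outward[of i] by simp
    qed
    then show ?thesis by (simp add: vec_eq_iff)
  qed
  then obtain F where FE: "F ** E = mat 1" by (metis matrix_left_invertible_ker)
  have form: "transpose E ** eta ** E = form_matrix lanner_C0 lanner_C1 (sqrt 2)"
  proof -
    have "(transpose E ** eta ** E) $ i $ j = form_matrix lanner_C0 lanner_C1 (sqrt 2) $ i $ j" for i j
    proof -
      have "(transpose E ** eta ** E) $ i $ j = axis i 1 \<bullet> ((transpose E ** eta ** E) *v axis j 1)"
        by (simp add: inner_axis' matrix_vector_mul_component inner_axis)
      also have "\<dots> = lorentz (E *v axis i 1) (E *v axis j 1)"
        by (simp add: lorentz_inner inner_mult_vec matrix_vector_mul_assoc matrix_mul_assoc)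
      also have "\<dots> = 2 * lorentz (n i) (n j)" by (simp add: Eaxis e_def O41_lorentz[OF g0])
      also have "\<dots> = form_matrix lanner_C0 lanner_C1 (sqrt 2) $ i $ j"
        using lanner_gram[OF assms(1)] by (simp add: n_def form_matrix_def)
      finally show ?thesis .
    qed
    then show ?thesis by (simp add: vec_eq_iff)
  qed
  interpret U: conjugate_forms lanner_C0 lanner_C1 E F "1/20"
    by standard (use FE form conjugate_lanner_form_definite in auto)
  have refl: "reflection (e i) \<in> U.arithmetic_group" for i
  proof -
    have "reflection ((1 / sqrt 2) *\<^sub>R (E *v axis i 1)) \<in> U.arithmetic_group"
      by (rule U.reflection_in_arithmetic_group) (auto simp: lanner_C0_def lanner_C1_def insert_commute set_eq_subset)
    then show ?thesis by (simp add: Eaxis)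
  qed
  obtain R where R: "\<forall>x\<in>H4. \<exists>B\<in>\<Gamma> \<inter> U.arithmetic_group. \<exists>y\<in>H4. norm y \<le> R \<and> x = B *v y"
    using T.common_subgroup_cobounded[OF \<Gamma> U.arithmetic_group_subgroup U.arithmetic_group_properly_discontinuous refl f _ f0 nbf]
    by auto
  have "subgroup (\<Gamma> \<inter> U.arithmetic_group) O41"
    using \<Gamma> U.arithmetic_group_subgroup by (rule O41.subgroups_Inter_pair)
  then have "commensurable O41 \<Gamma> U.arithmetic_group"
    unfolding commensurable_def
    using R by (intro conjI finite_index_if_cobounded[where R=R] \<Gamma> proper U.arithmetic_group_subgroup U.arithmetic_group_properly_discontinuous) auto
  then have "arithmetic_subgroup O41 \<Gamma>" by (rule U.arithmetic_subgroup_if_commensurable[OF \<Gamma>])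
  moreover have "\<exists>B\<in>\<Gamma>. \<exists>y\<in>H4. norm y \<le> R \<and> x = B *v y" if "x \<in> H4" for x
    using bspec[OF R that] by blast
  then have "hyperbolic_lattice \<Gamma>"
    unfolding hyperbolic_lattice_def
    using \<Gamma> disc finite_covolume_if_cobounded[of \<Gamma> R] by blast
  ultimately show ?thesis by (simp add: arithmetic_lattice_def)
qed

end
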